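(* Let $V$ be a complex vector space with basis $x_1,\dots,x_n$, let $\mathcal C'\subset\mathcal C$ be finite subgroups of $\mathbb C^\times$ with $-1\in\mathcal C$, let $c\colon\mathcal C'\to\mathbb C$, $\varepsilon'\mapsto c_{\varepsilon'}$, be a function, and let $W=W_{\mathcal C,\mathcal C'}$. Let $\underline{\mathcal H}_c(W)\cong S_{-\mathbf 1}(V)\otimes\mathbb CW\otimes S_{-\mathbf 1}(V^* )$ be the negative braided Cherednik algebra, and let $M_{\mathit{triv}}$ be its Verma module induced from the trivial representation of $W$, i.e. induced from the one-dimensional representation of the subalgebra $\mathbb CW\otimes S_{-\mathbf 1}(V^* )$ in which every $w\in W$ acts by $1$ and every $y_i$ acts by $0$; identify $M_{\mathit{triv}}$ with $S_{-\mathbf 1}(V)$ via the triangular decomposition. Then each generator $y_i$ ($i=1,\dots,n$) acts on $M_{\mathit{triv}}=S_{-\mathbf 1}(V)$ by the braided Dunkl operator $$\underline\nabla_i=\underline\partial_i+c_1\sum_{j\ne i,\ \varepsilon\in\mathcal C}\frac{x_i+\varepsilon x_j}{x_i^2-\varepsilon^2x_j^2}(1-\sigma_{ij}^{(\varepsilon)})+\sum_{\varepsilon'\in\mathcal C'\setminus\{1\}}\frac{c_{\varepsilon'}}{1-\varepsilon'}\cdot\frac1{x_i}(1-t_i^{(\varepsilon')}).$$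
   Context: $S_{-\mathbf 1}(V)=\mathbb C\langle x_1,\dots,x_n\mid x_ix_j=-x_jx_i\ (i\neq j)\rangle$, similarly $S_{-\mathbf 1}(V^* )$ with generators the dual basis $y_1,\dots,y_n$ of $V^*$. For $\varepsilon\in\mathbb C^\times$, $i\ne j$: $t_i^{(\varepsilon)}(x_k)=x_k$ for $k\ne i$, $t_i^{(\varepsilon)}(x_i)=\varepsilon x_i$; $\sigma_{ij}^{(\varepsilon)}(x_k)=x_k$ for $k\notin\{i,j\}$, $\sigma_{ij}^{(\varepsilon)}(x_i)=\varepsilon x_j$, $\sigma_{ij}^{(\varepsilon)}(x_j)=-\varepsilon^{-1}x_i$ (elements of $\mathrm{GL}(V)$, also viewed as algebra automorphisms of $S_{-\mathbf 1}(V)$). $W_{\mathcal C,\mathcal C'}\subset\mathrm{GL}(V)$ is generated by all $\sigma_{ij}^{(\varepsilon)}$, $\varepsilon\in\mathcal C$, and $t_i^{(\varepsilon')}$, $\varepsilon'\in\mathcal C'$. The negative braided Cherednik algebra $\underline{\mathcal H}_c(W)$ is generated by $V$, $W$, $V^*$ with relations: those of the group $W$; $x_ix_j+x_jx_i=y_iy_j+y_jy_i=0$ for $i\ne j$; $wx_iw^{-1}=w(x_i)$, $wy_iw^{-1}=w(y_i)$ for $w\in W$ (contragredient action on $V^*$); $y_jx_i+x_iy_j=c_1\sum_{\varepsilon\in\mathcal C}\varepsilon\sigma_{ij}^{(\varepsilon)}$ for $i\ne j$; $y_ix_i-x_iy_i=1+c_1\sum_{j\ne i,\,\varepsilon\in\mathcal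 C}\sigma_{ij}^{(\varepsilon)}+\sum_{\varepsilon'\in\mathcal C'\setminus\{1\}}c_{\varepsilon'}t_i^{(\varepsilon')}$. It has the triangular decomposition $S_{-\mathbf 1}(V)\otimes\mathbb CW\otimes S_{-\mathbf 1}(V^* )$, i.e. the multiplication map from this tensor product of subalgebras to $\underline{\mathcal H}_c(W)$ is a linear bijection. The braided derivative is $\underline\partial_i(x_1^{a_1}\cdots x_n^{a_n})=a_i(-1)^{a_1+\cdots+a_{i-1}}x_1^{a_1}\cdots x_i^{a_i-1}\cdots x_n^{a_n}$; fractions denote multiplication in the skew-field of fractions of $S_{-\mathbf 1}(V)$ (the $x_i^2$ are central).
   Formalization: With the printed sign of y_jx_i+x_iy_j=c_1Σεσ_ij, every x_i vanishes in M_triv if c_1≠0, n≥2. The theorem treats both signs ±: y_i acts by the Dunkl operator in each case, but injectivity of S_{-1}(V)→M_triv is claimed only for sign −, or c_1=0, or n=1. *)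

theory Defs
  imports
    "HOL-Analysis.Determinants"
    "HOL-Library.Poly_Mapping"
    "HOL-Algebra.QuotRing"
    "HOL-Algebra.Generated_Groups"
begin

section \<open>Free algebras and algebras given by a presentation\<close>

datatype 'g word = Word (letters: "'g list")

instantiation word :: (type) monoid_add
begin
definition zero_word :: "'a word" where "zero_word = Word []"
definition plus_word :: "'a word \<Rightarrow> 'a word \<Rightarrow> 'a word" where
  "plus_word u v = Word (letters u @ letters v)"
instance by standard (simp_all add: zero_word_def plus_word_def)
end

text \<open>Words form a monoid under concatenation, written additively to fit \<^theory>\<open>HOL-Library.Poly_Mapping\<close>,
  whose convolution product makes the following type the free algebra \<open>\<complex>\<langle>g | g :: 'g\<rangle>\<close>.\<close>

type_synonym 'g free_alg = "'g word \<Rightarrow>\<^sub>0 complex"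

definition cst :: "complex \<Rightarrow> 'g free_alg" where
  "cst z = Poly_Mapping.single 0 z"

definition var :: "'g \<Rightarrow> 'g free_alg" where
  "var g = Poly_Mapping.single (Word [g]) 1"

text \<open>The unital algebra homomorphism from the free algebra that sends each letter \<open>g\<close> to \<open>h g\<close>;
  \<open>s\<close> is the structure map of the target \<open>\<complex>\<close>-algebra.\<close>

definition free_eval :: "(complex \<Rightarrow> 'r::ring_1) \<Rightarrow> ('g \<Rightarrow> 'r) \<Rightarrow> 'g free_alg \<Rightarrow> 'r" where
  "free_eval s h p =
     (\<Sum>u\<in>Poly_Mapping.keys p. s (Poly_Mapping.lookup p u) * prod_list (map h (letters u)))"

text \<open>The free algebra on a set \<open>A\<close> of letters, and its quotient by the two-sided ideal generated
  by a set \<open>R\<close> of relators.\<close>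

definition free_ring :: "'g set \<Rightarrow> 'g free_alg ring" where
  "free_ring A =
     \<lparr>carrier = {p. \<forall>u\<in>Poly_Mapping.keys p. set (letters u) \<subseteq> A},
      mult = (*), one = 1, zero = 0, add = (+)\<rparr>"

definition presented :: "'g set \<Rightarrow> 'g free_alg set \<Rightarrow> 'g free_alg set ring" where
  "presented A R = free_ring A Quot (genideal (free_ring A) R)"

definition cls :: "'g set \<Rightarrow> 'g free_alg set \<Rightarrow> 'g free_alg \<Rightarrow> 'g free_alg set" where
  "cls A R p = genideal (free_ring A) R +>\<^bsub>free_ring A\<^esub> p"

lemma keys_times_letters:
  assumes "\<forall>u\<in>Poly_Mapping.keys p. set (letters u) \<subseteq> A"
    and "\<forall>u\<in>Poly_Mapping.keys q. set (letters u) \<subseteq> A"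
  shows "\<forall>u\<in>Poly_Mapping.keys (p * q). set (letters u) \<subseteq> A"
proof
  fix u assume "u \<in> Poly_Mapping.keys (p * q)"
  then obtain v w where "v \<in> Poly_Mapping.keys p" "w \<in> Poly_Mapping.keys q" "u = v + w"
    using keys_mult[of p q] by blast
  with assms show "set (letters u) \<subseteq> A" by (auto simp: plus_word_def)
qed

lemma ring_free_ring: "ring (free_ring A)"
proof (rule ringI)
  show "abelian_group (free_ring A)"
  proof (rule abelian_groupI)
    fix p q assume "p \<in> carrier (free_ring A)" "q \<in> carrier (free_ring A)"
    then show "p \<oplus>\<^bsub>free_ring A\<^esub> q \<in> carrier (free_ring A)"
      using Poly_Mapping.keys_add[of p q] by (auto simp: free_ring_def)
  next
    fix p assume "p \<in> carrier (free_ring A)"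
    then show "\<exists>q\<in>carrier (free_ring A). q \<oplus>\<^bsub>free_ring A\<^esub> p = \<zero>\<^bsub>free_ring A\<^esub>"
      by (intro bexI[of _ "- p"]) (auto simp: free_ring_def)
  qed (simp_all add: free_ring_def add.assoc add.commute)
  show "Group.monoid (free_ring A)"
  proof (rule monoidI)
    fix p q assume "p \<in> carrier (free_ring A)" "q \<in> carrier (free_ring A)"
    then show "p \<otimes>\<^bsub>free_ring A\<^esub> q \<in> carrier (free_ring A)"
      using keys_times_letters[of p A q] by (simp add: free_ring_def)
  qed (simp_all add: free_ring_def mult.assoc zero_word_def)
qed (simp_all add: free_ring_def distrib_left distrib_right)

section \<open>The skew polynomial algebra \<open>S\<^sub>-\<^sub>1(V)\<close>\<close>

text \<open>The linearly ordered finite index type \<open>'n\<close> plays the role of \<open>{1,...,n}\<close>; \<open>V\<close> is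
  \<^typ>\<open>complex ^ 'n\<close> with \<open>x\<^sub>1,...,x\<^sub>n\<close> the standard basis.\<close>

definition skew_relators :: "'n free_alg set" where
  "skew_relators = {var i * var j + var j * var i | i j. i \<noteq> j}"

definition skew_ideal :: "'n free_alg set" where
  "skew_ideal = genideal (free_ring UNIV) skew_relators"

lemma skew_ideal_ideal: "ideal skew_ideal (free_ring UNIV)"
  unfolding skew_ideal_def
  by (rule ring.genideal_ideal[OF ring_free_ring]) (simp add: free_ring_def)

lemma skew_ideal_zero: "0 \<in> skew_ideal"
  using additive_subgroup.zero_closed[OF ideal.axioms(1)[OF skew_ideal_ideal]]
  by (simp add: free_ring_def)

lemma skew_ideal_add: "p \<in> skew_ideal \<Longrightarrow> q \<in> skew_ideal \<Longrightarrow> p + q \<in> skew_ideal"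
  using additive_subgroup.a_closed[OF ideal.axioms(1)[OF skew_ideal_ideal]]
  by (simp add: free_ring_def)

lemma skew_ideal_lmult: "p \<in> skew_ideal \<Longrightarrow> q * p \<in> skew_ideal"
  using ideal.I_l_closed[OF skew_ideal_ideal, of p q] by (simp add: free_ring_def)

lemma skew_ideal_rmult: "p \<in> skew_ideal \<Longrightarrow> p * q \<in> skew_ideal"
  using ideal.I_r_closed[OF skew_ideal_ideal, of p q] by (simp add: free_ring_def)

lemma skew_ideal_uminus: "p \<in> skew_ideal \<Longrightarrow> - p \<in> skew_ideal"
  using skew_ideal_lmult[of p "- 1"] by simp

lemma skew_ideal_diff: "p \<in> skew_ideal \<Longrightarrow> q \<in> skew_ideal \<Longrightarrow> p - q \<in> skew_ideal"
  using skew_ideal_add[OF _ skew_ideal_uminus, of p q] by simp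

quotient_type 'n spoly = "'n free_alg" / "\<lambda>p q. p - q \<in> skew_ideal"
proof (rule equivpI)
  show "reflp (\<lambda>p q. p - q \<in> skew_ideal)" by (simp add: reflp_def skew_ideal_zero)
  show "symp (\<lambda>p q. p - q \<in> skew_ideal)"
  proof (rule sympI)
    fix p q :: "'a free_alg" assume "p - q \<in> skew_ideal"
    from skew_ideal_uminus[OF this] show "q - p \<in> skew_ideal" by simp
  qed
  show "transp (\<lambda>p q. p - q \<in> skew_ideal)"
  proof (rule transpI)
    fix p q r :: "'a free_alg" assume "p - q \<in> skew_ideal" "q - r \<in> skew_ideal"
    from skew_ideal_add[OF this] show "p - r \<in> skew_ideal" by simp
  qed
qed

instantiation spoly :: (type) ring
begin
lift_definition zero_spoly :: "'a spoly" is 0 .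
lift_definition plus_spoly :: "'a spoly \<Rightarrow> 'a spoly \<Rightarrow> 'a spoly" is "(+)"
  by (subst add_diff_add) (rule skew_ideal_add)
lift_definition uminus_spoly :: "'a spoly \<Rightarrow> 'a spoly" is uminus
  by (subst minus_diff_minus) (rule skew_ideal_uminus)
lift_definition minus_spoly :: "'a spoly \<Rightarrow> 'a spoly \<Rightarrow> 'a spoly" is "(-)"
proof -
  fix p p' q q' :: "'a free_alg"
  assume "p - p' \<in> skew_ideal" "q - q' \<in> skew_ideal"
  from skew_ideal_diff[OF this] show "(p - q) - (p' - q') \<in> skew_ideal"
    by (simp add: algebra_simps)
qed
lift_definition times_spoly :: "'a spoly \<Rightarrow> 'a spoly \<Rightarrow> 'a spoly" is "(*)"
proof -
  fix p p' q q' :: "'a free_alg"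
  assume "p - p' \<in> skew_ideal" "q - q' \<in> skew_ideal"
  then have "(p - p') * q + p' * (q - q') \<in> skew_ideal"
    by (intro skew_ideal_add skew_ideal_lmult skew_ideal_rmult)
  then show "p * q - p' * q' \<in> skew_ideal" by (simp add: algebra_simps)
qed
instance
proof
  fix a b c :: "'a spoly"
  show "a * b * c = a * (b * c)" by transfer (simp add: mult.assoc skew_ideal_zero)
  show "a + b + c = a + (b + c)" by transfer (simp add: add.assoc skew_ideal_zero)
  show "a + b = b + a" by transfer (simp add: add.commute skew_ideal_zero)
  show "0 + a = a" by transfer (simp add: skew_ideal_zero)
  show "- a + a = 0" by transfer (simp add: skew_ideal_zero)
  show "a - b = a + - b" by transfer (simp add: skew_ideal_zero)
  show "(a + b) * c = a * c + b * c" by transfer (simp add: distrib_right skew_ideal_zero)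
  show "a * (b + c) = a * b + a * c" by transfer (simp add: distrib_left skew_ideal_zero)
qed
end

text \<open>That \<open>0 \<noteq> 1\<close> in \<open>S\<^sub>-\<^sub>1(V)\<close> is seen by setting all \<open>x\<^sub>i\<close> to \<open>0\<close>.\<close>

lemma lookup_times_zero_word:
  fixes p q :: "'g free_alg"
  shows "Poly_Mapping.lookup (p * q) 0 = Poly_Mapping.lookup p 0 * Poly_Mapping.lookup q 0"
proof -
  have *: "(0::'g word) = l + r \<longleftrightarrow> l = 0 \<and> r = 0" for l r
    by (cases l; cases r) (auto simp: zero_word_def plus_word_def)
  have "(\<Sum>r. (f r when (0::'g word) = l + r)) = (f 0 when l = 0)" for l and f :: "'g word \<Rightarrow> complex"
    by (cases "l = 0") (simp_all add: * when_def)
  then show ?thesis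
    by (simp add: times_poly_mapping.rep_eq prod_fun_def mult_when)
qed

lemma skew_ideal_constant_term:
  assumes "p \<in> skew_ideal" shows "Poly_Mapping.lookup p 0 = 0"
proof -
  interpret F: ring "free_ring (UNIV :: 'a set)" by (rule ring_free_ring)
  let ?J = "{p :: 'a free_alg. Poly_Mapping.lookup p 0 = 0}"
  have inv: "\<ominus>\<^bsub>free_ring UNIV\<^esub> q = - q" for q :: "'a free_alg"
    by (rule F.minus_equality) (auto simp: free_ring_def)
  have "ideal ?J (free_ring UNIV)"
  proof (rule idealI)
    show "subgroup ?J (add_monoid (free_ring UNIV))"
    proof (rule F.add.subgroupI)
      fix q :: "'a free_alg" assume "q \<in> ?J"
      then show "\<ominus>\<^bsub>free_ring UNIV\<^esub> q \<in> ?J" by (simp add: inv)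
    qed (auto simp: free_ring_def lookup_add intro: exI[of _ 0])
  qed (rule ring_free_ring, simp_all add: free_ring_def lookup_times_zero_word)
  moreover have "Poly_Mapping.lookup (var g) 0 = 0" for g :: 'a
    by (simp add: var_def lookup_single zero_word_def)
  then have "skew_relators \<subseteq> ?J"
    by (auto simp: skew_relators_def lookup_add lookup_times_zero_word)
  ultimately have "skew_ideal \<subseteq> ?J"
    unfolding skew_ideal_def by (rule F.genideal_minimal)
  with assms show ?thesis by auto
qed

instantiation spoly :: (type) ring_1
begin
lift_definition one_spoly :: "'a spoly" is 1 .
instance
proof
  show "(0::'a spoly) \<noteq> 1"
  proof transfer
    show "(0::'a free_alg) - 1 \<notin> skew_ideal"
      using skew_ideal_constant_term[of "0 - (1::'a free_alg)"] by (auto simp: lookup_minus)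
  qed
qed (transfer; simp add: skew_ideal_zero)+
end

lift_definition const :: "complex \<Rightarrow> 'n spoly" is cst .
lift_definition sx :: "'n \<Rightarrow> 'n spoly" is var .

text \<open>The monomial \<open>x\<^sub>1\<^bsup>a\<^sub>1\<^esup> \<dots> x\<^sub>n\<^bsup>a\<^sub>n\<^esup>\<close>, with factors in increasing order of the indices.\<close>

definition smono :: "('n::{finite,linorder} \<Rightarrow> nat) \<Rightarrow> 'n spoly" where
  "smono a = prod_list (map (\<lambda>i. sx i ^ a i) (sorted_list_of_set UNIV))"

text \<open>These monomials are a \<open>\<complex>\<close>-basis of \<open>S\<^sub>-\<^sub>1(V)\<close>, so the braided derivative is the unique linear
  map with the given values. For \<open>a i = 0\<close> the coefficient vanishes, so truncated subtraction
  is harmless.\<close>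

definition braided_deriv :: "'n::{finite,linorder} \<Rightarrow> 'n spoly \<Rightarrow> 'n spoly" where
  "braided_deriv i = (THE D.
     (\<forall>f g. D (f + g) = D f + D g) \<and>
     (\<forall>z f. D (const z * f) = const z * D f) \<and>
     (\<forall>a. D (smono a) = of_nat (a i) * (- 1) ^ (\<Sum>j | j < i. a j) * smono (a(i := a i - 1))))"

text \<open>The algebra endomorphism of \<open>S\<^sub>-\<^sub>1(V)\<close> extending a linear map \<open>w\<close> of \<open>V\<close> (column \<open>k\<close> of the
  matrix being \<open>w(x\<^sub>k)\<close>). It is independent of the representative chosen by \<^const>\<open>rep_spoly\<close>
  whenever the \<open>w(x\<^sub>k)\<close> pairwise anticommute, in particular for the monomial matrices below.\<close>

definition skew_act :: "complex ^ 'n ^ 'n \<Rightarrow> 'n::finite spoly \<Rightarrow> 'n spoly" where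
  "skew_act w f =
     free_eval const (\<lambda>k. \<Sum>r\<in>UNIV. const (w $ r $ k) * sx r) (rep_spoly f)"

section \<open>The groups \<open>W\<^bsub>\<C>,\<C>'\<^esub>\<close>\<close>

definition cstar :: "complex monoid" where
  "cstar = \<lparr>carrier = - {0}, mult = (*), one = 1\<rparr>"

definition GL :: "(complex ^ 'n ^ 'n) monoid" where
  "GL = \<lparr>carrier = {A. invertible A}, mult = (**), one = mat 1\<rparr>"

text \<open>The matrix of the linear map \<open>x\<^sub>k \<mapsto> h k\<close>.\<close>

definition from_columns :: "('n \<Rightarrow> complex ^ 'n) \<Rightarrow> complex ^ 'n ^ 'n::finite" where
  "from_columns h = (\<chi> r k. h k $ r)"

definition refl_t :: "'n \<Rightarrow> complex \<Rightarrow> complex ^ 'n ^ 'n::finite" where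
  "refl_t i \<epsilon> = from_columns (\<lambda>k. if k = i then axis i \<epsilon> else axis k 1)"

definition refl_sigma :: "'n \<Rightarrow> 'n \<Rightarrow> complex \<Rightarrow> complex ^ 'n ^ 'n::finite" where
  "refl_sigma i j \<epsilon> = from_columns
     (\<lambda>k. if k = i then axis j \<epsilon> else if k = j then axis i (- inverse \<epsilon>) else axis k 1)"

definition Wgroup :: "complex set \<Rightarrow> complex set \<Rightarrow> (complex ^ 'n ^ 'n::finite) set" where
  "Wgroup C C' = generate GL
     ({refl_sigma i j \<epsilon> | i j \<epsilon>. i \<noteq> j \<and> \<epsilon> \<in> C} \<union> {refl_t i \<epsilon> | i \<epsilon>. \<epsilon> \<in> C'})"

section \<open>The negative braided Cherednik algebra and its Verma module\<close>

datatype ('n, 'w) gen = Xgen 'n | Wgen 'w | Ygen 'n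

abbreviation vX :: "'n \<Rightarrow> ('n, 'w) gen free_alg" where "vX i \<equiv> var (Xgen i)"
abbreviation vY :: "'n \<Rightarrow> ('n, 'w) gen free_alg" where "vY i \<equiv> var (Ygen i)"
abbreviation vW :: "'w \<Rightarrow> ('n, 'w) gen free_alg" where "vW w \<equiv> var (Wgen w)"

type_synonym 'n cher_gen = "('n, complex ^ 'n ^ 'n) gen"

definition cher_gens :: "complex set \<Rightarrow> complex set \<Rightarrow> 'n::finite cher_gen set" where
  "cher_gens C C' = range Xgen \<union> Wgen ` Wgroup C C' \<union> range Ygen"

text \<open>In the contragredient representation \<open>w(y\<^sub>i) = y\<^sub>i \<circ> w\<inverse> = \<Sum>\<^sub>k (w\<inverse>)\<^sub>i\<^sub>k y\<^sub>k\<close>.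

  The sign \<open>s\<close> in the relation for \<open>y\<^sub>j x\<^sub>i + x\<^sub>i y\<^sub>j\<close> is \<open>1\<close> in the usual display of this relation.
  With the conventions for \<open>\<sigma>\<^sub>i\<^sub>j\<close> and for the conjugation action used here, the triangular
  decomposition requires \<open>s = - 1\<close> (or, equivalently as \<open>- 1 \<in> \<C>\<close>, the inverses of the
  \<open>\<sigma>\<^sub>i\<^sub>j\<close> in that relation): expanding \<open>y\<^sub>j (x\<^sub>i x\<^sub>j + x\<^sub>j x\<^sub>i) = 0\<close> gives
  \<open>(1 + s) c\<^sub>1 (x\<^sub>i \<Sum>\<^sub>\<epsilon> \<sigma>\<^sub>i\<^sub>j - x\<^sub>j \<Sum>\<^sub>\<epsilon> \<epsilon> \<sigma>\<^sub>i\<^sub>j) = 0\<close>. Both signs are therefore covered.\<close>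

definition cher_relators ::
  "complex \<Rightarrow> complex set \<Rightarrow> complex set \<Rightarrow> (complex \<Rightarrow> complex) \<Rightarrow> 'n::finite cher_gen free_alg set"
where
  "cher_relators s C C' c =
     {vW v * vW w - vW (v ** w) | v w. v \<in> Wgroup C C' \<and> w \<in> Wgroup C C'} \<union>
     {vW (mat 1) - 1} \<union>
     {vX i * vX j + vX j * vX i | i j. i \<noteq> j} \<union>
     {vY i * vY j + vY j * vY i | i j. i \<noteq> j} \<union>
     {vW w * vX i * vW (matrix_inv w) - (\<Sum>k\<in>UNIV. cst (w $ k $ i) * vX k)
        | w i. w \<in> Wgroup C C'} \<union>
     {vW w * vY i * vW (matrix_inv w) - (\<Sum>k\<in>UNIV. cst (matrix_inv w $ i $ k) * vY k)
        | w i. w \<in> Wgroup C C'} \<union>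
     {vY j * vX i + vX i * vY j - cst (s * c 1) * (\<Sum>\<epsilon>\<in>C. cst \<epsilon> * vW (refl_sigma i j \<epsilon>))
        | i j. i \<noteq> j} \<union>
     {vY i * vX i - vX i * vY i
        - (1 + cst (c 1) * (\<Sum>j\<in>UNIV - {i}. \<Sum>\<epsilon>\<in>C. vW (refl_sigma i j \<epsilon>))
             + (\<Sum>\<epsilon>\<in>C' - {1}. cst (c \<epsilon>) * vW (refl_t i \<epsilon>)))
        | i. True}"

definition cherednik ::
  "complex \<Rightarrow> complex set \<Rightarrow> complex set \<Rightarrow> (complex \<Rightarrow> complex) \<Rightarrow> 'n::finite cher_gen free_alg set ring"
where
  "cherednik s C C' c = presented (cher_gens C C') (cher_relators s C C' c)"

definition cher_cls ::
  "complex \<Rightarrow> complex set \<Rightarrow> complex set \<Rightarrow> (complex \<Rightarrow> complex) \<Rightarrow>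
   'n::finite cher_gen free_alg \<Rightarrow> 'n cher_gen free_alg set"
where
  "cher_cls s C C' c = cls (cher_gens C C') (cher_relators s C C' c)"

text \<open>The trivial character of \<open>\<complex>W \<otimes> S\<^sub>-\<^sub>1(V\<^sup>*)\<close>, on polynomials in the letters \<open>w\<close> and \<open>y\<^sub>i\<close>.\<close>

definition triv_char :: "('n, 'w) gen free_alg \<Rightarrow> complex" where
  "triv_char = free_eval id (\<lambda>g. case g of Wgen w \<Rightarrow> 1 | _ \<Rightarrow> 0)"

text \<open>\<open>M\<^sub>t\<^sub>r\<^sub>i\<^sub>v = H \<otimes>\<^sub>B \<complex>\<close> for \<open>B = \<complex>W \<otimes> S\<^sub>-\<^sub>1(V\<^sup>*)\<close> is the quotient of \<open>H = H \<otimes> \<complex>\<close> by the additive span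
  of all \<open>h b - h \<chi>(b)\<close>, where \<open>\<chi>\<close> is the trivial character.\<close>

definition verma_sub ::
  "complex \<Rightarrow> complex set \<Rightarrow> complex set \<Rightarrow> (complex \<Rightarrow> complex) \<Rightarrow> 'n::finite cher_gen free_alg set set"
where
  "verma_sub s C C' c =
     (let H = cherednik s C C' c; cl = cher_cls s C C' c in
      generate (add_monoid H)
        {(h \<otimes>\<^bsub>H\<^esub> cl b) \<ominus>\<^bsub>H\<^esub> (h \<otimes>\<^bsub>H\<^esub> cl (cst (triv_char b))) | h b.
           h \<in> carrier H \<and> b \<in> carrier (free_ring (Wgen ` Wgroup C C' \<union> range Ygen))})"

definition verma ::
  "complex \<Rightarrow> complex set \<Rightarrow> complex set \<Rightarrow> (complex \<Rightarrow> complex) \<Rightarrow> 'n::finite cher_gen free_alg set set set"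
where
  "verma s C C' c = a_rcosets\<^bsub>cherednik s C C' c\<^esub> verma_sub s C C' c"

definition verma_act ::
  "complex \<Rightarrow> complex set \<Rightarrow> complex set \<Rightarrow> (complex \<Rightarrow> complex) \<Rightarrow>
   'n::finite cher_gen free_alg set \<Rightarrow> 'n cher_gen free_alg set set \<Rightarrow> 'n cher_gen free_alg set set"
where
  "verma_act s C C' c h m =
     (\<Union>k\<in>m. verma_sub s C C' c +>\<^bsub>cherednik s C C' c\<^esub> (h \<otimes>\<^bsub>cherednik s C C' c\<^esub> k))"

text \<open>The linear map \<open>S\<^sub>-\<^sub>1(V) \<rightarrow> H \<rightarrow> M\<^sub>t\<^sub>r\<^sub>i\<^sub>v\<close>, \<open>f \<mapsto> f \<otimes> 1 \<otimes> 1 \<mapsto> f \<cdot> 1\<close>, by which \<open>M\<^sub>t\<^sub>r\<^sub>i\<^sub>v\<close> is identified with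
  \<open>S\<^sub>-\<^sub>1(V)\<close>.\<close>

definition verma_of ::
  "complex \<Rightarrow> complex set \<Rightarrow> complex set \<Rightarrow> (complex \<Rightarrow> complex) \<Rightarrow>
   'n::finite spoly \<Rightarrow> 'n cher_gen free_alg set set"
where
  "verma_of s C C' c f =
     verma_sub s C C' c +>\<^bsub>cherednik s C C' c\<^esub> cher_cls s C C' c (free_eval cst vX (rep_spoly f))"

section \<open>Braided Dunkl operators\<close>

definition skew_field_of_fractions :: "('a::ring_1 \<Rightarrow> 'k::division_ring) \<Rightarrow> bool" where
  "skew_field_of_fractions \<phi> \<longleftrightarrow>
     \<phi> 1 = 1 \<and> (\<forall>a b. \<phi> (a + b) = \<phi> a + \<phi> b) \<and> (\<forall>a b. \<phi> (a * b) = \<phi> a * \<phi> b) \<and> inj \<phi> \<and>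
     (\<forall>k. \<exists>a b. b \<noteq> 0 \<and> k = \<phi> a / \<phi> b) \<and> (\<forall>k. \<exists>a b. b \<noteq> 0 \<and> k = inverse (\<phi> b) * \<phi> a)"

text \<open>The values lie a priori only in the skew field of fractions. Recall that \<open>a / b = a * inverse b\<close>;
  the denominators \<open>x\<^sub>i\<^sup>2 - \<epsilon>\<^sup>2 x\<^sub>j\<^sup>2\<close> are central.\<close>

definition braided_dunkl ::
  "('n::{finite,linorder} spoly \<Rightarrow> 'k::division_ring) \<Rightarrow> complex set \<Rightarrow> complex set \<Rightarrow>
   (complex \<Rightarrow> complex) \<Rightarrow> 'n \<Rightarrow> 'n spoly \<Rightarrow> 'k"
where
  "braided_dunkl \<phi> C C' c i f =
     \<phi> (braided_deriv i f)
     + \<phi> (const (c 1)) * (\<Sum>j\<in>UNIV - {i}. \<Sum>\<epsilon>\<in>C.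
         \<phi> (sx i + const \<epsilon> * sx j) / \<phi> ((sx i)\<^sup>2 - const (\<epsilon>\<^sup>2) * (sx j)\<^sup>2)
           * \<phi> (f - skew_act (refl_sigma i j \<epsilon>) f))
     + (\<Sum>\<epsilon>\<in>C' - {1}. \<phi> (const (c \<epsilon> / (1 - \<epsilon>))) * (1 / \<phi> (sx i)) * \<phi> (f - skew_act (refl_t i \<epsilon>) f))"

end

theory Submission
  imports Defs
begin

text \<open>The braided Dunkl operators \<open>D\<^sub>i\<close> preserve \<open>S\<^sub>-\<^sub>1(V)\<close> and are determined there by \<open>D\<^sub>i 1 = 0\<close> and their
  commutation rules with multiplication by the \<open>x\<^sub>k\<close>: the non-polynomial contributions of \<open>\<epsilon>\<close> and \<open>- \<epsilon>\<close>
  to these rules cancel, and what remains are the defining relations between \<open>y\<^sub>i\<close> and \<open>x\<^sub>k\<close> for \<open>s = - 1\<close>.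
  Since \<open>y\<^sub>i\<close> kills the cyclic vector of the Verma module, \<open>y\<^sub>i\<close> acts by \<open>D\<^sub>i\<close>. For \<open>s = 1\<close> the relations force
  \<open>c\<^sub>1 x\<^sub>k\<close> to act by \<open>0\<close> when there are at least two indices, so that the sign does not matter.
  Conversely the rules imply, by induction on the degree, that the \<open>D\<^sub>i\<close> are \<open>W\<close>-equivariant and
  anticommute; so multiplications, \<open>W\<close> and the \<open>D\<^sub>i\<close> represent the Cherednik algebra on \<open>S\<^sub>-\<^sub>1(V)\<close>, and
  evaluating this representation at \<open>1\<close> inverts the map \<open>f \<mapsto> f \<cdot> 1\<close> to the Verma module.\<close>

section \<open>Actions of free algebras\<close>

text \<open>Moving D_i past x_i or x_j leaves, up to sign, a fraction with numerator 2 \<epsilon>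
  x_i x_j f or 2 \<epsilon> x_j^2 f; its denominator contains only \<epsilon>^2, so it is odd in
  \<epsilon>. What survives of sigma_ij in D_i x_j is \<Sum> \<epsilon>^(-1) sigma_ij^(\<epsilon>).
  Because sigma_ij^(\<epsilon>) = sigma_ji^(-1/\<epsilon>), this equals - \<Sum> \<epsilon>
  sigma_ji^(\<epsilon>), and that minus is the origin of \<open>s = - 1\<close>. For
  \<open>s = 1\<close>, comparing y_j with D_j on x_k x_j + x_j x_k = 0 gives 2 |C| c_1 x_k . 1 = 0.
  So for c_1 \<noteq> 0 and two or more indices f \<mapsto> f . 1 is not injective, whence the
  condition in the theorem. The formula for y_i survives because \<Sum> \<epsilon>
  sigma_ij^(\<epsilon>) takes values without constant term, as the elements of \<open>C\<close> sum
  to 0. The obstacle is a pair of nested quotients with chosen representatives. Computations in the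
  Verma module are pulled back to the free algebra modulo a left ideal \<open>J\<close>; statements
  about S_{-1}(V) go by induction over 1, sums, scalars and left multiplication by generators, so
  ordered monomials serve only to identify \<open>braided_deriv\<close>.\<close>

lemma poly_mapping_single_induct [case_names zero single add]:
  fixes p :: "'a \<Rightarrow>\<^sub>0 'b::comm_monoid_add"
  assumes "P 0" and "\<And>u z. P (Poly_Mapping.single u z)" and "\<And>p q. P p \<Longrightarrow> P q \<Longrightarrow> P (p + q)"
  shows "P p"
proof (induction p rule: update_induct)
  case const
  show ?case by (rule assms(1))
next
  case (update p k b)
  have "Poly_Mapping.update k b p = p + Poly_Mapping.single k b"
    using update(1)
    by (intro poly_mapping_eqI)
       (auto simp: lookup_update lookup_add lookup_single when_def in_keys_iff)
  with update.IH assms(2,3) show ?case by metis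
qed

text \<open>\<open>free_eval\<close> wants a ring as target, whereas the actions below are on pairs
  and by operators. Here letters act by arbitrary maps of an abelian group, the last letter of a
  word first; with left multiplications as letters this recovers \<open>free_eval\<close>.\<close>

definition word_act ::
  "(complex \<Rightarrow> 'm \<Rightarrow> 'm) \<Rightarrow> ('g \<Rightarrow> 'm \<Rightarrow> 'm) \<Rightarrow> 'g free_alg \<Rightarrow> 'm \<Rightarrow> 'm::comm_monoid_add"
where
  "word_act sm h p v =
     (\<Sum>u\<in>Poly_Mapping.keys p. sm (Poly_Mapping.lookup p u) (foldr h (letters u) v))"

locale free_alg_module =
  fixes sm :: "complex \<Rightarrow> 'm \<Rightarrow> 'm::ab_group_add" and h :: "'g \<Rightarrow> 'm \<Rightarrow> 'm"
  assumes sm_add_left: "sm (a + b) v = sm a v + sm b v"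
    and sm_add_right: "sm a (v + w) = sm a v + sm a w"
    and sm_mult: "sm (a * b) v = sm a (sm b v)"
    and sm_one: "sm 1 v = v"
    and h_add: "h g (v + w) = h g v + h g w"
    and h_sm: "h g (sm a v) = sm a (h g v)"
begin

abbreviation "act \<equiv> word_act sm h"

lemma sm_zero_left [simp]: "sm 0 v = 0"
  using sm_add_left[of 0 0 v] by simp

lemma sm_zero_right [simp]: "sm a 0 = 0"
  using sm_add_right[of a 0 0] by simp

lemma foldr_h_add: "foldr h us (v + w) = foldr h us v + foldr h us w"
  by (induction us) (simp_all add: h_add)

lemma foldr_h_sm: "foldr h us (sm a v) = sm a (foldr h us v)"
  by (induction us) (simp_all add: h_sm)

lemma act_zero [simp]: "act 0 v = 0"
  by (simp add: word_act_def)

lemma act_single: "act (Poly_Mapping.single u z) v = sm z (foldr h (letters u) v)"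
  by (simp add: word_act_def)

lemma act_cst: "act (cst z) v = sm z v"
  by (simp add: cst_def act_single zero_word_def)

lemma act_one: "act 1 v = v"
  using act_cst[of 1 v] by (simp add: cst_def sm_one)

lemma act_var: "act (var g) v = h g v"
  by (simp add: var_def act_single sm_one)

lemma act_add: "act (p + q) v = act p v + act q v"
proof -
  let ?f = "\<lambda>r u. sm (Poly_Mapping.lookup r u) (foldr h (letters u) v)"
  \<comment> \<open>The support of \<open>r\<close> is enlarged to a common one; the added summands
    vanish because \<open>sm 0 v = 0\<close>.\<close>
  have *: "act r v = (\<Sum>u\<in>Poly_Mapping.keys p \<union> Poly_Mapping.keys q. ?f r u)"
    if "Poly_Mapping.keys r \<subseteq> Poly_Mapping.keys p \<union> Poly_Mapping.keys q" for r
    unfolding word_act_def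
    by (rule sum.mono_neutral_left) (use that in \<open>auto simp: in_keys_iff\<close>)
  show ?thesis
    by (simp add: * Poly_Mapping.keys_add sum.distrib[symmetric] lookup_add sm_add_left)
qed

lemma act_uminus: "act (- p) v = - act p v"
  using act_add[of p "- p" v] by (simp add: eq_neg_iff_add_eq_0 add.commute)

lemma act_diff: "act (p - q) v = act p v - act q v"
  using act_add[of p "- q" v] by (simp add: act_uminus)

lemma act_sum: "act (sum f S) v = (\<Sum>a\<in>S. act (f a) v)"
  by (induction S rule: infinite_finite_induct) (simp_all add: act_add)

lemma act_add_right: "act p (v + w) = act p v + act p w"
  by (simp add: word_act_def foldr_h_add sm_add_right sum.distrib)

lemma act_zero_right [simp]: "act p 0 = 0"
  using act_add_right[of p 0 0] by simp

lemma act_times: "act (p * q) v = act p (act q v)"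
proof (induction p rule: poly_mapping_single_induct)
  case (single u z)
  show ?case
  proof (induction q rule: poly_mapping_single_induct)
    case (single w z')
    show ?case
      by (simp add: mult_single act_single plus_word_def sm_mult foldr_h_sm)
  qed (simp_all add: act_add act_add_right distrib_left)
qed (simp_all add: act_add distrib_right)

end

text \<open>Reduces containment of a generated ideal to closure under the type-class operations;
  negatives come from multiplication by \<open>- 1\<close>.\<close>

lemma genideal_free_ring_subset:
  fixes A :: "'g set"
  assumes "R \<subseteq> K" and "K \<subseteq> carrier (free_ring A)" and "0 \<in> K"
    and "\<And>p q. p \<in> K \<Longrightarrow> q \<in> K \<Longrightarrow> p + q \<in> K"
    and "\<And>p q. p \<in> K \<Longrightarrow> q \<in> carrier (free_ring A) \<Longrightarrow> q * p \<in> K"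
    and "\<And>p q. p \<in> K \<Longrightarrow> q \<in> carrier (free_ring A) \<Longrightarrow> p * q \<in> K"
  shows "genideal (free_ring A) R \<subseteq> K"
proof -
  interpret F: ring "free_ring A" by (rule ring_free_ring)
  have "ideal K (free_ring A)"
  proof (rule idealI)
    show "subgroup K (add_monoid (free_ring A))"
    proof (rule F.add.subgroupI)
      fix p assume p: "p \<in> K"
      have "-1 \<in> carrier (free_ring A)"
        by (simp add: free_ring_def zero_word_def)
      from assms(5)[OF p this] have "- p \<in> K" by simp
      moreover have "\<ominus>\<^bsub>free_ring A\<^esub> p = - p"
        using p assms(2) by (intro F.minus_equality) (auto simp: free_ring_def)
      ultimately show "\<ominus>\<^bsub>free_ring A\<^esub> p \<in> K" by simp
    qed (use assms in \<open>auto simp: free_ring_def\<close>)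
  qed (use assms in \<open>auto simp: free_ring_def intro: ring_free_ring[unfolded free_ring_def]\<close>)
  with assms(1) show ?thesis by (intro F.genideal_minimal)
qed

text \<open>The universal property of a presentation, for modules. The relators have to kill every
  vector: the annihilator of a whole module is a two-sided ideal, that of one vector only a left
  ideal.\<close>

lemma (in free_alg_module) act_genideal:
  assumes "R \<subseteq> carrier (free_ring A)" and "\<And>r v. r \<in> R \<Longrightarrow> act r v = 0"
    and "p \<in> genideal (free_ring A) R"
  shows "act p v = 0"
proof -
  interpret F: ring "free_ring A" by (rule ring_free_ring)
  have closed: "p + q \<in> carrier (free_ring A)" "p * q \<in> carrier (free_ring A)"
    if "p \<in> carrier (free_ring A)" "q \<in> carrier (free_ring A)" for p q
    using F.a_closed[OF that] F.m_closed[OF that] by (simp_all add: free_ring_def)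
  have "genideal (free_ring A) R \<subseteq> {p \<in> carrier (free_ring A). \<forall>v. act p v = 0}"
  proof (rule genideal_free_ring_subset)
    show "0 \<in> {p \<in> carrier (free_ring A). \<forall>v. act p v = 0}"
      by (simp add: free_ring_def)
  qed (use assms in \<open>auto simp: act_add act_times closed\<close>)
  with assms(3) show ?thesis by blast
qed

lemma free_eval_word_act: "free_eval s h p * v = word_act (\<lambda>z. (*) (s z)) (\<lambda>g. (*) (h g)) p v"
proof -
  have "foldr (\<lambda>g. (*) (h g)) us v = prod_list (map h us) * v" for us
    by (induction us) (simp_all add: mult.assoc)
  then show ?thesis
    by (simp add: free_eval_def word_act_def sum_distrib_right mult.assoc)
qed

locale free_alg_eval =
  fixes s :: "complex \<Rightarrow> 'r::ring_1" and h :: "'g \<Rightarrow> 'r"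
  assumes s_add: "s (a + b) = s a + s b" and s_mult: "s (a * b) = s a * s b" and s_one: "s 1 = 1"
    and s_central: "h g * s a = s a * h g"
begin

sublocale free_alg_module "\<lambda>z. (*) (s z)" "\<lambda>g. (*) (h g)"
  by standard (simp_all add: s_add s_mult s_one distrib_left distrib_right mult.assoc[symmetric] s_central)

lemma eval_eq: "free_eval s h p = act p 1"
  using free_eval_word_act[of s h p 1] by simp

lemma eval_cst: "free_eval s h (cst z) = s z"
  by (simp add: eval_eq act_cst)

lemma eval_one: "free_eval s h 1 = 1"
  by (simp add: eval_eq act_one)

lemma eval_zero: "free_eval s h 0 = 0"
  by (simp add: eval_eq)

lemma eval_var: "free_eval s h (var g) = h g"
  by (simp add: eval_eq act_var)

lemma eval_add: "free_eval s h (p + q) = free_eval s h p + free_eval s h q"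
  by (simp add: eval_eq act_add)

lemma eval_diff: "free_eval s h (p - q) = free_eval s h p - free_eval s h q"
  by (simp add: eval_eq act_diff)

lemma eval_times: "free_eval s h (p * q) = free_eval s h p * free_eval s h q"
  by (simp add: eval_eq act_times) (simp add: free_eval_word_act[symmetric])

end

section \<open>The skew polynomial algebra and its derivations\<close>

lemma abs_spoly_eq_iff: "abs_spoly p = abs_spoly q \<longleftrightarrow> p - q \<in> skew_ideal"
  by (rule spoly.abs_eq_iff)

lemma abs_rep_spoly [simp]: "abs_spoly (rep_spoly f) = f"
  by (rule Quotient3_abs_rep[OF Quotient3_spoly])

lemma skew_relators_carrier: "skew_relators \<subseteq> carrier (free_ring UNIV)"
  by (simp add: free_ring_def)

lemma anticommute_sx:
  assumes "i \<noteq> j" shows "sx i * sx j = - (sx j * sx i)"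
proof -
  interpret F: ring "free_ring (UNIV :: 'a set)" by (rule ring_free_ring)
  have "var i * var j + var j * var i \<in> skew_relators"
    using assms by (auto simp: skew_relators_def)
  then have "var i * var j + var j * var i \<in> skew_ideal"
    unfolding skew_ideal_def using F.genideal_self[OF skew_relators_carrier] by blast
  then have "sx i * sx j + sx j * sx i = 0"
    by transfer simp
  then show ?thesis by (simp add: eq_neg_iff_add_eq_0)
qed

lemma cst_add: "cst (a + b) = cst a + cst b"
  by (simp add: cst_def single_add)

lemma cst_mult: "cst (a * b) = cst a * cst b"
  by (simp add: cst_def mult_single)

lemma cst_one: "cst 1 = 1"
  by (simp add: cst_def)

lemma var_cst: "var g * cst z = cst z * var g"
  by (simp add: cst_def var_def mult_single)

lemma const_add: "const (a + b) = const a + const b"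
  by transfer (simp add: cst_add skew_ideal_zero)

lemma const_mult: "const (a * b) = const a * const b"
  by transfer (simp add: cst_mult skew_ideal_zero)

lemma const_one [simp]: "const 1 = 1"
  by transfer (simp add: cst_one skew_ideal_zero)

lemma const_zero [simp]: "const 0 = 0"
  using const_add[of 0 0] by simp

lemma const_uminus: "const (- z) = - const z"
  using const_add[of z "- z"] by (simp add: eq_neg_iff_add_eq_0 add.commute)

lemma const_sum: "const (sum f S) = (\<Sum>a\<in>S. const (f a))"
  by (induction S rule: infinite_finite_induct) (simp_all add: const_add)

lemma const_of_nat: "const (of_nat n) = of_nat n"
  by (induction n) (simp_all add: const_add)

lemma sx_const: "sx i * const z = const z * sx i"
  by transfer (simp add: var_cst skew_ideal_zero)

lemma sx_const_left: "sx i * (const z * f) = const z * (sx i * f)"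
  by (simp add: mult.assoc[symmetric] sx_const)

lemma const_commute: "const a * const b = const b * const a"
  by (simp add: const_mult[symmetric] mult.commute)

lemma const_commute_left: "const a * (const b * f) = const b * (const a * f)"
  by (simp add: mult.assoc[symmetric] const_commute)

lemma const_inverse:
  assumes "z \<noteq> 0" shows "const z * const (inverse z) = 1" "const (inverse z) * const z = 1"
  using assms by (simp_all add: const_mult[symmetric])

text \<open>Elements are sums of scaled words, and words are built by left multiplication. No linear
  independence of monomials enters, so operators can be compared through their commutation rules
  with the \<open>sx k\<close> alone.\<close>

lemma spoly_induct [case_names one add scale var]:
  assumes one: "P 1" and add: "\<And>f g. P f \<Longrightarrow> P g \<Longrightarrow> P (f + g)"
    and scale: "\<And>z f. P f \<Longrightarrow> P (const z * f)" and var: "\<And>k f. P f \<Longrightarrow> P (sx k * f)"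
  shows "P f"
proof -
  have "P (abs_spoly p)" for p
  proof (induction p rule: poly_mapping_single_induct)
    case zero
    \<comment> \<open>Zero is reached as \<open>const 0 * 1\<close>.\<close>
    show ?case using scale[OF one, of 0] by (simp add: zero_spoly.abs_eq[symmetric])
  next
    case (add p q)
    then show ?case using assms(2) by (simp add: plus_spoly.abs_eq[symmetric])
  next
    case (single u z)
    have "P (abs_spoly (Poly_Mapping.single (Word us) 1))" for us
    proof (induction us)
      case Nil
      have "abs_spoly (Poly_Mapping.single (Word []) 1) = (1 :: 'a spoly)"
        by (simp add: one_spoly.abs_eq zero_word_def[symmetric])
      then show ?case using one by simp
    next
      case (Cons k us)
      have "abs_spoly (Poly_Mapping.single (Word (k # us)) 1)
          = sx k * abs_spoly (Poly_Mapping.single (Word us) 1)"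
        by (simp add: sx.abs_eq times_spoly.abs_eq var_def mult_single plus_word_def)
      with var[OF Cons] show ?case by simp
    qed
    then have "P (const z * abs_spoly (Poly_Mapping.single u 1))"
      using scale by (cases u) auto
    then show ?case
      by (simp add: const.abs_eq times_spoly.abs_eq cst_def mult_single)
  qed
  from this[of "rep_spoly f"] show ?thesis by simp
qed

lemma const_central: "f * const z = const z * f"
  by (induction f rule: spoly_induct)
     (simp_all add: distrib_left distrib_right mult.assoc const_commute_left sx_const_left)

lemma const_central_left: "f * (const z * g) = const z * (f * g)"
  by (simp add: mult.assoc[symmetric] const_central)

lemma const_minus_one_power: "const ((- 1) ^ n) = (- 1) ^ n"
  by (cases "even n") (simp_all add: const_uminus)

locale skew_module = free_alg_module sm h
  for sm :: "complex \<Rightarrow> 'm \<Rightarrow> 'm::ab_group_add" and h :: "'n \<Rightarrow> 'm \<Rightarrow> 'm" +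
  assumes h_anticommute: "i \<noteq> j \<Longrightarrow> h i (h j v) + h j (h i v) = 0"
begin

lemma act_skew_ideal: "p \<in> skew_ideal \<Longrightarrow> act p v = 0"
  unfolding skew_ideal_def
  by (rule act_genideal[OF skew_relators_carrier])
     (auto simp: skew_relators_def act_add act_times act_var h_anticommute)

lemma act_cong: "abs_spoly p = abs_spoly q \<Longrightarrow> act p v = act q v"
  using act_skew_ideal[of "p - q" v] by (simp add: abs_spoly_eq_iff act_diff)

text \<open>By \<open>act_cong\<close> the value does not depend on the representative: any
  anticommuting family of linear operators makes \<open>'m\<close> a module over S_{-1}(V).\<close>

definition sact :: "'n spoly \<Rightarrow> 'm \<Rightarrow> 'm" where
  "sact f v = act (rep_spoly f) v"

lemma sact_abs: "sact (abs_spoly p) v = act p v"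
  unfolding sact_def by (rule act_cong) simp

lemma sact_one: "sact 1 v = v"
  by (simp add: one_spoly.abs_eq sact_abs act_one)

lemma sact_add: "sact (f + g) v = sact f v + sact g v"
proof -
  have "f + g = abs_spoly (rep_spoly f + rep_spoly g)"
    by (simp add: plus_spoly.abs_eq[symmetric])
  then show ?thesis by (simp only: sact_abs act_add) (simp add: sact_def)
qed

lemma sact_times: "sact (f * g) v = sact f (sact g v)"
proof -
  have "f * g = abs_spoly (rep_spoly f * rep_spoly g)"
    by (simp add: times_spoly.abs_eq[symmetric])
  then show ?thesis by (simp only: sact_abs act_times) (simp add: sact_def)
qed

lemma sact_const: "sact (const z) v = sm z v"
  by (simp add: const.abs_eq sact_abs act_cst)

lemma sact_sx: "sact (sx k) v = h k v"
  by (simp add: sx.abs_eq sact_abs act_var)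

end

locale skew_eval = free_alg_eval s h
  for s :: "complex \<Rightarrow> 'r::ring_1" and h :: "'n \<Rightarrow> 'r" +
  assumes h_anticomm: "i \<noteq> j \<Longrightarrow> h i * h j + h j * h i = 0"
begin

sublocale skew_module "\<lambda>z. (*) (s z)" "\<lambda>g. (*) (h g)"
  by standard (simp add: h_anticomm mult.assoc[symmetric] distrib_right[symmetric])

lemma eval_rep: "free_eval s h (rep_spoly f) = sact f 1"
  by (simp add: eval_eq sact_def)

lemma sact_eq_times: "sact f v = free_eval s h (rep_spoly f) * v"
  by (simp add: sact_def free_eval_word_act)

lemma seval_one: "free_eval s h (rep_spoly 1) = 1"
  by (simp add: eval_rep sact_one)

lemma seval_add:
  "free_eval s h (rep_spoly (f + g)) = free_eval s h (rep_spoly f) + free_eval s h (rep_spoly g)"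
  by (simp add: eval_rep sact_add)

lemma seval_times:
  "free_eval s h (rep_spoly (f * g)) = free_eval s h (rep_spoly f) * free_eval s h (rep_spoly g)"
  by (simp add: eval_rep sact_times) (simp add: sact_eq_times)

lemma seval_const: "free_eval s h (rep_spoly (const z)) = s z"
  by (simp add: eval_rep sact_const)

lemma seval_sx: "free_eval s h (rep_spoly (sx k)) = h k"
  by (simp add: eval_rep sact_sx)

end

definition skew_derivation :: "'n \<Rightarrow> ('n spoly \<Rightarrow> 'n spoly) \<Rightarrow> bool" where
  "skew_derivation i D \<longleftrightarrow>
     D 1 = 0 \<and> (\<forall>f g. D (f + g) = D f + D g) \<and> (\<forall>z f. D (const z * f) = const z * D f) \<and>
     (\<forall>f. D (sx i * f) = sx i * D f + f) \<and> (\<forall>k f. k \<noteq> i \<longrightarrow> D (sx k * f) = - (sx k * D f))"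

text \<open>The skew derivation is read off an action of \<open>S\<^sub>-\<^sub>1(V)\<close> on pairs, in which \<open>f\<close> maps \<open>(1, 0)\<close>
  to \<open>(f, D f)\<close>; the relations of \<open>S\<^sub>-\<^sub>1(V)\<close> then replace a check of well-definedness on monomials.\<close>

lemma ex_skew_derivation:
  fixes i :: 'n
  shows "\<exists>D. skew_derivation i D"
proof -
  define sm :: "complex \<Rightarrow> 'n spoly \<times> 'n spoly \<Rightarrow> 'n spoly \<times> 'n spoly"
    where "sm z v = (const z * fst v, const z * snd v)" for z v
  define h where "h k v = (sx k * fst v, if k = i then sx k * snd v + fst v else - (sx k * snd v))"
    for k and v :: "'n spoly \<times> 'n spoly"
  interpret skew_module sm h
  proof
    fix k l :: 'n and v :: "'n spoly \<times> 'n spoly" assume "k \<noteq> l"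
    have "sx k * (sx l * x) = - (sx l * (sx k * x))" for x
      by (simp add: mult.assoc[symmetric] anticommute_sx[OF \<open>k \<noteq> l\<close>])
    with \<open>k \<noteq> l\<close> show "h k (h l v) + h l (h k v) = 0"
      by (auto simp: h_def prod_eq_iff distrib_left)
  qed (auto simp: sm_def h_def prod_eq_iff const_add const_mult distrib_left distrib_right mult.assoc
         sx_const_left)
  have sm: "fst (sm z v) = const z * fst v" "snd (sm z v) = const z * snd v" for z v
    by (simp_all add: sm_def)
  have h: "fst (h k v) = sx k * fst v" "snd (h i v) = sx i * snd v + fst v"
    "k \<noteq> i \<Longrightarrow> snd (h k v) = - (sx k * snd v)" for k v
    by (simp_all add: h_def)
  have fst: "fst (sact f v) = f * fst v" for f v
    by (induction f rule: spoly_induct)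
       (simp_all add: sact_one sact_add sact_times sact_const sact_sx sm h distrib_right mult.assoc)
  have "skew_derivation i (\<lambda>f. snd (sact f (1, 0)))"
    by (simp add: skew_derivation_def sact_one sact_add sact_times sact_const sact_sx sm h fst)
  then show ?thesis by blast
qed

lemma skew_derivation_power_neq:
  assumes "skew_derivation i D" "k \<noteq> i"
  shows "D (sx k ^ n * f) = (- 1) ^ n * (sx k ^ n * D f)"
proof (induction n)
  case (Suc n)
  have "D (sx k ^ Suc n * f) = - (sx k * D (sx k ^ n * f))"
    using assms by (simp add: skew_derivation_def mult.assoc)
  \<comment> \<open>The sign is written as \<open>const\<close> of a scalar so that
    \<open>const_central_left\<close> can move it past \<open>sx k\<close>.\<close>
  also have "\<dots> = - (sx k * (const ((- 1) ^ n) * (sx k ^ n * D f)))"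
    by (simp only: Suc const_minus_one_power)
  also have "\<dots> = (- 1) ^ Suc n * (sx k ^ Suc n * D f)"
    by (subst const_central_left) (simp add: mult.assoc const_minus_one_power)
  finally show ?case .
qed simp

lemma skew_derivation_power_eq:
  assumes "skew_derivation i D"
  shows "D (sx i ^ n * f) = of_nat n * (sx i ^ (n - 1) * f) + sx i ^ n * D f"
proof (induction n)
  case (Suc n)
  have "sx i * (of_nat n * (sx i ^ (n - 1) * f)) = of_nat n * (sx i * (sx i ^ (n - 1) * f))"
    by (metis mult.assoc mult_of_nat_commute)
  \<comment> \<open>For \<open>n = 0\<close> the truncated exponent \<open>n - 1\<close> is
    harmless, since both sides carry the factor \<open>of_nat n\<close>.\<close>
  also have "\<dots> = of_nat n * (sx i ^ n * f)"
    by (cases n) (simp_all add: mult.assoc)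
  finally have "sx i * (of_nat n * (sx i ^ (n - 1) * f)) = of_nat n * (sx i ^ n * f)" .
  moreover have "D (sx i ^ Suc n * f) = sx i * D (sx i ^ n * f) + sx i ^ n * f"
    using assms by (simp add: skew_derivation_def mult.assoc)
  ultimately show ?case
    by (simp add: Suc distrib_left distrib_right mult.assoc)
qed simp

section \<open>Ordered monomials and the uniqueness of the braided derivative\<close>

abbreviation list_mono :: "('n \<Rightarrow> nat) \<Rightarrow> 'n list \<Rightarrow> 'n spoly" where
  "list_mono a is \<equiv> prod_list (map (\<lambda>i. sx i ^ a i) is)"

lemma skew_derivation_list_mono_notin:
  assumes "skew_derivation i D" "i \<notin> set is"
  shows "D (list_mono a is) = 0"
  using assms(2)
proof (induction "is")
  case Nil
  then show ?case using assms(1) by (simp add: skew_derivation_def)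
next
  case (Cons k "is")
  then have "k \<noteq> i" "i \<notin> set is" by auto
  with Cons.IH show ?case by (simp add: skew_derivation_power_neq[OF assms(1)])
qed

text \<open>The derivation passes the factors to the left of x_i, each giving a sign (-1)^(a j),
  acts on the power of x_i, and vanishes on what follows. Sortedness identifies the factors on the
  left with the indices \<open>j < i\<close>.\<close>

lemma skew_derivation_list_mono:
  fixes a :: "'n::linorder \<Rightarrow> nat"
  assumes D: "skew_derivation i D" and "sorted_wrt (<) is" "i \<in> set is"
  shows "D (list_mono a is) =
    of_nat (a i) * (- 1) ^ (\<Sum>j | j \<in> set is \<and> j < i. a j) * list_mono (a(i := a i - 1)) is"
  using assms(2,3)
proof (induction "is")
  case (Cons k "is")
  show ?case
  proof (cases "k = i")
    case True
    with Cons.prems have "i \<notin> set is" by auto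
    moreover from this have "list_mono (a(i := a i - 1)) is = list_mono a is"
      by (intro arg_cong[where f = prod_list] map_cong) auto
    moreover have "{j. j \<in> set (k # is) \<and> j < i} = {}"
      using True Cons.prems(1) by force
    then have s: "(\<Sum>j | j \<in> set (k # is) \<and> j < i. a j) = 0"
      by (simp only: sum.empty)
    ultimately show ?thesis
      unfolding s using True
      by (simp add: skew_derivation_power_eq[OF D] skew_derivation_list_mono_notin[OF D] mult.assoc)
  next
    case False
    with Cons.prems have k: "k < i" "i \<in> set is" "k \<notin> set is" by auto
    have "{j. j \<in> set (k # is) \<and> j < i} = insert k {j. j \<in> set is \<and> j < i}"
      using k by auto
    then have s: "(\<Sum>j | j \<in> set (k # is) \<and> j < i. a j) = a k + (\<Sum>j | j \<in> set is \<and> j < i. a j)"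
      using k by simp
    let ?z = "of_nat (a i) * (- 1) ^ (\<Sum>j | j \<in> set is \<and> j < i. a j) :: complex"
    have "D (list_mono a is) = const ?z * list_mono (a(i := a i - 1)) is"
      using Cons k by (simp add: const_mult const_of_nat const_minus_one_power)
    then have "D (list_mono a (k # is)) =
        const ((- 1) ^ a k) * (sx k ^ a k * (const ?z * list_mono (a(i := a i - 1)) is))"
      using False by (simp add: skew_derivation_power_neq[OF D] const_minus_one_power)
    also have "\<dots> = const ((- 1) ^ a k * ?z) * list_mono (a(i := a i - 1)) (k # is)"
      using False by (subst const_central_left) (simp add: const_mult mult.assoc)
    also have "(- 1) ^ a k * ?z = of_nat (a i) * (- 1) ^ (\<Sum>j | j \<in> set (k # is) \<and> j < i. a j)"
      unfolding s by (simp add: power_add)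
    finally show ?thesis
      by (simp add: const_mult const_of_nat const_minus_one_power)
  qed
qed simp

lemma sx_power_anticommute:
  assumes "i \<noteq> k" shows "sx i * (sx k ^ n * f) = (- 1) ^ n * (sx k ^ n * (sx i * f))"
proof (induction n)
  case (Suc n)
  have "sx i * (sx k ^ Suc n * f) = sx i * sx k * (sx k ^ n * f)"
    by (simp add: mult.assoc)
  also have "\<dots> = - (sx k * (sx i * (sx k ^ n * f)))"
    by (simp add: anticommute_sx[OF assms] mult.assoc)
  also have "\<dots> = - (sx k * (const ((- 1) ^ n) * (sx k ^ n * (sx i * f))))"
    by (simp only: Suc const_minus_one_power)
  also have "\<dots> = (- 1) ^ Suc n * (sx k ^ Suc n * (sx i * f))"
    by (subst const_central_left) (simp add: mult.assoc const_minus_one_power)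
  finally show ?case .
qed simp

lemma sx_times_list_mono:
  fixes a :: "'n::linorder \<Rightarrow> nat"
  assumes "sorted_wrt (<) is" "i \<in> set is"
  shows "\<exists>z. sx i * list_mono a is = const z * list_mono (a(i := Suc (a i))) is"
  using assms
proof (induction "is")
  case (Cons k "is")
  show ?case
  proof (cases "k = i")
    case True
    with Cons.prems have "i \<notin> set is" by auto
    then have "list_mono (a(i := Suc (a i))) is = list_mono a is"
      by (intro arg_cong[where f = prod_list] map_cong) auto
    with True show ?thesis by (intro exI[of _ 1]) (simp add: mult.assoc)
  next
    case False
    with Cons.prems have "i \<in> set is" by auto
    with Cons obtain z where z: "sx i * list_mono a is = const z * list_mono (a(i := Suc (a i))) is"
      by auto
    from False have "sx i * list_mono a (k # is) =
        const ((- 1) ^ a k) * (sx k ^ a k * (const z * list_mono (a(i := Suc (a i))) is))"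
      by (simp add: sx_power_anticommute z const_minus_one_power)
    also have "\<dots> = const ((- 1) ^ a k * z) * list_mono (a(i := Suc (a i))) (k # is)"
      using False by (subst const_central_left) (simp add: const_mult mult.assoc)
    finally show ?thesis by blast
  qed
qed simp

lemma sx_times_smono: "\<exists>z. sx i * smono a = const z * smono (a(i := Suc (a i)))"
  unfolding smono_def by (rule sx_times_list_mono) auto

text \<open>Spanning is what the uniqueness half of the \<open>THE\<close> in
  \<open>braided_deriv\<close> rests on. The existence half is \<open>ex_skew_derivation\<close>, so
  independence of the monomials is bypassed.\<close>

inductive smono_span :: "'n::{finite,linorder} spoly \<Rightarrow> bool" where
  smono: "smono_span (smono a)"
| add: "smono_span f \<Longrightarrow> smono_span g \<Longrightarrow> smono_span (f + g)"
| scale: "smono_span f \<Longrightarrow> smono_span (const z * f)"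

lemma smono_span: "smono_span f"
proof (induction f rule: spoly_induct)
  case one
  have "map (\<lambda>i. sx i ^ 0) is = replicate (length is) (1 :: 'a spoly)" for "is" :: "'a list"
    by (induction "is") simp_all
  then have "smono (\<lambda>_. 0) = (1 :: 'a spoly)"
    unfolding smono_def by (simp add: prod_list_replicate)
  then show ?case by (metis smono_span.smono)
next
  case (var k f)
  then show ?case
  proof induction
    case (smono a)
    then show ?case using sx_times_smono[of k a] smono_span.intros by metis
  qed (auto simp: distrib_left sx_const_left intro: smono_span.intros)
qed (auto intro: smono_span.intros)

lemma braided_deriv_eq:
  fixes D :: "'n::{finite,linorder} spoly \<Rightarrow> 'n spoly"
  assumes "skew_derivation i D" shows "braided_deriv i = D"
  unfolding braided_deriv_def
proof (rule the_equality)
  have "{j. j \<in> set (sorted_list_of_set (UNIV :: 'n set)) \<and> j < i} = {j. j < i}" by simp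
  then show D: "(\<forall>f g. D (f + g) = D f + D g) \<and> (\<forall>z f. D (const z * f) = const z * D f) \<and>
     (\<forall>a. D (smono a) = of_nat (a i) * (- 1) ^ (\<Sum>j | j < i. a j) * smono (a(i := a i - 1)))"
    using assms skew_derivation_list_mono[OF assms, of "sorted_list_of_set UNIV"]
    by (simp add: skew_derivation_def smono_def)
  fix E :: "'n spoly \<Rightarrow> 'n spoly"
  assume E: "(\<forall>f g. E (f + g) = E f + E g) \<and> (\<forall>z f. E (const z * f) = const z * E f) \<and>
     (\<forall>a. E (smono a) = of_nat (a i) * (- 1) ^ (\<Sum>j | j < i. a j) * smono (a(i := a i - 1)))"
  show "E = D"
  proof
    fix f
    from smono_span[of f] show "E f = D f"
      by induction (use D E in simp_all)
  qed
qed

lemma skew_derivation_braided_deriv: "skew_derivation i (braided_deriv i)"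
  using ex_skew_derivation[of i] braided_deriv_eq by metis

lemma skew_derivationD:
  assumes "skew_derivation i D"
  shows "D 1 = 0" "D (f + g) = D f + D g" "D (const z * f) = const z * D f"
    "D (sx i * f) = sx i * D f + f" "k \<noteq> i \<Longrightarrow> D (sx k * f) = - (sx k * D f)"
  using assms unfolding skew_derivation_def by blast+

lemmas braided_deriv_rules = skew_derivationD[OF skew_derivation_braided_deriv]

lemma braided_deriv_zero: "braided_deriv i 0 = 0"
  using braided_deriv_rules(2)[of i 0 0] by simp

lemma braided_deriv_sx: "braided_deriv i (sx j) = (if j = i then 1 else 0)"
  using braided_deriv_rules(4)[of i 1] braided_deriv_rules(5)[of j i 1]
  by (auto simp: braided_deriv_rules(1))

text \<open>Two applications of \<open>braided_deriv i\<close> send x_i^2 to 2 and any multiple of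
  x_j^2 to 0. This makes the denominators of the Dunkl operators invertible.\<close>

lemma sx_square_diff_nonzero:
  fixes i j :: "'n::{finite,linorder}"
  assumes "i \<noteq> j" shows "(sx i)\<^sup>2 - const z * (sx j)\<^sup>2 \<noteq> 0"
proof -
  have "(sx i)\<^sup>2 \<noteq> const z * (sx j)\<^sup>2"
  proof
    assume "(sx i)\<^sup>2 = const z * (sx j)\<^sup>2"
    then have "braided_deriv i (braided_deriv i ((sx i)\<^sup>2))
        = braided_deriv i (braided_deriv i (const z * (sx j)\<^sup>2))" by (rule arg_cong)
    also have "braided_deriv i (const z * (sx j)\<^sup>2) = 0"
      using assms by (simp only: power2_eq_square braided_deriv_rules braided_deriv_sx) simp
    also have "braided_deriv i ((sx i)\<^sup>2) = sx i + sx i"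
      by (simp only: power2_eq_square braided_deriv_rules braided_deriv_sx) simp
    finally have "const 2 = (0 :: 'n spoly)"
      by (simp add: braided_deriv_rules(2) braided_deriv_sx braided_deriv_zero
            const_of_nat[of 2, simplified])
    then show False
      using const_inverse(1)[of 2, where ?'a = 'n] by simp
  qed
  then show ?thesis by simp
qed

lemma sx_nonzero: "sx i \<noteq> (0 :: 'n::{finite,linorder} spoly)"
  using braided_deriv_sx[of i i] by (auto simp: braided_deriv_zero)

section \<open>Monomial matrices\<close>

text \<open>The generalized permutation matrix sending x_k to \<open>a k\<close> times x_{\<pi> k}.
  All of \<open>W\<close> has this shape, so products, inverses and the action on generators reduce
  to bookkeeping of \<open>\<pi>\<close> and \<open>a\<close>.\<close>

definition mono_mat :: "('n \<Rightarrow> 'n) \<Rightarrow> ('n \<Rightarrow> complex) \<Rightarrow> complex ^ 'n ^ 'n::finite" where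
  "mono_mat \<pi> a = from_columns (\<lambda>k. axis (\<pi> k) (a k))"

lemma mono_mat_nth: "mono_mat \<pi> a $ r $ k = (if r = \<pi> k then a k else 0)"
  by (simp add: mono_mat_def from_columns_def axis_def)

lemma mono_mat_mult: "mono_mat \<pi> a ** mono_mat \<rho> b = mono_mat (\<pi> \<circ> \<rho>) (\<lambda>k. a (\<rho> k) * b k)"
  by (simp add: vec_eq_iff matrix_matrix_mult_def mono_mat_nth if_distrib[where f = "\<lambda>x. _ * x"]
        cong: if_cong)

lemma mat_1_mono_mat: "mat 1 = mono_mat id (\<lambda>_. 1)"
  by (simp add: vec_eq_iff mono_mat_nth mat_def)

text \<open>A one-sided inverse of a square matrix is two-sided, so the choice made in
  \<open>matrix_inv\<close> has a single candidate.\<close>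

lemma matrix_inv_eq:
  fixes A B :: "complex ^ 'n ^ 'n::finite"
  assumes "A ** B = mat 1" shows "matrix_inv A = B"
proof -
  have "B ** A = mat 1" using assms matrix_left_right_inverse by blast
  with assms have "\<exists>B. A ** B = mat 1 \<and> B ** A = mat 1" by blast
  then have "A ** matrix_inv A = mat 1 \<and> matrix_inv A ** A = mat 1"
    unfolding matrix_inv_def by (rule someI_ex)
  then have "B ** A ** matrix_inv A = B"
    by (simp add: matrix_mul_assoc[symmetric])
  with \<open>B ** A = mat 1\<close> show ?thesis by simp
qed

lemma mono_mat_inverse:
  assumes "bij \<pi>" "\<And>k. a k \<noteq> 0"
  shows "mono_mat \<pi> a ** mono_mat (inv_into UNIV \<pi>) (\<lambda>k. inverse (a (inv_into UNIV \<pi> k))) = mat 1"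
  using assms
  by (simp add: mono_mat_mult mat_1_mono_mat surj_iff[THEN iffD1, OF bij_is_surj])

lemma matrix_inv_mono_mat:
  assumes "bij \<pi>" "\<And>k. a k \<noteq> 0"
  shows "matrix_inv (mono_mat \<pi> a) = mono_mat (inv_into UNIV \<pi>) (\<lambda>k. inverse (a (inv_into UNIV \<pi> k)))"
  by (rule matrix_inv_eq) (rule mono_mat_inverse[OF assms])

lemma refl_t_mono_mat: "refl_t i \<epsilon> = mono_mat id (\<lambda>k. if k = i then \<epsilon> else 1)"
  by (auto simp: refl_t_def mono_mat_def intro!: arg_cong[where f = from_columns])

lemma refl_sigma_mono_mat:
  "refl_sigma i j \<epsilon> =
     mono_mat (Transposition.transpose i j) (\<lambda>k. if k = i then \<epsilon> else if k = j then - inverse \<epsilon> else 1)"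
  by (auto simp: refl_sigma_def mono_mat_def Transposition.transpose_def intro!: arg_cong[where f = from_columns])

lemma group_GL: "group (GL :: (complex ^ 'n ^ 'n::finite) monoid)"
proof (rule groupI)
  show "\<one>\<^bsub>GL\<^esub> \<in> carrier (GL :: (complex ^ 'n ^ 'n) monoid)"
    by (auto simp: GL_def invertible_def intro: exI[of _ "mat 1"])
next
  fix A :: "complex ^ 'n ^ 'n" assume "A \<in> carrier GL"
  then obtain B where "A ** B = mat 1" "B ** A = mat 1"
    by (auto simp: GL_def invertible_def)
  then show "\<exists>B\<in>carrier GL. B \<otimes>\<^bsub>GL\<^esub> A = \<one>\<^bsub>GL\<^esub>"
    by (auto simp: GL_def invertible_def)
qed (auto simp: GL_def invertible_mult matrix_mul_assoc)

lemma inv_GL: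
  assumes "A \<in> carrier GL" shows "inv\<^bsub>GL\<^esub> A = matrix_inv A"
proof -
  interpret group "GL :: (complex ^ 'a ^ 'a) monoid" by (rule group_GL)
  have "A ** inv\<^bsub>GL\<^esub> A = mat 1"
    using r_inv[OF assms] by (simp add: GL_def)
  then show ?thesis by (simp add: matrix_inv_eq)
qed

text \<open>The entries are kept in \<open>C\<close> because conjugating
  \<open>refl_sigma i j \<epsilon>\<close> multiplies \<open>\<epsilon>\<close> by a quotient of
  entries; sums over \<open>C\<close> can then be reindexed.\<close>

definition mono_mats :: "complex set \<Rightarrow> (complex ^ 'n ^ 'n::finite) set" where
  "mono_mats C = {mono_mat \<pi> a | \<pi> a. bij \<pi> \<and> (\<forall>k. a k \<in> C)}"

section \<open>The finite parameter groups and \<open>W\<close> as a group of monomial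
  matrices\<close>

locale parameters =
  fixes C C' :: "complex set" and c :: "complex \<Rightarrow> complex"
  assumes subgroup_C: "subgroup C cstar" and finite_C: "finite C"
    and subgroup_C': "subgroup C' cstar" and finite_C': "finite C'"
    and C'_subset: "C' \<subseteq> C" and minus_one_C: "- 1 \<in> C"
begin

lemma group_cstar: "group cstar"
proof (rule groupI)
  fix x assume "x \<in> carrier cstar"
  then show "\<exists>y\<in>carrier cstar. y \<otimes>\<^bsub>cstar\<^esub> x = \<one>\<^bsub>cstar\<^esub>"
    by (intro bexI[of _ "inverse x"]) (auto simp: cstar_def)
qed (auto simp: cstar_def)

lemma C_nonzero: "\<epsilon> \<in> C \<Longrightarrow> \<epsilon> \<noteq> 0"
  using subgroup.subset[OF subgroup_C] by (auto simp: cstar_def)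

lemma C_one: "1 \<in> C"
  using subgroup.one_closed[OF subgroup_C] by (simp add: cstar_def)

lemma C_mult: "\<epsilon> \<in> C \<Longrightarrow> \<delta> \<in> C \<Longrightarrow> \<epsilon> * \<delta> \<in> C"
  using subgroup.m_closed[OF subgroup_C] by (simp add: cstar_def)

lemma C_uminus: "\<epsilon> \<in> C \<Longrightarrow> - \<epsilon> \<in> C"
  using C_mult[OF minus_one_C] by simp

lemma C_inverse: "\<epsilon> \<in> C \<Longrightarrow> inverse \<epsilon> \<in> C"
proof -
  interpret group cstar by (rule group_cstar)
  assume \<epsilon>: "\<epsilon> \<in> C"
  then have "inv\<^bsub>cstar\<^esub> \<epsilon> = inverse \<epsilon>"
    using C_nonzero by (intro inv_equality) (auto simp: cstar_def)
  with subgroup.m_inv_closed[OF subgroup_C \<epsilon>] show ?thesis by simp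
qed

lemma sum_C_reindex:
  assumes "\<And>\<epsilon>. \<epsilon> \<in> C \<Longrightarrow> r \<epsilon> \<in> C" and "inj_on r C"
  shows "(\<Sum>\<epsilon>\<in>C. g (r \<epsilon>)) = (\<Sum>\<epsilon>\<in>C. g \<epsilon>)"
proof (rule sum.reindex_bij_betw)
  have "r ` C = C" using assms by (intro endo_inj_surj finite_C) auto
  with assms show "bij_betw r C C" by (simp add: bij_betw_def)
qed

text \<open>Negation permutes \<open>C\<close>, so the sum equals its own negative. This is why
  \<open>sigma_sum i j\<close> kills constants.\<close>

lemma sum_C: "(\<Sum>\<epsilon>\<in>C. \<epsilon>) = 0"
  using sum_C_reindex[of uminus "\<lambda>x. x"] C_uminus by (simp add: sum_negf)

lemma sum_C_mult: "\<delta> \<in> C \<Longrightarrow> (\<Sum>\<epsilon>\<in>C. g (\<epsilon> * \<delta>)) = (\<Sum>\<epsilon>\<in>C. g \<epsilon>)"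
  using C_nonzero C_mult by (intro sum_C_reindex) (auto simp: inj_on_def)

abbreviation "W \<equiv> Wgroup C C'"
abbreviation "Wgens \<equiv> {refl_sigma i j \<epsilon> | i j \<epsilon>. i \<noteq> j \<and> \<epsilon> \<in> C} \<union> {refl_t i \<epsilon> | i \<epsilon>. \<epsilon> \<in> C'}"

lemma refl_sigma_mono_mats: "\<epsilon> \<in> C \<Longrightarrow> refl_sigma i j \<epsilon> \<in> mono_mats C"
  unfolding refl_sigma_mono_mat mono_mats_def using C_uminus C_inverse C_one by force

lemma refl_t_mono_mats: "\<epsilon> \<in> C \<Longrightarrow> refl_t i \<epsilon> \<in> mono_mats C"
  unfolding refl_t_mono_mat mono_mats_def using C_one by force

lemma mono_mats_mult:
  assumes "v \<in> mono_mats C" "w \<in> mono_mats C"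
  shows "v ** w \<in> mono_mats C"
proof -
  from assms obtain \<pi> a \<rho> b where "v = mono_mat \<pi> a" "bij \<pi>" "\<forall>k. a k \<in> C"
    "w = mono_mat \<rho> b" "bij \<rho>" "\<forall>k. b k \<in> C"
    unfolding mono_mats_def by blast
  then have "v ** w = mono_mat (\<pi> \<circ> \<rho>) (\<lambda>k. a (\<rho> k) * b k)" "bij (\<pi> \<circ> \<rho>)" "\<forall>k. a (\<rho> k) * b k \<in> C"
    by (simp_all add: mono_mat_mult bij_comp C_mult)
  then show ?thesis unfolding mono_mats_def by blast
qed

lemma mono_mats_inv:
  assumes "w \<in> mono_mats C"
  shows "matrix_inv w \<in> mono_mats C" "w ** matrix_inv w = mat 1" "matrix_inv w ** w = mat 1"
proof -
  from assms obtain \<pi> a where w: "w = mono_mat \<pi> a" "bij \<pi>" "\<And>k. a k \<in> C"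
    by (auto simp: mono_mats_def)
  with C_nonzero have i: "matrix_inv w = mono_mat (inv_into UNIV \<pi>) (\<lambda>k. inverse (a (inv_into UNIV \<pi> k)))"
    by (simp add: matrix_inv_mono_mat)
  with w show "matrix_inv w \<in> mono_mats C"
    unfolding mono_mats_def using C_inverse bij_imp_bij_inv by fastforce
  show 1: "w ** matrix_inv w = mat 1"
    unfolding i using w C_nonzero by (simp add: mono_mat_inverse)
  then show "matrix_inv w ** w = mat 1"
    using matrix_left_right_inverse by blast
qed

lemma mono_mats_GL: "mono_mats C \<subseteq> carrier GL"
  using mono_mats_inv(2,3) by (fastforce simp: GL_def invertible_def)

lemma Wgens_mono_mats: "(Wgens :: (complex ^ 'n ^ 'n::finite) set) \<subseteq> mono_mats C"
  using refl_sigma_mono_mats refl_t_mono_mats C'_subset by blast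

lemma W_mono_mats: "w \<in> W \<Longrightarrow> w \<in> mono_mats C"
  unfolding Wgroup_def
proof (induction rule: generate.induct)
  case one
  have "mat 1 \<in> mono_mats C"
    unfolding mat_1_mono_mat mono_mats_def using C_one by force
  then show ?case by (simp add: GL_def)
next
  case (incl h)
  then show ?case using Wgens_mono_mats by blast
next
  case (inv h)
  then have h: "h \<in> mono_mats C" using Wgens_mono_mats by blast
  with mono_mats_GL inv_GL mono_mats_inv(1) show ?case by fastforce
next
  case (eng h1 h2)
  with mono_mats_mult show ?case by (simp add: GL_def)
qed

lemma W_mult: "v \<in> W \<Longrightarrow> w \<in> W \<Longrightarrow> v ** w \<in> W"
  unfolding Wgroup_def using generate.eng[of v GL _ w] by (simp add: GL_def)

lemma W_one: "mat 1 \<in> W"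
  unfolding Wgroup_def using generate.one[of GL] by (simp add: GL_def)

lemma W_inv:
  assumes "w \<in> W" shows "matrix_inv w \<in> W"
proof -
  have "inv\<^bsub>GL\<^esub> w \<in> W"
    using assms Wgens_mono_mats mono_mats_GL unfolding Wgroup_def
    by (intro group.generate_m_inv_closed[OF group_GL]) blast+
  moreover have "w \<in> carrier GL"
    using assms W_mono_mats mono_mats_GL by blast
  ultimately show ?thesis by (simp add: inv_GL)
qed

lemma W_refl_sigma: "i \<noteq> j \<Longrightarrow> \<epsilon> \<in> C \<Longrightarrow> refl_sigma i j \<epsilon> \<in> W"
  unfolding Wgroup_def by (rule generate.incl) blast

lemma W_refl_t: "\<epsilon> \<in> C' \<Longrightarrow> refl_t i \<epsilon> \<in> W"
  unfolding Wgroup_def by (rule generate.incl) blast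

end

text \<open>Injectivity of \<open>\<pi>\<close> makes the images of distinct generators anticommute.
  Hence \<open>skew_act\<close>, defined through a chosen representative, is an algebra homomorphism
  here.\<close>

lemma skew_act_mono_mat:
  assumes "inj \<pi>"
  shows "skew_act (mono_mat \<pi> a) 1 = 1"
    and "skew_act (mono_mat \<pi> a) (f + g) = skew_act (mono_mat \<pi> a) f + skew_act (mono_mat \<pi> a) g"
    and "skew_act (mono_mat \<pi> a) (const z * f) = const z * skew_act (mono_mat \<pi> a) f"
    and "skew_act (mono_mat \<pi> a) (sx k * f) = const (a k) * (sx (\<pi> k) * skew_act (mono_mat \<pi> a) f)"
proof -
  let ?h = "\<lambda>k. const (a k) * sx (\<pi> k)"
  interpret skew_eval const ?h
  proof
    fix i j :: 'a assume "i \<noteq> j"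
    with assms have "\<pi> i \<noteq> \<pi> j" by (auto simp: inj_def)
    have *: "?h i * ?h j = const (a i * a j) * (sx (\<pi> i) * sx (\<pi> j))" for i j
      by (simp only: const_mult mult.assoc sx_const_left)
    show "?h i * ?h j + ?h j * ?h i = 0"
      unfolding * mult.commute[of "a j" "a i"] anticommute_sx[OF \<open>\<pi> i \<noteq> \<pi> j\<close>] by simp
  qed (rule const_add const_mult const_one const_central)+
  have eq: "skew_act (mono_mat \<pi> a) f = free_eval const ?h (rep_spoly f)" for f
    by (simp add: skew_act_def mono_mat_nth if_distrib[where f = const]
          if_distrib[where f = "\<lambda>x. x * _"] cong: if_cong)
  show "skew_act (mono_mat \<pi> a) 1 = 1"
    "skew_act (mono_mat \<pi> a) (f + g) = skew_act (mono_mat \<pi> a) f + skew_act (mono_mat \<pi> a) g"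
    "skew_act (mono_mat \<pi> a) (const z * f) = const z * skew_act (mono_mat \<pi> a) f"
    "skew_act (mono_mat \<pi> a) (sx k * f) = const (a k) * (sx (\<pi> k) * skew_act (mono_mat \<pi> a) f)"
    by (simp_all add: eq seval_one seval_add seval_times seval_const seval_sx mult.assoc)
qed

lemma skew_act_mat_1: "skew_act (mat 1) f = f"
  unfolding mat_1_mono_mat
  by (induction f rule: spoly_induct) (simp_all add: skew_act_mono_mat)

lemma skew_act_mult:
  assumes "inj \<pi>" "inj \<rho>"
  shows "skew_act (mono_mat \<pi> a ** mono_mat \<rho> b) f = skew_act (mono_mat \<pi> a) (skew_act (mono_mat \<rho> b) f)"
  unfolding mono_mat_mult
  using assms
  by (induction f rule: spoly_induct)
     (simp_all add: skew_act_mono_mat inj_compose const_mult mult.assoc const_commute_left)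

context parameters
begin

lemma skew_act_mono_mats:
  assumes "w \<in> mono_mats C"
  shows "skew_act w 1 = 1"
    and "skew_act w (f + g) = skew_act w f + skew_act w g"
    and "skew_act w (const z * f) = const z * skew_act w f"
  using assms by (auto simp: mono_mats_def skew_act_mono_mat bij_is_inj)

lemma skew_act_mono_mats_sum:
  assumes "w \<in> mono_mats C"
  shows "skew_act w (sum g S) = (\<Sum>a\<in>S. skew_act w (g a))"
proof -
  have "skew_act w 0 = 0"
    using skew_act_mono_mats(2)[OF assms, of 0 0] by simp
  then show ?thesis
    by (induction S rule: infinite_finite_induct) (simp_all add: skew_act_mono_mats[OF assms])
qed

lemma skew_act_mono_mats_uminus:
  assumes "w \<in> mono_mats C" shows "skew_act w (- f) = - skew_act w f"
  using skew_act_mono_mats(3)[OF assms, of "- 1" f] by (simp add: const_uminus)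

lemma skew_act_mono_mats_mult:
  assumes "v \<in> mono_mats C" "w \<in> mono_mats C"
  shows "skew_act (v ** w) f = skew_act v (skew_act w f)"
  using assms by (auto simp: mono_mats_def skew_act_mult bij_is_inj)

end

lemma skew_act_refl_sigma:
  assumes "i \<noteq> j"
  shows "skew_act (refl_sigma i j \<epsilon>) (sx k * f) =
     (if k = i then const \<epsilon> * (sx j * skew_act (refl_sigma i j \<epsilon>) f)
      else if k = j then - (const (inverse \<epsilon>) * (sx i * skew_act (refl_sigma i j \<epsilon>) f))
      else sx k * skew_act (refl_sigma i j \<epsilon>) f)"
  unfolding refl_sigma_mono_mat
  using assms by (simp add: skew_act_mono_mat const_uminus Transposition.transpose_def)

lemma skew_act_refl_t:
  "skew_act (refl_t i \<epsilon>) (sx k * f) =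
     (if k = i then const \<epsilon> * (sx i * skew_act (refl_t i \<epsilon>) f) else sx k * skew_act (refl_t i \<epsilon>) f)"
  unfolding refl_t_mono_mat by (simp add: skew_act_mono_mat)

section \<open>Dunkl terms in the skew field of fractions\<close>

text \<open>Passing any other x_k costs two signs, which cancel.\<close>

lemma sx_square_central: "(sx i)\<^sup>2 * f = f * (sx i)\<^sup>2"
proof (induction f rule: spoly_induct)
  case (var k f)
  have "(sx i)\<^sup>2 * sx k = sx k * (sx i)\<^sup>2"
  proof (cases "k = i")
    case False
    then have "sx i * (sx i * sx k) = sx k * (sx i * sx i)"
      by (simp add: anticommute_sx[of i k] mult.assoc[symmetric])
    then show ?thesis by (simp add: power2_eq_square mult.assoc)
  qed (simp add: power2_eq_square mult.assoc)
  with var show ?case by (metis mult.assoc)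
qed (simp_all add: distrib_left distrib_right mult.assoc const_central_left)

lemma sx_square_diff_central:
  "((sx i)\<^sup>2 - const z * (sx j)\<^sup>2) * f = f * ((sx i)\<^sup>2 - const z * (sx j)\<^sup>2)"
  by (simp only: left_diff_distrib right_diff_distrib mult.assoc sx_square_central const_central_left)

text \<open>The numerator computations for x_k f with k different from i and j, and below for k = j
  and k = i. Read \<open>a\<close>, \<open>b\<close>, \<open>e\<close> as x_i, x_j, \<epsilon> and
  \<open>g\<close> as sigma_ij f. In an abstract ring the anticommutation rule is an oriented
  rewrite rule, whereas the rule for the \<open>sx k\<close> would loop.\<close>

lemma dunkl_identity_other:
  fixes a b e x :: "'r::ring_1"
  assumes "\<And>y. a * (x * y) = - (x * (a * y))" "\<And>y. b * (x * y) = - (x * (b * y))"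
    and "\<And>y. x * (e * y) = e * (x * y)"
  shows "(a + e * b) * (x * f - x * g) = - (x * ((a + e * b) * (f - g)))"
  by (simp add: distrib_left distrib_right left_diff_distrib right_diff_distrib mult.assoc assms)

text \<open>Here \<open>e'\<close> is the inverse of \<epsilon>, so the second factor on the left is
  x_j f - sigma_ij(x_j f). On the right the multiple of the denominator will become polynomial; the
  last bracket is the remainder that stays a fraction.\<close>

lemma dunkl_identity_neq:
  fixes a b e e' :: "'r::ring_1"
  assumes "\<And>y. b * (a * y) = - (a * (b * y))" "\<And>y. e * (e' * y) = y"
    and "\<And>y. a * (e * y) = e * (a * y)" "\<And>y. b * (e * y) = e * (b * y)"
    and "\<And>y. a * (e' * y) = e' * (a * y)" "\<And>y. b * (e' * y) = e' * (b * y)"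
  shows "(a + e * b) * (b * f + e' * (a * g)) =
     - (b * ((a + e * b) * (f - g))) + (a\<^sup>2 - e\<^sup>2 * b\<^sup>2) * (e' * g) + (e * (b * (b * f)) + e * (b * (b * f)))"
  by (simp add: distrib_left distrib_right left_diff_distrib right_diff_distrib mult.assoc
      power2_eq_square assms)

lemma dunkl_identity_eq:
  fixes a b e :: "'r::ring_1"
  assumes "\<And>y. b * (a * y) = - (a * (b * y))"
    and "\<And>y. a * (e * y) = e * (a * y)" "\<And>y. b * (e * y) = e * (b * y)"
  shows "(a + e * b) * (a * f - e * (b * g)) =
     a * ((a + e * b) * (f - g)) + (a\<^sup>2 - e\<^sup>2 * b\<^sup>2) * g - (e * (a * (b * f)) + e * (a * (b * f)))"
  by (simp add: distrib_left distrib_right left_diff_distrib right_diff_distrib mult.assoc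
      power2_eq_square assms)

lemma anticommute_sx_left: "i \<noteq> j \<Longrightarrow> sx i * (sx j * f) = - (sx j * (sx i * f))"
  by (simp add: mult.assoc[symmetric] anticommute_sx[of i j])

lemma inverse_commute_division_ring:
  fixes a b :: "'k::division_ring"
  assumes "a * b = b * a" "a \<noteq> 0" shows "inverse a * b = b * inverse a"
  by (metis assms mult.assoc mult_1_right left_inverse mult_1_left right_inverse)

locale fraction_field =
  fixes \<phi> :: "'n::{finite,linorder} spoly \<Rightarrow> 'k::division_ring"
  assumes fractions: "skew_field_of_fractions \<phi>"
begin

lemma phi_one: "\<phi> 1 = 1" and phi_add: "\<phi> (f + g) = \<phi> f + \<phi> g" and phi_times: "\<phi> (f * g) = \<phi> f * \<phi> g"
  and phi_inj: "inj \<phi>"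
  using fractions by (simp_all add: skew_field_of_fractions_def)

lemma phi_zero: "\<phi> 0 = 0"
  using phi_add[of 0 0] by simp

lemma phi_uminus: "\<phi> (- f) = - \<phi> f"
  using phi_add[of f "- f"] by (simp add: phi_zero eq_neg_iff_add_eq_0 add.commute)

lemma phi_diff: "\<phi> (f - g) = \<phi> f - \<phi> g"
  using phi_add[of f "- g"] by (simp add: phi_uminus)

lemma phi_sum: "\<phi> (sum h S) = (\<Sum>a\<in>S. \<phi> (h a))"
  by (induction S rule: infinite_finite_induct) (simp_all add: phi_zero phi_add)

lemma phi_eq_0: "\<phi> f = 0 \<longleftrightarrow> f = 0"
  using phi_inj phi_zero by (metis injD)

text \<open>\<open>'k\<close> is merely a division ring, so characteristic 2 has to be excluded: 2
  is the image of \<open>const 2\<close>, which is nonzero because it is invertible.\<close>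

lemma double_eq_0:
  fixes x :: 'k assumes "x + x = 0" shows "x = 0"
proof -
  have "const (1 + 1) = (1 + 1 :: 'n spoly)"
    by (simp only: const_add const_one)
  then have "\<phi> (const 2) * x = x + x"
    by (simp only: one_add_one[where ?'a = complex] phi_add phi_one distrib_right mult_1_left)
  then have "\<phi> (const 2) * x = 0"
    using assms by simp
  moreover have "const 2 \<noteq> (0 :: 'n spoly)"
    using const_inverse(1)[of 2, where ?'a = 'n] by auto
  ultimately show ?thesis by (simp add: phi_eq_0)
qed

definition dunkl_sigma :: "'n \<Rightarrow> 'n \<Rightarrow> complex \<Rightarrow> 'n spoly \<Rightarrow> 'k" where
  "dunkl_sigma i j \<epsilon> f = \<phi> (sx i + const \<epsilon> * sx j) / \<phi> ((sx i)\<^sup>2 - const (\<epsilon>\<^sup>2) * (sx j)\<^sup>2)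
     * \<phi> (f - skew_act (refl_sigma i j \<epsilon>) f)"

definition dunkl_t :: "'n \<Rightarrow> complex \<Rightarrow> 'n spoly \<Rightarrow> 'k" where
  "dunkl_t i \<epsilon> f = 1 / \<phi> (sx i) * \<phi> (f - skew_act (refl_t i \<epsilon>) f)"

abbreviation denom :: "'n \<Rightarrow> 'n \<Rightarrow> complex \<Rightarrow> 'k" where
  "denom i j \<epsilon> \<equiv> \<phi> ((sx i)\<^sup>2 - const (\<epsilon>\<^sup>2) * (sx j)\<^sup>2)"

lemma denom_nonzero: "i \<noteq> j \<Longrightarrow> denom i j \<epsilon> \<noteq> 0"
  using sx_square_diff_nonzero by (simp add: phi_eq_0)

lemma inverse_denom_central:
  "i \<noteq> j \<Longrightarrow> inverse (denom i j \<epsilon>) * \<phi> f = \<phi> f * inverse (denom i j \<epsilon>)"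
  by (rule inverse_commute_division_ring)
     (simp_all only: phi_times[symmetric] sx_square_diff_central denom_nonzero not_False_eq_True)

text \<open>Pulling the central denominator to the front leaves the image of an element of
  S_{-1}(V), where the ring identities above apply.\<close>

lemma dunkl_sigma_eq:
  assumes "i \<noteq> j"
  shows "dunkl_sigma i j \<epsilon> f = inverse (denom i j \<epsilon>) *
     \<phi> ((sx i + const \<epsilon> * sx j) * (f - skew_act (refl_sigma i j \<epsilon>) f))"
  unfolding dunkl_sigma_def divide_inverse inverse_denom_central[OF assms, symmetric]
  by (simp only: phi_times mult.assoc)

lemma dunkl_sigma_other:
  assumes "i \<noteq> j" "k \<noteq> i" "k \<noteq> j"
  shows "dunkl_sigma i j \<epsilon> (sx k * f) = - (\<phi> (sx k) * dunkl_sigma i j \<epsilon> f)"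
proof -
  have "(sx i + const \<epsilon> * sx j) * (sx k * f - sx k * skew_act (refl_sigma i j \<epsilon>) f) =
    - (sx k * ((sx i + const \<epsilon> * sx j) * (f - skew_act (refl_sigma i j \<epsilon>) f)))"
    using assms by (intro dunkl_identity_other anticommute_sx_left sx_const_left) auto
  then have "dunkl_sigma i j \<epsilon> (sx k * f) = - (inverse (denom i j \<epsilon>) * \<phi> (sx k) *
      \<phi> ((sx i + const \<epsilon> * sx j) * (f - skew_act (refl_sigma i j \<epsilon>) f)))"
    using assms by (simp add: dunkl_sigma_eq skew_act_refl_sigma phi_uminus phi_times mult.assoc)
  also have "\<dots> = - (\<phi> (sx k) * dunkl_sigma i j \<epsilon> f)"
    unfolding inverse_denom_central[OF assms(1)] using assms(1)
    by (simp only: dunkl_sigma_eq mult.assoc not_False_eq_True)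
  finally show ?thesis .
qed

text \<open>This is \<open>dunkl_identity_neq\<close> divided by the denominator. The denominator
  depends on \<open>\<epsilon>\<close> through its square only, so the last summand changes sign
  with \<open>\<epsilon>\<close>.\<close>

lemma dunkl_sigma_neq:
  assumes "i \<noteq> j" "\<epsilon> \<noteq> 0"
  shows "dunkl_sigma i j \<epsilon> (sx j * f) = - (\<phi> (sx j) * dunkl_sigma i j \<epsilon> f)
     + \<phi> (const (inverse \<epsilon>) * skew_act (refl_sigma i j \<epsilon>) f)
     + inverse (denom i j \<epsilon>) * \<phi> (const (2 * \<epsilon>) * (sx j * (sx j * f)))"
proof -
  let ?s = "skew_act (refl_sigma i j \<epsilon>) f" and ?u = "sx i + const \<epsilon> * sx j"
  let ?q = "(sx i)\<^sup>2 - const (\<epsilon>\<^sup>2) * (sx j)\<^sup>2"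
  have "?u * (sx j * f + const (inverse \<epsilon>) * (sx i * ?s)) = - (sx j * (?u * (f - ?s)))
      + ((sx i)\<^sup>2 - (const \<epsilon>)\<^sup>2 * (sx j)\<^sup>2) * (const (inverse \<epsilon>) * ?s)
      + (const \<epsilon> * (sx j * (sx j * f)) + const \<epsilon> * (sx j * (sx j * f)))"
    using assms
    by (intro dunkl_identity_neq anticommute_sx_left sx_const_left)
       (auto simp: mult.assoc[symmetric] const_inverse)
  also have "(const \<epsilon>)\<^sup>2 = const (\<epsilon>\<^sup>2)" by (simp add: power2_eq_square const_mult)
  also have "const \<epsilon> * (sx j * (sx j * f)) + const \<epsilon> * (sx j * (sx j * f)) =
      const (2 * \<epsilon>) * (sx j * (sx j * f))"
    by (simp only: mult_2 const_add distrib_right)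
  finally have *: "?u * (sx j * f + const (inverse \<epsilon>) * (sx i * ?s)) =
      - (sx j * (?u * (f - ?s))) + ?q * (const (inverse \<epsilon>) * ?s) + const (2 * \<epsilon>) * (sx j * (sx j * f))" .
  have "inverse (\<phi> ?q) * \<phi> (?q * g) = \<phi> g" for g
    using denom_nonzero[OF assms(1)] by (simp add: phi_times mult.assoc[symmetric])
  moreover have "inverse (\<phi> ?q) * \<phi> (sx j * g) = \<phi> (sx j) * (inverse (\<phi> ?q) * \<phi> g)" for g
    by (simp only: phi_times mult.assoc[symmetric] inverse_denom_central[OF assms(1), of \<epsilon> "sx j"])
  moreover have "dunkl_sigma i j \<epsilon> (sx j * f) =
      inverse (\<phi> ?q) * \<phi> (?u * (sx j * f + const (inverse \<epsilon>) * (sx i * ?s)))"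
    using assms by (simp add: dunkl_sigma_eq skew_act_refl_sigma)
  ultimately show ?thesis
    unfolding * phi_add phi_uminus dunkl_sigma_eq[OF assms(1), of \<epsilon> f] by (simp only: distrib_left mult_minus_right)
qed

lemma dunkl_sigma_self:
  assumes "i \<noteq> j"
  shows "dunkl_sigma i j \<epsilon> (sx i * f) = \<phi> (sx i) * dunkl_sigma i j \<epsilon> f
     + \<phi> (skew_act (refl_sigma i j \<epsilon>) f)
     - inverse (denom i j \<epsilon>) * \<phi> (const (2 * \<epsilon>) * (sx i * (sx j * f)))"
proof -
  let ?s = "skew_act (refl_sigma i j \<epsilon>) f" and ?u = "sx i + const \<epsilon> * sx j"
  let ?q = "(sx i)\<^sup>2 - const (\<epsilon>\<^sup>2) * (sx j)\<^sup>2"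
  have "?u * (sx i * f - const \<epsilon> * (sx j * ?s)) = sx i * (?u * (f - ?s))
      + ((sx i)\<^sup>2 - (const \<epsilon>)\<^sup>2 * (sx j)\<^sup>2) * ?s
      - (const \<epsilon> * (sx i * (sx j * f)) + const \<epsilon> * (sx i * (sx j * f)))"
    using assms by (intro dunkl_identity_eq anticommute_sx_left sx_const_left) auto
  also have "(const \<epsilon>)\<^sup>2 = const (\<epsilon>\<^sup>2)" by (simp add: power2_eq_square const_mult)
  also have "const \<epsilon> * (sx i * (sx j * f)) + const \<epsilon> * (sx i * (sx j * f)) =
      const (2 * \<epsilon>) * (sx i * (sx j * f))"
    by (simp only: mult_2 const_add distrib_right)
  finally have *: "?u * (sx i * f - const \<epsilon> * (sx j * ?s)) =
      sx i * (?u * (f - ?s)) + ?q * ?s - const (2 * \<epsilon>) * (sx i * (sx j * f))" .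
  have q: "inverse (\<phi> ?q) * \<phi> (?q * g) = \<phi> g" for g
    using denom_nonzero[OF assms(1)] by (simp add: phi_times mult.assoc[symmetric])
  have x: "inverse (\<phi> ?q) * \<phi> (sx i * g) = \<phi> (sx i) * (inverse (\<phi> ?q) * \<phi> g)" for g
    by (simp only: phi_times mult.assoc[symmetric] inverse_denom_central[OF assms(1), of \<epsilon> "sx i"])
  have split: "k * \<phi> (a + b - d) = k * \<phi> a + k * \<phi> b - k * \<phi> d" for k a b d
    by (simp only: phi_add phi_diff distrib_left right_diff_distrib)
  have "dunkl_sigma i j \<epsilon> (sx i * f) = inverse (\<phi> ?q) * \<phi> (?u * (sx i * f - const \<epsilon> * (sx j * ?s)))"
    using assms by (simp add: dunkl_sigma_eq skew_act_refl_sigma)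
  then show ?thesis
    unfolding * split q x dunkl_sigma_eq[OF assms(1), of \<epsilon> f] .
qed

text \<open>Since x_i anticommutes with x_k, so does its inverse.\<close>

lemma dunkl_t_other:
  assumes "k \<noteq> i"
  shows "dunkl_t i \<epsilon> (sx k * f) = - (\<phi> (sx k) * dunkl_t i \<epsilon> f)"
proof -
  have nz: "\<phi> (sx i) \<noteq> 0" by (simp add: phi_eq_0 sx_nonzero)
  have "\<phi> (sx i) * (- \<phi> (sx k)) = \<phi> (sx k) * \<phi> (sx i)"
    unfolding phi_uminus[symmetric] phi_times[symmetric] using anticommute_sx[OF assms] by simp
  then have "\<phi> (sx i) * (- \<phi> (sx k)) * inverse (\<phi> (sx i)) = \<phi> (sx k)"
    using nz by (simp add: mult.assoc)
  then have *: "inverse (\<phi> (sx i)) * \<phi> (sx k) = - \<phi> (sx k) * inverse (\<phi> (sx i))"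
    using nz by (metis left_inverse mult.assoc mult_1_left)
  have "dunkl_t i \<epsilon> (sx k * f) = inverse (\<phi> (sx i)) * \<phi> (sx k) * \<phi> (f - skew_act (refl_t i \<epsilon>) f)"
    using assms by (simp add: dunkl_t_def skew_act_refl_t divide_inverse mult.assoc
        right_diff_distrib[symmetric] phi_times)
  then show ?thesis
    unfolding * by (simp add: dunkl_t_def divide_inverse mult.assoc)
qed

text \<open>As t_i(x_i f) = \<epsilon> x_i t_i(f), the new contribution is x_i (1 - \<epsilon>)
  t_i(f), and 1/x_i cancels x_i. The factor 1 - \<epsilon> is the reason for the coefficient
  c_\<epsilon> / (1 - \<epsilon>) in the Dunkl operator.\<close>

lemma dunkl_t_self:
  "dunkl_t i \<epsilon> (sx i * f) = \<phi> (sx i) * dunkl_t i \<epsilon> f + \<phi> (const (1 - \<epsilon>) * skew_act (refl_t i \<epsilon>) f)"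
proof -
  have nz: "\<phi> (sx i) \<noteq> 0" by (simp add: phi_eq_0 sx_nonzero)
  let ?t = "skew_act (refl_t i \<epsilon>) f"
  have const_diff_one: "const (1 - \<epsilon>) = 1 - (const \<epsilon> :: 'n spoly)"
    using const_add[of 1 "- \<epsilon>", where ?'a = 'n] by (simp add: const_uminus)
  have "sx i * f - skew_act (refl_t i \<epsilon>) (sx i * f) = sx i * (f - ?t) + sx i * (const (1 - \<epsilon>) * ?t)"
    by (simp add: const_diff_one skew_act_refl_t left_diff_distrib right_diff_distrib sx_const_left)
  then show ?thesis
    using nz
    by (simp add: dunkl_t_def divide_inverse phi_add phi_times distrib_left)
       (simp add: mult.assoc[symmetric])
qed

lemma dunkl_sigma_linear:
  assumes "i \<noteq> j"
  shows "dunkl_sigma i j \<epsilon> 1 = 0" "dunkl_sigma i j \<epsilon> (f + g) = dunkl_sigma i j \<epsilon> f + dunkl_sigma i j \<epsilon> g"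
    "dunkl_sigma i j \<epsilon> (const z * f) = \<phi> (const z) * dunkl_sigma i j \<epsilon> f"
proof -
  have i: "inj (Transposition.transpose i j)" by (rule inj_transpose)
  show "dunkl_sigma i j \<epsilon> 1 = 0" "dunkl_sigma i j \<epsilon> (f + g) = dunkl_sigma i j \<epsilon> f + dunkl_sigma i j \<epsilon> g"
    unfolding dunkl_sigma_def
    by (simp_all add: refl_sigma_mono_mat skew_act_mono_mat[OF i] phi_zero add_diff_add
          phi_add distrib_left)
  have "dunkl_sigma i j \<epsilon> (const z * f) = inverse (denom i j \<epsilon>) * \<phi> (const z) *
      \<phi> ((sx i + const \<epsilon> * sx j) * (f - skew_act (refl_sigma i j \<epsilon>) f))"
    unfolding dunkl_sigma_eq[OF assms]
    by (simp add: refl_sigma_mono_mat skew_act_mono_mat[OF i] phi_times[symmetric] mult.assoc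
         right_diff_distrib[symmetric] const_central_left)
  then show "dunkl_sigma i j \<epsilon> (const z * f) = \<phi> (const z) * dunkl_sigma i j \<epsilon> f"
    unfolding inverse_denom_central[OF assms, of \<epsilon> "const z"] by (simp only: dunkl_sigma_eq[OF assms] mult.assoc)
qed

lemma dunkl_t_linear:
  "dunkl_t i \<epsilon> 1 = 0" "dunkl_t i \<epsilon> (f + g) = dunkl_t i \<epsilon> f + dunkl_t i \<epsilon> g"
  "dunkl_t i \<epsilon> (const z * f) = \<phi> (const z) * dunkl_t i \<epsilon> f"
proof -
  show "dunkl_t i \<epsilon> 1 = 0" "dunkl_t i \<epsilon> (f + g) = dunkl_t i \<epsilon> f + dunkl_t i \<epsilon> g"
    unfolding dunkl_t_def
    by (simp_all add: refl_t_mono_mat skew_act_mono_mat phi_zero add_diff_add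
          phi_add distrib_left)
  have "inverse (\<phi> (sx i)) * \<phi> (const z) = \<phi> (const z) * inverse (\<phi> (sx i))"
    by (rule inverse_commute_division_ring)
       (simp_all only: phi_times[symmetric] sx_const phi_eq_0 sx_nonzero not_False_eq_True)
  then show "dunkl_t i \<epsilon> (const z * f) = \<phi> (const z) * dunkl_t i \<epsilon> f"
    unfolding dunkl_t_def
    by (simp add: refl_t_mono_mat skew_act_mono_mat right_diff_distrib[symmetric] phi_times
         divide_inverse mult.assoc[symmetric])
qed

end

section \<open>Braided Dunkl operators\<close>

context parameters
begin

text \<open>The group algebra element in the relation for y_j x_i + x_i y_j, without its factor
  \<open>s * c 1\<close>, acting on S_{-1}(V). In the same way \<open>refl_sum i\<close> is the
  right side of the relation for y_i x_i - x_i y_i.\<close>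

definition sigma_sum :: "'n \<Rightarrow> 'n \<Rightarrow> 'n::finite spoly \<Rightarrow> 'n spoly" where
  "sigma_sum i j f = (\<Sum>\<epsilon>\<in>C. const \<epsilon> * skew_act (refl_sigma i j \<epsilon>) f)"

definition refl_sum :: "'n \<Rightarrow> 'n::finite spoly \<Rightarrow> 'n spoly" where
  "refl_sum i f = f + const (c 1) * (\<Sum>j\<in>UNIV - {i}. \<Sum>\<epsilon>\<in>C. skew_act (refl_sigma i j \<epsilon>) f)
     + (\<Sum>\<epsilon>\<in>C' - {1}. const (c \<epsilon>) * skew_act (refl_t i \<epsilon>) f)"

lemma refl_sigma_swap:
  assumes "i \<noteq> j" "\<epsilon> \<noteq> 0" shows "refl_sigma j i (- inverse \<epsilon>) = refl_sigma i j \<epsilon>"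
  unfolding refl_sigma_def using assms by (intro arg_cong[where f = from_columns]) auto

text \<open>The substitution \<epsilon> \<mapsto> -1/\<epsilon> permutes \<open>C\<close>, exchanges
  the two indices by \<open>refl_sigma_swap\<close>, and turns the weight 1/\<epsilon> into
  -\<epsilon>.\<close>

lemma sum_sigma_swap:
  assumes "i \<noteq> j"
  shows "(\<Sum>\<epsilon>\<in>C. const (inverse \<epsilon>) * skew_act (refl_sigma j i \<epsilon>) f) = - sigma_sum i j f"
proof -
  let ?g = "\<lambda>\<epsilon>. const (inverse \<epsilon>) * skew_act (refl_sigma j i \<epsilon>) f"
  have "(\<Sum>\<epsilon>\<in>C. ?g \<epsilon>) = (\<Sum>\<epsilon>\<in>C. ?g (- inverse \<epsilon>))"
    using C_inverse C_uminus by (intro sum_C_reindex[symmetric]) (auto simp: inj_on_def)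
  also have "\<dots> = (\<Sum>\<epsilon>\<in>C. - (const \<epsilon> * skew_act (refl_sigma i j \<epsilon>) f))"
    using assms C_nonzero by (intro sum.cong) (auto simp: refl_sigma_swap const_uminus inverse_minus_eq)
  finally show ?thesis by (simp add: sigma_sum_def sum_negf)
qed

end

locale dunkl = parameters C C' c + fraction_field \<phi>
  for C C' :: "complex set" and c :: "complex \<Rightarrow> complex"
    and \<phi> :: "'n::{finite,linorder} spoly \<Rightarrow> 'k::division_ring"
begin

abbreviation "dunkl_value \<equiv> braided_dunkl \<phi> C C' c"

lemma dunkl_value_eq:
  "dunkl_value i f = \<phi> (braided_deriv i f)
     + \<phi> (const (c 1)) * (\<Sum>j\<in>UNIV - {i}. \<Sum>\<epsilon>\<in>C. dunkl_sigma i j \<epsilon> f)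
     + (\<Sum>\<epsilon>\<in>C' - {1}. \<phi> (const (c \<epsilon> / (1 - \<epsilon>))) * dunkl_t i \<epsilon> f)"
  by (simp only: braided_dunkl_def dunkl_sigma_def dunkl_t_def mult.assoc)

lemma phi_const_commute: "\<phi> f * \<phi> (const z) = \<phi> (const z) * \<phi> f"
  by (simp only: phi_times[symmetric] const_central)

lemma phi_const_left_commute: "\<phi> (const z) * (\<phi> f * x) = \<phi> f * (\<phi> (const z) * x)"
  by (metis mult.assoc phi_const_commute)

lemma dunkl_value_one: "dunkl_value i 1 = 0"
proof -
  have "(\<Sum>j\<in>UNIV - {i}. \<Sum>\<epsilon>\<in>C. dunkl_sigma i j \<epsilon> 1) = 0"
    by (intro sum.neutral ballI) (auto simp: dunkl_sigma_linear)
  then show ?thesis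
    by (simp add: dunkl_value_eq braided_deriv_rules(1) phi_zero dunkl_t_linear(1))
qed

lemma dunkl_value_add: "dunkl_value i (f + g) = dunkl_value i f + dunkl_value i g"
proof -
  have "(\<Sum>j\<in>UNIV - {i}. \<Sum>\<epsilon>\<in>C. dunkl_sigma i j \<epsilon> (f + g)) =
      (\<Sum>j\<in>UNIV - {i}. \<Sum>\<epsilon>\<in>C. dunkl_sigma i j \<epsilon> f + dunkl_sigma i j \<epsilon> g)"
    by (intro sum.cong refl dunkl_sigma_linear) auto
  then show ?thesis
    by (simp add: dunkl_value_eq braided_deriv_rules(2) phi_add dunkl_t_linear(2) distrib_left sum.distrib)
qed

lemma dunkl_value_const: "dunkl_value i (const z * f) = \<phi> (const z) * dunkl_value i f"
proof -
  have "(\<Sum>j\<in>UNIV - {i}. \<Sum>\<epsilon>\<in>C. dunkl_sigma i j \<epsilon> (const z * f)) =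
      (\<Sum>j\<in>UNIV - {i}. \<Sum>\<epsilon>\<in>C. \<phi> (const z) * dunkl_sigma i j \<epsilon> f)"
    by (intro sum.cong refl dunkl_sigma_linear) auto
  then show ?thesis
    by (simp only: dunkl_value_eq braided_deriv_rules(3) phi_times dunkl_t_linear(3) distrib_left
        sum_distrib_left phi_const_left_commute[where f = "const z"])
qed

text \<open>The terms that are not polynomial are odd in \<open>\<epsilon>\<close>, hence cancel because \<open>- 1 \<in> C\<close>.\<close>

lemma sum_C_odd:
  assumes "\<And>\<epsilon>. \<epsilon> \<in> C \<Longrightarrow> g (- \<epsilon>) = - g \<epsilon>"
  shows "(\<Sum>\<epsilon>\<in>C. g \<epsilon>) = (0 :: 'k)"
proof -
  have "(\<Sum>\<epsilon>\<in>C. g (- \<epsilon>)) = (\<Sum>\<epsilon>\<in>C. g \<epsilon>)"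
    using C_uminus by (intro sum_C_reindex) auto
  moreover have "(\<Sum>\<epsilon>\<in>C. g (- \<epsilon>)) = - (\<Sum>\<epsilon>\<in>C. g \<epsilon>)"
    unfolding sum_negf[symmetric] by (intro sum.cong refl assms)
  ultimately have "(\<Sum>\<epsilon>\<in>C. g \<epsilon>) = - (\<Sum>\<epsilon>\<in>C. g \<epsilon>)"
    by (rule trans[OF sym])
  then show ?thesis
    unfolding eq_neg_iff_add_eq_0 by (rule double_eq_0)
qed

lemma sum_dunkl_sigma_neq:
  assumes "i \<noteq> j"
  shows "(\<Sum>\<epsilon>\<in>C. dunkl_sigma i j \<epsilon> (sx j * f)) =
    - (\<phi> (sx j) * (\<Sum>\<epsilon>\<in>C. dunkl_sigma i j \<epsilon> f)) - \<phi> (sigma_sum j i f)"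
proof -
  let ?h = "\<lambda>\<epsilon>. inverse (denom i j \<epsilon>) * \<phi> (const (2 * \<epsilon>) * (sx j * (sx j * f)))"
  have "(\<Sum>\<epsilon>\<in>C. ?h \<epsilon>) = 0"
    by (rule sum_C_odd) (simp add: const_uminus phi_uminus)
  moreover have "(\<Sum>\<epsilon>\<in>C. dunkl_sigma i j \<epsilon> (sx j * f)) =
      (\<Sum>\<epsilon>\<in>C. - (\<phi> (sx j) * dunkl_sigma i j \<epsilon> f)
        + \<phi> (const (inverse \<epsilon>) * skew_act (refl_sigma i j \<epsilon>) f) + ?h \<epsilon>)"
    using assms C_nonzero by (intro sum.cong refl dunkl_sigma_neq)
  moreover have "(\<Sum>\<epsilon>\<in>C. \<phi> (const (inverse \<epsilon>) * skew_act (refl_sigma i j \<epsilon>) f)) = - \<phi> (sigma_sum j i f)"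
    using sum_sigma_swap[of j i f] assms by (simp only: phi_sum[symmetric] phi_uminus not_sym not_False_eq_True)
  ultimately show ?thesis
    by (simp add: sum.distrib sum_negf sum_distrib_left sum_subtractf)
qed

lemma sum_dunkl_sigma_self:
  assumes "i \<noteq> j"
  shows "(\<Sum>\<epsilon>\<in>C. dunkl_sigma i j \<epsilon> (sx i * f)) =
    \<phi> (sx i) * (\<Sum>\<epsilon>\<in>C. dunkl_sigma i j \<epsilon> f) + \<phi> (\<Sum>\<epsilon>\<in>C. skew_act (refl_sigma i j \<epsilon>) f)"
proof -
  let ?h = "\<lambda>\<epsilon>. inverse (denom i j \<epsilon>) * \<phi> (const (2 * \<epsilon>) * (sx i * (sx j * f)))"
  have "(\<Sum>\<epsilon>\<in>C. ?h \<epsilon>) = 0"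
    by (rule sum_C_odd) (simp add: const_uminus phi_uminus)
  moreover have "(\<Sum>\<epsilon>\<in>C. dunkl_sigma i j \<epsilon> (sx i * f)) =
      (\<Sum>\<epsilon>\<in>C. \<phi> (sx i) * dunkl_sigma i j \<epsilon> f + \<phi> (skew_act (refl_sigma i j \<epsilon>) f) - ?h \<epsilon>)"
    using assms by (intro sum.cong refl dunkl_sigma_self)
  ultimately show ?thesis
    by (simp add: sum.distrib sum_subtractf sum_distrib_left phi_sum)
qed

lemma sum_dunkl_sigma_other:
  assumes "i \<noteq> j" "k \<noteq> i" "k \<noteq> j"
  shows "(\<Sum>\<epsilon>\<in>C. dunkl_sigma i j \<epsilon> (sx k * f)) = - (\<phi> (sx k) * (\<Sum>\<epsilon>\<in>C. dunkl_sigma i j \<epsilon> f))"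
  using assms by (simp add: dunkl_sigma_other sum_negf sum_distrib_left)

lemma dunkl_value_neq:
  assumes "j \<noteq> i"
  shows "dunkl_value i (sx j * f) =
    - (\<phi> (sx j) * dunkl_value i f) - \<phi> (const (c 1) * sigma_sum j i f)"
proof -
  let ?S = "\<lambda>l f. \<Sum>\<epsilon>\<in>C. dunkl_sigma i l \<epsilon> f"
  \<comment> \<open>Among the reflections occurring in D_i only those with \<open>l = j\<close> move
    x_j; the other terms just change sign.\<close>
  have "(\<Sum>l\<in>UNIV - {i}. ?S l (sx j * f)) = ?S j (sx j * f) + (\<Sum>l\<in>UNIV - {i} - {j}. ?S l (sx j * f))"
    using assms by (intro sum.remove) auto
  also have "(\<Sum>l\<in>UNIV - {i} - {j}. ?S l (sx j * f)) = (\<Sum>l\<in>UNIV - {i} - {j}. - (\<phi> (sx j) * ?S l f))"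
    using assms by (intro sum.cong refl sum_dunkl_sigma_other) auto
  also have "?S j (sx j * f) = - (\<phi> (sx j) * ?S j f) - \<phi> (sigma_sum j i f)"
    using assms by (intro sum_dunkl_sigma_neq) auto
  also have "- (\<phi> (sx j) * ?S j f) - \<phi> (sigma_sum j i f) + (\<Sum>l\<in>UNIV - {i} - {j}. - (\<phi> (sx j) * ?S l f))
      = - (\<phi> (sx j) * (?S j f + (\<Sum>l\<in>UNIV - {i} - {j}. ?S l f))) - \<phi> (sigma_sum j i f)"
    by (simp add: sum_negf sum_distrib_left distrib_left)
  also have "?S j f + (\<Sum>l\<in>UNIV - {i} - {j}. ?S l f) = (\<Sum>l\<in>UNIV - {i}. ?S l f)"
    using assms by (intro sum.remove[symmetric]) auto
  finally have "\<phi> (const (c 1)) * (\<Sum>l\<in>UNIV - {i}. ?S l (sx j * f)) =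
      - (\<phi> (sx j) * (\<phi> (const (c 1)) * (\<Sum>l\<in>UNIV - {i}. ?S l f))) - \<phi> (const (c 1) * sigma_sum j i f)"
    by (simp only: right_diff_distrib mult_minus_right phi_times phi_const_left_commute)
  moreover have "(\<Sum>\<epsilon>\<in>C' - {1}. \<phi> (const (c \<epsilon> / (1 - \<epsilon>))) * dunkl_t i \<epsilon> (sx j * f)) =
      - (\<phi> (sx j) * (\<Sum>\<epsilon>\<in>C' - {1}. \<phi> (const (c \<epsilon> / (1 - \<epsilon>))) * dunkl_t i \<epsilon> f))"
    using assms by (simp only: dunkl_t_other mult_minus_right sum_negf sum_distrib_left phi_const_left_commute
      not_False_eq_True)
  ultimately show ?thesis
    using assms by (simp add: dunkl_value_eq braided_deriv_rules(5) phi_uminus phi_times distrib_left)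
qed

lemma dunkl_value_self: "dunkl_value i (sx i * f) = \<phi> (sx i) * dunkl_value i f + \<phi> (refl_sum i f)"
proof -
  let ?S = "\<lambda>l f. \<Sum>\<epsilon>\<in>C. dunkl_sigma i l \<epsilon> f"
  have "(\<Sum>l\<in>UNIV - {i}. ?S l (sx i * f)) =
      (\<Sum>l\<in>UNIV - {i}. \<phi> (sx i) * ?S l f + \<phi> (\<Sum>\<epsilon>\<in>C. skew_act (refl_sigma i l \<epsilon>) f))"
    by (intro sum.cong refl sum_dunkl_sigma_self) auto
  then have "\<phi> (const (c 1)) * (\<Sum>l\<in>UNIV - {i}. ?S l (sx i * f)) =
      \<phi> (sx i) * (\<phi> (const (c 1)) * (\<Sum>l\<in>UNIV - {i}. ?S l f))
       + \<phi> (const (c 1) * (\<Sum>l\<in>UNIV - {i}. \<Sum>\<epsilon>\<in>C. skew_act (refl_sigma i l \<epsilon>) f))"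
    by (simp only: sum.distrib distrib_left phi_times phi_sum sum_distrib_left phi_const_left_commute)
  moreover have "(\<Sum>\<epsilon>\<in>C' - {1}. \<phi> (const (c \<epsilon> / (1 - \<epsilon>))) * dunkl_t i \<epsilon> (sx i * f)) =
      \<phi> (sx i) * (\<Sum>\<epsilon>\<in>C' - {1}. \<phi> (const (c \<epsilon> / (1 - \<epsilon>))) * dunkl_t i \<epsilon> f)
      + \<phi> (\<Sum>\<epsilon>\<in>C' - {1}. const (c \<epsilon>) * skew_act (refl_t i \<epsilon>) f)"
  proof -
    have "\<phi> (const (c \<epsilon> / (1 - \<epsilon>))) * dunkl_t i \<epsilon> (sx i * f) =
        \<phi> (sx i) * (\<phi> (const (c \<epsilon> / (1 - \<epsilon>))) * dunkl_t i \<epsilon> f) + \<phi> (const (c \<epsilon>) * skew_act (refl_t i \<epsilon>) f)"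
      if "\<epsilon> \<in> C' - {1}" for \<epsilon>
    proof -
      \<comment> \<open>Division by \<open>1 - \<epsilon>\<close> is legitimate because
        \<open>\<epsilon> = 1\<close> is excluded from this sum.\<close>
      have "const (c \<epsilon> / (1 - \<epsilon>)) * (const (1 - \<epsilon>) * g) = const (c \<epsilon>) * g" for g :: "'n spoly"
        using that by (simp add: mult.assoc[symmetric] const_mult[symmetric])
      then have "\<phi> (const (c \<epsilon> / (1 - \<epsilon>))) * \<phi> (const (1 - \<epsilon>) * g) = \<phi> (const (c \<epsilon>) * g)" for g
        by (simp only: phi_times[symmetric])
      then show ?thesis
        by (simp only: dunkl_t_self distrib_left phi_const_left_commute)
    qed
    then show ?thesis by (simp add: sum.distrib sum_distrib_left phi_sum)
  qed
  ultimately show ?thesis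
    by (simp add: dunkl_value_eq braided_deriv_rules(4) phi_add phi_times distrib_left refl_sum_def)
qed

text \<open>Once the fractions have cancelled in the sum over \<open>C\<close>, the value on x_k f
  is obtained from the value on f by operations inside the image of \<open>\<phi>\<close>, and the
  value on 1 is 0.\<close>

lemma ex_dunkl: "\<exists>g. \<phi> g = dunkl_value i f"
proof (induction f rule: spoly_induct)
  case one
  show ?case using phi_zero dunkl_value_one by metis
next
  case (add f g)
  then show ?case unfolding dunkl_value_add by (metis phi_add)
next
  case (scale z f)
  then show ?case unfolding dunkl_value_const by (metis phi_times)
next
  case (var k f)
  then obtain g where g: "\<phi> g = dunkl_value i f" by blast
  show ?case
  proof (cases "k = i")
    case True
    with g have "\<phi> (sx i * g + refl_sum i f) = dunkl_value i (sx k * f)"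
      by (simp add: dunkl_value_self phi_add phi_times)
    then show ?thesis by blast
  next
    case False
    have "\<phi> (- (sx k * g) - const (c 1) * sigma_sum k i f) = dunkl_value i (sx k * f)"
      by (simp only: dunkl_value_neq[OF False] phi_diff phi_uminus phi_times[of "sx k"] g)
    then show ?thesis by blast
  qed
qed

text \<open>The choice is forced, \<open>\<phi>\<close> being injective. From here on the skew field
  is left behind and the operators are iterated on S_{-1}(V).\<close>

definition dunkl_op :: "'n \<Rightarrow> 'n spoly \<Rightarrow> 'n spoly" where
  "dunkl_op i f = (SOME g. \<phi> g = dunkl_value i f)"

lemma phi_dunkl_op: "\<phi> (dunkl_op i f) = dunkl_value i f"
  unfolding dunkl_op_def by (rule someI_ex) (rule ex_dunkl)

lemma dunkl_op_eqI: "\<phi> g = dunkl_value i f \<Longrightarrow> dunkl_op i f = g"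
  using phi_inj phi_dunkl_op by (metis injD)

lemma dunkl_op_one: "dunkl_op i 1 = 0"
  by (rule dunkl_op_eqI) (simp add: phi_zero dunkl_value_one)

lemma dunkl_op_add: "dunkl_op i (f + g) = dunkl_op i f + dunkl_op i g"
  by (rule dunkl_op_eqI) (simp add: phi_add phi_dunkl_op dunkl_value_add)

lemma dunkl_op_const: "dunkl_op i (const z * f) = const z * dunkl_op i f"
  by (rule dunkl_op_eqI) (simp add: phi_times phi_dunkl_op dunkl_value_const)

lemma dunkl_op_neq:
  "j \<noteq> i \<Longrightarrow> dunkl_op i (sx j * f) = - (sx j * dunkl_op i f) - const (c 1) * sigma_sum j i f"
  by (rule dunkl_op_eqI) (simp only: phi_diff phi_uminus phi_times[of "sx j"] phi_dunkl_op dunkl_value_neq not_False_eq_True)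

lemma dunkl_op_self: "dunkl_op i (sx i * f) = sx i * dunkl_op i f + refl_sum i f"
  by (rule dunkl_op_eqI) (simp add: phi_add phi_times phi_dunkl_op dunkl_value_self)

lemma dunkl_op_zero: "dunkl_op i 0 = 0"
  using dunkl_op_add[of i 0 0] by simp

lemma dunkl_op_uminus: "dunkl_op i (- f) = - dunkl_op i f"
  using dunkl_op_const[of i "- 1" f] by (simp add: const_uminus)

lemma dunkl_op_diff: "dunkl_op i (f - g) = dunkl_op i f - dunkl_op i g"
  using dunkl_op_add[of i f "- g"] by (simp add: dunkl_op_uminus)

lemma dunkl_op_sum: "dunkl_op i (sum h S) = (\<Sum>a\<in>S. dunkl_op i (h a))"
  by (induction S rule: infinite_finite_induct) (simp_all add: dunkl_op_zero dunkl_op_add)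

end

section \<open>Relations between braided Dunkl operators\<close>

context parameters
begin

text \<open>The new parameter is found by comparing both sides on x_i: one gives
  \<open>\<epsilon> * a j\<close> times x_{\<pi> j}, the other \<open>a i\<close> times the new
  parameter times x_{\<pi> j}.\<close>

lemma mono_mat_refl_sigma:
  fixes \<pi> :: "'n::finite \<Rightarrow> 'n"
  assumes "inj \<pi>" "i \<noteq> j" "\<epsilon> \<noteq> 0" "a i \<noteq> 0" "a j \<noteq> 0"
  shows "mono_mat \<pi> a ** refl_sigma i j \<epsilon> = refl_sigma (\<pi> i) (\<pi> j) (\<epsilon> * (a j / a i)) ** mono_mat \<pi> a"
proof -
  have "\<pi> \<circ> Transposition.transpose i j = Transposition.transpose (\<pi> i) (\<pi> j) \<circ> \<pi>"
    using assms(1) by (auto simp: fun_eq_iff Transposition.transpose_def inj_def)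
  moreover have "\<pi> i \<noteq> \<pi> j" "\<And>k. \<pi> k = \<pi> i \<longleftrightarrow> k = i" "\<And>k. \<pi> k = \<pi> j \<longleftrightarrow> k = j"
    using assms by (auto simp: inj_def)
  ultimately show ?thesis
    unfolding refl_sigma_mono_mat mono_mat_mult using assms
    by (intro arg_cong2[where f = mono_mat]) (auto simp: fun_eq_iff Transposition.transpose_def divide_inverse)
qed

lemma mono_mat_refl_t:
  assumes "inj \<pi>"
  shows "mono_mat \<pi> a ** refl_t i \<epsilon> = refl_t (\<pi> i) \<epsilon> ** mono_mat \<pi> a"
  unfolding refl_t_mono_mat mono_mat_mult
  using assms by (intro arg_cong2[where f = mono_mat]) (auto simp: fun_eq_iff inj_def)

lemma skew_act_refl_sigma_conj:
  assumes "bij \<pi>" "\<And>k. a k \<in> C" "i \<noteq> j" "\<epsilon> \<in> C"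
  shows "skew_act (mono_mat \<pi> a) (skew_act (refl_sigma i j \<epsilon>) f) =
    skew_act (refl_sigma (\<pi> i) (\<pi> j) (\<epsilon> * (a j / a i))) (skew_act (mono_mat \<pi> a) f)"
proof -
  have w: "mono_mat \<pi> a \<in> mono_mats C"
    using assms(1,2) by (auto simp: mono_mats_def)
  have "\<epsilon> * (a j / a i) \<in> C"
    using assms C_mult C_inverse by (simp add: divide_inverse)
  with w assms show ?thesis
    by (simp add: skew_act_mono_mats_mult[symmetric] refl_sigma_mono_mats mono_mat_refl_sigma
        bij_is_inj C_nonzero)
qed

lemma skew_act_refl_t_conj:
  assumes "bij \<pi>" "\<And>k. a k \<in> C" "\<epsilon> \<in> C"
  shows "skew_act (mono_mat \<pi> a) (skew_act (refl_t i \<epsilon>) f) =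
    skew_act (refl_t (\<pi> i) \<epsilon>) (skew_act (mono_mat \<pi> a) f)"
proof -
  have "mono_mat \<pi> a \<in> mono_mats C"
    using assms(1,2) by (auto simp: mono_mats_def)
  with assms show ?thesis
    by (simp add: skew_act_mono_mats_mult[symmetric] refl_t_mono_mats mono_mat_refl_t bij_is_inj)
qed

lemma skew_act_sigma_sum:
  assumes "bij \<pi>" "\<And>k. a k \<in> C" "i \<noteq> j"
  shows "skew_act (mono_mat \<pi> a) (sigma_sum i j f) =
    const (a i / a j) * sigma_sum (\<pi> i) (\<pi> j) (skew_act (mono_mat \<pi> a) f)"
proof -
  have w: "mono_mat \<pi> a \<in> mono_mats C"
    using assms(1,2) by (auto simp: mono_mats_def)
  have q: "a j / a i \<in> C" using assms C_mult C_inverse by (simp add: divide_inverse)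
  \<comment> \<open>The factor \<open>a i / a j\<close> is built in so that the weight at
    \<open>\<epsilon> * (a j / a i)\<close> is again \<open>\<epsilon>\<close>.\<close>
  let ?g = "\<lambda>\<delta>. const (\<delta> * (a i / a j)) * skew_act (refl_sigma (\<pi> i) (\<pi> j) \<delta>) (skew_act (mono_mat \<pi> a) f)"
  have "skew_act (mono_mat \<pi> a) (sigma_sum i j f) = (\<Sum>\<epsilon>\<in>C. ?g (\<epsilon> * (a j / a i)))"
    unfolding sigma_sum_def skew_act_mono_mats_sum[OF w] skew_act_mono_mats(3)[OF w]
    using assms C_nonzero by (intro sum.cong refl) (simp add: skew_act_refl_sigma_conj)
  also have "\<dots> = (\<Sum>\<epsilon>\<in>C. ?g \<epsilon>)" by (rule sum_C_mult[OF q])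
  also have "\<dots> = const (a i / a j) * sigma_sum (\<pi> i) (\<pi> j) (skew_act (mono_mat \<pi> a) f)"
    unfolding sigma_sum_def sum_distrib_left
    by (intro sum.cong refl) (simp only: mult.commute[of _ "a i / a j"] const_mult mult.assoc)
  finally show ?thesis .
qed

lemma skew_act_refl_sum:
  assumes "bij \<pi>" "\<And>k. a k \<in> C"
  shows "skew_act (mono_mat \<pi> a) (refl_sum i f) = refl_sum (\<pi> i) (skew_act (mono_mat \<pi> a) f)"
proof -
  let ?w = "mono_mat \<pi> a"
  have w: "?w \<in> mono_mats C"
    using assms by (auto simp: mono_mats_def)
  have "skew_act ?w (\<Sum>j\<in>UNIV - {i}. \<Sum>\<epsilon>\<in>C. skew_act (refl_sigma i j \<epsilon>) f) =
      (\<Sum>j\<in>UNIV - {i}. \<Sum>\<epsilon>\<in>C. skew_act (refl_sigma (\<pi> i) (\<pi> j) (\<epsilon> * (a j / a i))) (skew_act ?w f))"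
    unfolding skew_act_mono_mats_sum[OF w]
    using assms by (intro sum.cong refl skew_act_refl_sigma_conj) auto
  \<comment> \<open>These sums are unweighted, so rescaling \<open>\<epsilon>\<close> within
    \<open>C\<close> leaves no scalar behind; afterwards \<open>\<pi>\<close> reindexes
    \<open>j\<close>.\<close>
  also have "\<dots> = (\<Sum>j\<in>UNIV - {i}. \<Sum>\<epsilon>\<in>C. skew_act (refl_sigma (\<pi> i) (\<pi> j) \<epsilon>) (skew_act ?w f))"
    using assms C_mult C_inverse by (intro sum.cong refl sum_C_mult) (simp add: divide_inverse)
  also have "\<dots> = (\<Sum>j\<in>UNIV - {\<pi> i}. \<Sum>\<epsilon>\<in>C. skew_act (refl_sigma (\<pi> i) j \<epsilon>) (skew_act ?w f))"
  proof (rule sum.reindex_bij_betw)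
    show "bij_betw \<pi> (UNIV - {i}) (UNIV - {\<pi> i})"
      using assms(1) by (simp add: bij_betw_def inj_on_def image_set_diff[OF bij_is_inj])
  qed
  finally have s: "skew_act ?w (\<Sum>j\<in>UNIV - {i}. \<Sum>\<epsilon>\<in>C. skew_act (refl_sigma i j \<epsilon>) f) =
      (\<Sum>j\<in>UNIV - {\<pi> i}. \<Sum>\<epsilon>\<in>C. skew_act (refl_sigma (\<pi> i) j \<epsilon>) (skew_act ?w f))" .
  have t: "skew_act ?w (\<Sum>\<epsilon>\<in>C' - {1}. const (c \<epsilon>) * skew_act (refl_t i \<epsilon>) f) =
      (\<Sum>\<epsilon>\<in>C' - {1}. const (c \<epsilon>) * skew_act (refl_t (\<pi> i) \<epsilon>) (skew_act ?w f))"
    unfolding skew_act_mono_mats_sum[OF w] skew_act_mono_mats(3)[OF w]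
    using assms C'_subset by (intro sum.cong refl arg_cong2[where f = "(*)"] skew_act_refl_t_conj) auto
  show ?thesis
    unfolding refl_sum_def skew_act_mono_mats(2)[OF w] skew_act_mono_mats(3)[OF w] s t ..
qed

end

context dunkl
begin

text \<open>Equivariance, the factor \<open>inverse (a i)\<close> being that of the contragredient
  action on y_i. For x_k f it reduces to the equivariance of \<open>refl_sum\<close> or
  \<open>sigma_sum\<close>, according to whether \<open>k = i\<close>.\<close>

lemma skew_act_dunkl_op:
  assumes "bij \<pi>" "\<And>k. a k \<in> C"
  shows "skew_act (mono_mat \<pi> a) (dunkl_op i f) =
    const (inverse (a i)) * dunkl_op (\<pi> i) (skew_act (mono_mat \<pi> a) f)"
proof -
  let ?s = "skew_act (mono_mat \<pi> a)"
  have w: "mono_mat \<pi> a \<in> mono_mats C"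
    using assms by (auto simp: mono_mats_def)
  note s = skew_act_mono_mats[OF w] skew_act_mono_mats_uminus[OF w]
  have s_diff: "?s (f - g) = ?s f - ?s g" for f g
    using s(2)[of f "- g"] s(4) by simp
  have s_sx: "?s (sx k * f) = const (a k) * (sx (\<pi> k) * ?s f)" for k f
    using skew_act_mono_mat(4) assms(1) bij_is_inj by blast
  have s_zero: "?s 0 = 0" using s(2)[of 0 0] by simp
  show ?thesis
  proof (induction f rule: spoly_induct)
    case one
    show ?case by (simp add: s s_zero dunkl_op_one)
  next
    case (add f g)
    then show ?case by (simp add: s dunkl_op_add distrib_left)
  next
    case (scale z f)
    then show ?case by (simp add: s dunkl_op_const const_commute_left)
  next
    case (var k f)
    show ?case
    proof (cases "k = i")
      case True
      have "?s (dunkl_op i (sx i * f)) = const (a i) * (sx (\<pi> i) * (const (inverse (a i)) * dunkl_op (\<pi> i) (?s f)))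
          + refl_sum (\<pi> i) (?s f)"
        unfolding dunkl_op_self s(2) s_sx var skew_act_refl_sum[OF assms] ..
      also have "\<dots> = sx (\<pi> i) * dunkl_op (\<pi> i) (?s f) + refl_sum (\<pi> i) (?s f)"
        using C_nonzero[OF assms(2)]
        by (simp only: sx_const_left) (simp add: mult.assoc[symmetric] const_inverse)
      also have "\<dots> = const (inverse (a i)) * (const (a i) * dunkl_op (\<pi> i) (sx (\<pi> i) * ?s f))"
        using C_nonzero[OF assms(2)]
        by (simp add: dunkl_op_self mult.assoc[symmetric] const_inverse)
      also have "const (a i) * dunkl_op (\<pi> i) (sx (\<pi> i) * ?s f) = dunkl_op (\<pi> i) (?s (sx i * f))"
        by (simp only: s_sx dunkl_op_const)
      finally show ?thesis using True by simp
    next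
      case False
      then have \<pi>: "\<pi> k \<noteq> \<pi> i" using assms(1) by (meson bij_is_inj injD)
      let ?D = "dunkl_op (\<pi> i) (?s f)" and ?S = "sigma_sum (\<pi> k) (\<pi> i) (?s f)"
      have "?s (dunkl_op i (sx k * f)) =
          - (const (a k) * (sx (\<pi> k) * (const (inverse (a i)) * ?D))) - const (c 1) * (const (a k / a i) * ?S)"
        unfolding dunkl_op_neq[OF False] s_diff s s_sx var skew_act_sigma_sum[OF assms False] ..
      also have "\<dots> = const (inverse (a i)) * (const (a k) * (- (sx (\<pi> k) * ?D) - const (c 1) * ?S))"
        by (simp only: sx_const_left divide_inverse right_diff_distrib mult_minus_right const_mult mult.assoc
            const_commute_left)
      also have "\<dots> = const (inverse (a i)) * dunkl_op (\<pi> i) (?s (sx k * f))"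
        by (simp only: s_sx dunkl_op_const dunkl_op_neq[OF \<pi>])
      finally show ?thesis .
    qed
  qed
qed

lemma dunkl_op_refl_sigma_other:
  assumes "\<epsilon> \<in> C" "l \<noteq> i" "l \<noteq> j"
  shows "dunkl_op l (skew_act (refl_sigma i j \<epsilon>) f) = skew_act (refl_sigma i j \<epsilon>) (dunkl_op l f)"
  unfolding refl_sigma_mono_mat using assms C_one C_uminus C_inverse
  by (subst skew_act_dunkl_op) auto

text \<open>Equivariance with the entries \<open>\<epsilon>\<close> at i and
  \<open>- inverse \<epsilon>\<close> at j, whose inverses are the two factors.\<close>

lemma skew_act_refl_sigma_dunkl_op:
  assumes "\<epsilon> \<in> C" "i \<noteq> j"
  shows "skew_act (refl_sigma i j \<epsilon>) (dunkl_op i f) =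
      const (inverse \<epsilon>) * dunkl_op j (skew_act (refl_sigma i j \<epsilon>) f)"
    and "skew_act (refl_sigma i j \<epsilon>) (dunkl_op j f) =
      - (const \<epsilon> * dunkl_op i (skew_act (refl_sigma i j \<epsilon>) f))"
  unfolding refl_sigma_mono_mat using assms C_one C_uminus C_inverse
  by (subst skew_act_dunkl_op; auto simp: inverse_minus_eq const_uminus)+

lemma dunkl_op_refl_t_other:
  assumes "\<epsilon> \<in> C" "l \<noteq> i"
  shows "dunkl_op l (skew_act (refl_t i \<epsilon>) f) = skew_act (refl_t i \<epsilon>) (dunkl_op l f)"
  unfolding refl_t_mono_mat using assms C_one
  by (subst skew_act_dunkl_op) auto

lemma dunkl_op_sigma_sum_other:
  assumes "l \<noteq> i" "l \<noteq> j"
  shows "dunkl_op l (sigma_sum i j f) = sigma_sum i j (dunkl_op l f)"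
  using assms by (simp add: sigma_sum_def dunkl_op_sum dunkl_op_const dunkl_op_refl_sigma_other)

text \<open>The weight \<epsilon> in \<open>sigma_sum\<close> is absorbed by the scalar from
  equivariance. What remains are unweighted sums, comparable with those in
  \<open>refl_sum\<close>.\<close>

lemma dunkl_op_sigma_sum:
  assumes "i \<noteq> j"
  shows "dunkl_op i (sigma_sum i j f) = - (\<Sum>\<epsilon>\<in>C. skew_act (refl_sigma i j \<epsilon>) (dunkl_op j f))"
    and "sigma_sum i j (dunkl_op i f) = (\<Sum>\<epsilon>\<in>C. dunkl_op j (skew_act (refl_sigma i j \<epsilon>) f))"
proof -
  show "dunkl_op i (sigma_sum i j f) = - (\<Sum>\<epsilon>\<in>C. skew_act (refl_sigma i j \<epsilon>) (dunkl_op j f))"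
    using assms by (simp add: sigma_sum_def dunkl_op_sum dunkl_op_const skew_act_refl_sigma_dunkl_op sum_negf)
  show "sigma_sum i j (dunkl_op i f) = (\<Sum>\<epsilon>\<in>C. dunkl_op j (skew_act (refl_sigma i j \<epsilon>) f))"
    unfolding sigma_sum_def using assms C_nonzero
    by (intro sum.cong refl) (simp add: skew_act_refl_sigma_dunkl_op mult.assoc[symmetric] const_inverse)
qed

text \<open>D_j commutes with every t_i and with every sigma_il for \<open>l \<noteq> j\<close>.
  Only the sigma_ij fail, and \<open>dunkl_op_sigma_sum\<close> expresses this failure through
  \<open>sigma_sum\<close>.\<close>

lemma dunkl_op_refl_sum:
  assumes "i \<noteq> j"
  shows "dunkl_op j (refl_sum i f) = refl_sum i (dunkl_op j f)
    + const (c 1) * (dunkl_op i (sigma_sum i j f) + sigma_sum i j (dunkl_op i f))"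
proof -
  let ?r = "\<lambda>l f. \<Sum>\<epsilon>\<in>C. skew_act (refl_sigma i l \<epsilon>) f"
  have split: "(\<Sum>l\<in>UNIV - {i}. h l) = h j + (\<Sum>l\<in>UNIV - {i} - {j}. h l)" for h :: "'n \<Rightarrow> 'n spoly"
    using assms by (intro sum.remove) auto
  have "(\<Sum>l\<in>UNIV - {i} - {j}. dunkl_op j (?r l f)) = (\<Sum>l\<in>UNIV - {i} - {j}. ?r l (dunkl_op j f))"
    unfolding dunkl_op_sum using assms by (intro sum.cong refl dunkl_op_refl_sigma_other) auto
  moreover have "dunkl_op j (?r j f) =
      ?r j (dunkl_op j f) + (dunkl_op i (sigma_sum i j f) + sigma_sum i j (dunkl_op i f))"
    using assms by (simp add: dunkl_op_sigma_sum dunkl_op_sum)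
  ultimately have "dunkl_op j (\<Sum>l\<in>UNIV - {i}. ?r l f) = (\<Sum>l\<in>UNIV - {i}. ?r l (dunkl_op j f))
      + (dunkl_op i (sigma_sum i j f) + sigma_sum i j (dunkl_op i f))"
    unfolding split dunkl_op_add dunkl_op_sum[of j _ "UNIV - {i} - {j}"] by simp
  moreover have "dunkl_op j (\<Sum>\<epsilon>\<in>C' - {1}. const (c \<epsilon>) * skew_act (refl_t i \<epsilon>) f) =
      (\<Sum>\<epsilon>\<in>C' - {1}. const (c \<epsilon>) * skew_act (refl_t i \<epsilon>) (dunkl_op j f))"
    unfolding dunkl_op_sum dunkl_op_const using assms C'_subset
    by (intro sum.cong refl arg_cong2[where f = "(*)"] dunkl_op_refl_t_other) auto
  ultimately show ?thesis
    by (simp add: refl_sum_def dunkl_op_add dunkl_op_const distrib_left)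
qed

text \<open>The correction term of \<open>dunkl_op_refl_sum\<close> equals the c_1 terms that arise
  when D_j passes x_i in the two orders of application, so they cancel.\<close>

lemma dunkl_op_anticommute_step:
  assumes "i \<noteq> j" "dunkl_op i (dunkl_op j f) + dunkl_op j (dunkl_op i f) = 0"
  shows "dunkl_op i (dunkl_op j (sx i * f)) + dunkl_op j (dunkl_op i (sx i * f)) = 0"
proof -
  have "dunkl_op i (dunkl_op j (sx i * f)) =
      - (sx i * dunkl_op i (dunkl_op j f)) - refl_sum i (dunkl_op j f) - const (c 1) * dunkl_op i (sigma_sum i j f)"
    using assms(1) by (simp add: dunkl_op_neq dunkl_op_self dunkl_op_diff dunkl_op_uminus dunkl_op_const)
  moreover have "dunkl_op j (dunkl_op i (sx i * f)) =
      - (sx i * dunkl_op j (dunkl_op i f)) - const (c 1) * sigma_sum i j (dunkl_op i f) + dunkl_op j (refl_sum i f)"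
    using assms(1) by (simp add: dunkl_op_neq dunkl_op_self dunkl_op_add)
  moreover have "sx i * dunkl_op i (dunkl_op j f) + sx i * dunkl_op j (dunkl_op i f) = 0"
    unfolding distrib_left[symmetric] assms(2) by simp
  then have "sx i * dunkl_op j (dunkl_op i f) = - (sx i * dunkl_op i (dunkl_op j f))"
    by (simp add: eq_neg_iff_add_eq_0 add.commute)
  ultimately show ?thesis
    unfolding dunkl_op_refl_sum[OF assms(1)] by (simp add: distrib_left)
qed

lemma dunkl_op_anticommute:
  assumes "i \<noteq> j" shows "dunkl_op i (dunkl_op j f) + dunkl_op j (dunkl_op i f) = 0"
proof (induction f rule: spoly_induct)
  case one
  show ?case by (simp add: dunkl_op_one dunkl_op_zero)
next
  case (add f g)
  have "dunkl_op i (dunkl_op j (f + g)) + dunkl_op j (dunkl_op i (f + g)) =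
      (dunkl_op i (dunkl_op j f) + dunkl_op j (dunkl_op i f)) + (dunkl_op i (dunkl_op j g) + dunkl_op j (dunkl_op i g))"
    by (simp add: dunkl_op_add)
  with add show ?case by simp
next
  case (scale z f)
  then show ?case by (simp add: dunkl_op_const distrib_left[symmetric])
next
  case (var k f)
  consider "k = i" | "k = j" | "k \<noteq> i" "k \<noteq> j" by blast
  then show ?case
  proof cases
    case 1
    with dunkl_op_anticommute_step[OF assms var] show ?thesis by simp
  next
    case 2
    with dunkl_op_anticommute_step[of j i f] assms var show ?thesis by (simp add: add.commute)
  next
    case 3
    \<comment> \<open>D_i commutes with \<open>sigma_sum k j\<close> and D_j with
      \<open>sigma_sum k i\<close>; hence the c_1 terms of the two orders are opposite.\<close>
    have "dunkl_op i (dunkl_op j (sx k * f)) + dunkl_op j (dunkl_op i (sx k * f)) =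
        sx k * (dunkl_op i (dunkl_op j f) + dunkl_op j (dunkl_op i f))"
      using 3 assms
      by (simp add: dunkl_op_neq dunkl_op_diff dunkl_op_uminus dunkl_op_const dunkl_op_sigma_sum_other distrib_left)
    with var show ?thesis by simp
  qed
qed

end

section \<open>The Verma module\<close>

lemma free_ring_carrier_closed:
  shows "p \<in> carrier (free_ring A) \<Longrightarrow> q \<in> carrier (free_ring A) \<Longrightarrow> p + q \<in> carrier (free_ring A)"
    and "p \<in> carrier (free_ring A) \<Longrightarrow> q \<in> carrier (free_ring A) \<Longrightarrow> p * q \<in> carrier (free_ring A)"
    and "cst z \<in> carrier (free_ring A)" and "1 \<in> carrier (free_ring A)" and "0 \<in> carrier (free_ring A)"
    and "p \<in> carrier (free_ring A) \<Longrightarrow> - p \<in> carrier (free_ring A)"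
    and "g \<in> A \<Longrightarrow> var g \<in> carrier (free_ring A)"
proof -
  interpret ring "free_ring A" by (rule ring_free_ring)
  show "p \<in> carrier (free_ring A) \<Longrightarrow> q \<in> carrier (free_ring A) \<Longrightarrow> p + q \<in> carrier (free_ring A)"
    using a_closed[of p q] by (simp add: free_ring_def)
  show "p \<in> carrier (free_ring A) \<Longrightarrow> q \<in> carrier (free_ring A) \<Longrightarrow> p * q \<in> carrier (free_ring A)"
    using m_closed[of p q] by (simp add: free_ring_def)
  show "1 \<in> carrier (free_ring A)" "0 \<in> carrier (free_ring A)"
    using one_closed zero_closed by (simp_all add: free_ring_def)
qed (auto simp: free_ring_def cst_def var_def zero_word_def)

lemma free_ring_carrier_diff:
  "p \<in> carrier (free_ring A) \<Longrightarrow> q \<in> carrier (free_ring A) \<Longrightarrow> p - q \<in> carrier (free_ring A)"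
  using free_ring_carrier_closed(1,6)[of _ A] by (metis diff_conv_add_uminus)

lemma free_ring_carrier_sum:
  "(\<And>a. a \<in> S \<Longrightarrow> f a \<in> carrier (free_ring A)) \<Longrightarrow> sum f S \<in> carrier (free_ring A)"
  by (induction S rule: infinite_finite_induct) (auto intro: free_ring_carrier_closed)

lemmas free_ring_carrier_intros =
  free_ring_carrier_closed free_ring_carrier_diff free_ring_carrier_sum

lemma free_ring_simps:
  "p \<otimes>\<^bsub>free_ring A\<^esub> q = p * q" "p \<oplus>\<^bsub>free_ring A\<^esub> q = p + q"
  "\<one>\<^bsub>free_ring A\<^esub> = 1" "\<zero>\<^bsub>free_ring A\<^esub> = 0"
  by (simp_all add: free_ring_def)

lemma free_ring_uminus:
  assumes "p \<in> carrier (free_ring A)" shows "\<ominus>\<^bsub>free_ring A\<^esub> p = - p"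
proof -
  interpret ring "free_ring A" by (rule ring_free_ring)
  show ?thesis
    using assms by (intro minus_equality) (auto simp: free_ring_simps intro: free_ring_carrier_intros)
qed

lemma free_ring_minus:
  assumes "p \<in> carrier (free_ring A)" "q \<in> carrier (free_ring A)"
  shows "p \<ominus>\<^bsub>free_ring A\<^esub> q = p - q"
  using assms by (simp add: a_minus_def free_ring_uminus free_ring_simps)

section \<open>The Cherednik algebra and its Verma module as quotients of the free algebra\<close>

locale cherednik_algebra = parameters C C' c
  for C C' :: "complex set" and c :: "complex \<Rightarrow> complex" +
  fixes s :: complex
begin

abbreviation gens :: "'n::finite cher_gen set" where "gens \<equiv> cher_gens C C'"
abbreviation rels :: "'n::finite cher_gen free_alg set" where "rels \<equiv> cher_relators s C C' c"
abbreviation F :: "'n::finite cher_gen free_alg ring" where "F \<equiv> free_ring gens"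
abbreviation I :: "'n::finite cher_gen free_alg set" where "I \<equiv> genideal F rels"
abbreviation H :: "'n::finite cher_gen free_alg set ring" where "H \<equiv> cherednik s C C' c"
abbreviation cl :: "'n::finite cher_gen free_alg \<Rightarrow> 'n cher_gen free_alg set"
  where "cl \<equiv> cher_cls s C C' c"
abbreviation S :: "'n::finite cher_gen free_alg set set" where "S \<equiv> verma_sub s C C' c"
abbreviation borel_gens :: "'n::finite cher_gen set" where "borel_gens \<equiv> Wgen ` W \<union> range Ygen"

text \<open>The preimage of \<open>S\<close> in the free algebra. Elements of the Verma module are
  cosets of cosets; modulo \<open>J\<close> they can be treated as ordinary polynomials in the
  letters.\<close>

definition J :: "'n::finite cher_gen free_alg set" where
  "J = {p \<in> carrier F. cl p \<in> S}"

definition V :: "'n::finite cher_gen free_alg \<Rightarrow> 'n cher_gen free_alg set set" where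
  "V p = S +>\<^bsub>H\<^esub> cl p"

lemma gens_carrier:
  "vX i \<in> carrier F" "vY i \<in> carrier F" "w \<in> W \<Longrightarrow> vW w \<in> carrier F"
  by (auto intro!: free_ring_carrier_intros simp: cher_gens_def)

lemma rels_carrier: "rels \<subseteq> carrier F"
  unfolding cher_relators_def
  by (auto intro!: free_ring_carrier_intros gens_carrier W_mult W_one W_inv W_refl_sigma W_refl_t)

lemma ideal_I: "ideal I F"
  by (rule ring.genideal_ideal[OF ring_free_ring rels_carrier])

lemma rels_I: "r \<in> rels \<Longrightarrow> r \<in> I"
  using ring.genideal_self[OF ring_free_ring rels_carrier] by blast

lemma H_eq: "H = F Quot I"
  by (simp add: cherednik_def presented_def)

lemma cl_eq: "cl p = I +>\<^bsub>F\<^esub> p"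
  by (simp add: cher_cls_def cls_def)

lemma ring_H: "ring H"
  unfolding H_eq by (rule ideal.quotient_is_ring[OF ideal_I])

lemma cl_hom: "cl \<in> ring_hom F H"
  using ideal.rcos_ring_hom[OF ideal_I] unfolding H_eq cl_eq[abs_def] .

lemma cl_carrier: "p \<in> carrier F \<Longrightarrow> cl p \<in> carrier H"
  by (rule ring_hom_closed[OF cl_hom])

lemma cl_times: "p \<in> carrier F \<Longrightarrow> q \<in> carrier F \<Longrightarrow> cl p \<otimes>\<^bsub>H\<^esub> cl q = cl (p * q)"
  using ring_hom_mult[OF cl_hom, of p q] by (simp add: free_ring_simps)

lemma cl_add: "p \<in> carrier F \<Longrightarrow> q \<in> carrier F \<Longrightarrow> cl p \<oplus>\<^bsub>H\<^esub> cl q = cl (p + q)"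
  using ring_hom_add[OF cl_hom, of p q] by (simp add: free_ring_simps)

lemma cl_zero: "cl 0 = \<zero>\<^bsub>H\<^esub>"
  using ring_hom_zero[OF cl_hom ring_free_ring ring_H] by (simp add: free_ring_simps)

lemma cl_uminus:
  assumes "p \<in> carrier F" shows "\<ominus>\<^bsub>H\<^esub> cl p = cl (- p)"
proof -
  interpret ring H by (rule ring_H)
  have "cl (- p) \<oplus>\<^bsub>H\<^esub> cl p = \<zero>\<^bsub>H\<^esub>"
    using assms by (simp add: cl_add free_ring_carrier_intros cl_zero)
  then show ?thesis
    using assms by (intro minus_equality cl_carrier free_ring_carrier_intros)
qed

lemma cl_minus: "p \<in> carrier F \<Longrightarrow> q \<in> carrier F \<Longrightarrow> cl p \<ominus>\<^bsub>H\<^esub> cl q = cl (p - q)"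
  by (simp add: a_minus_def cl_uminus cl_add free_ring_carrier_intros)

lemma cl_surj: "x \<in> carrier H \<Longrightarrow> \<exists>p\<in>carrier F. x = cl p"
  unfolding H_eq cl_eq by (auto simp: FactRing_def A_RCOSETS_def')

lemma cl_eq_cl_iff:
  assumes "p \<in> carrier F" "q \<in> carrier F" shows "cl p = cl q \<longleftrightarrow> p - q \<in> I"
proof -
  interpret ideal I F by (rule ideal_I)
  have "cl p = cl q \<longleftrightarrow> p \<in> I +>\<^bsub>F\<^esub> q"
    unfolding cl_eq using a_repr_independence'[of p q] a_rcos_self[of p] assms by auto
  also have "\<dots> \<longleftrightarrow> p - q \<in> I"
    using a_rcos_module_minus[OF ring_free_ring, of q p] assms by (simp add: free_ring_minus)
  finally show ?thesis .
qed

definition verma_gens :: "'n::finite cher_gen free_alg set" where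
  "verma_gens = {p * b - p * cst (triv_char b) | p b. p \<in> carrier F \<and> b \<in> carrier (free_ring borel_gens)}"

lemma borel_carrier: "b \<in> carrier (free_ring borel_gens) \<Longrightarrow> b \<in> carrier F"
  by (auto simp: free_ring_def cher_gens_def)

lemma verma_gens_carrier: "verma_gens \<subseteq> carrier F"
  unfolding verma_gens_def using borel_carrier
  by (auto intro!: free_ring_carrier_diff free_ring_carrier_closed(2,3))

lemma S_eq: "(S :: 'n::finite cher_gen free_alg set set) = generate (add_monoid H) (cl ` verma_gens)"
proof -
  have 1: "(cl p \<otimes>\<^bsub>H\<^esub> cl b) \<ominus>\<^bsub>H\<^esub> (cl p \<otimes>\<^bsub>H\<^esub> cl (cst (triv_char b))) = cl (p * b - p * cst (triv_char b))"
    if "p \<in> carrier F" "b \<in> carrier (free_ring borel_gens)" for p b :: "'n cher_gen free_alg"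
    using that borel_carrier[OF that(2)] by (simp add: cl_times cl_minus free_ring_carrier_intros)
  have "{(h \<otimes>\<^bsub>H\<^esub> cl b) \<ominus>\<^bsub>H\<^esub> (h \<otimes>\<^bsub>H\<^esub> cl (cst (triv_char b))) | h b.
           h \<in> carrier H \<and> b \<in> carrier (free_ring borel_gens)} =
      (cl ` verma_gens :: 'n cher_gen free_alg set set)"
    (is "?L = _")
  proof
    show "?L \<subseteq> cl ` verma_gens"
    proof
      fix x assume "x \<in> ?L"
      then obtain h b where x: "x = (h \<otimes>\<^bsub>H\<^esub> cl b) \<ominus>\<^bsub>H\<^esub> (h \<otimes>\<^bsub>H\<^esub> cl (cst (triv_char b)))"
        and h: "h \<in> carrier H" and b: "b \<in> carrier (free_ring borel_gens)" by blast
      from cl_surj[OF h] obtain p where p: "p \<in> carrier F" "h = cl p" by blast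
      with b 1 x have "x = cl (p * b - p * cst (triv_char b))" by simp
      with p b show "x \<in> cl ` verma_gens" by (auto simp: verma_gens_def)
    qed
    show "cl ` verma_gens \<subseteq> ?L"
    proof
      fix x :: "'n cher_gen free_alg set" assume "x \<in> cl ` verma_gens"
      then obtain p b where "x = cl (p * b - p * cst (triv_char b))" and p: "p \<in> carrier F"
        and b: "b \<in> carrier (free_ring borel_gens)" by (auto simp: verma_gens_def)
      with 1 have "x = (cl p \<otimes>\<^bsub>H\<^esub> cl b) \<ominus>\<^bsub>H\<^esub> (cl p \<otimes>\<^bsub>H\<^esub> cl (cst (triv_char b)))" by simp
      with b cl_carrier[OF p] show "x \<in> ?L" by blast
    qed
  qed
  then show ?thesis by (simp add: verma_sub_def Let_def)
qed

text \<open>\<open>verma_sub\<close> is defined as a mere additive span. Since \<open>p\<close> is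
  arbitrary in its generators, the span is a left submodule, which is what lets \<open>H\<close> act
  on the quotient.\<close>

lemma verma_gens_lmult: "p \<in> carrier F \<Longrightarrow> q \<in> verma_gens \<Longrightarrow> p * q \<in> verma_gens"
  unfolding verma_gens_def
  by (clarsimp simp: right_diff_distrib mult.assoc[symmetric])
     (metis free_ring_carrier_closed(2))

lemma S_subgroup: "additive_subgroup S H"
proof -
  interpret ring H by (rule ring_H)
  have "subgroup (generate (add_monoid H) (cl ` verma_gens)) (add_monoid H)"
    using verma_gens_carrier by (intro add.generate_is_subgroup) (auto intro: cl_carrier)
  then show ?thesis unfolding S_eq by (rule additive_subgroup.intro)
qed

lemma J_add: "p \<in> J \<Longrightarrow> q \<in> J \<Longrightarrow> p + q \<in> J"
  using additive_subgroup.a_closed[OF S_subgroup, of "cl p" "cl q"]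
  by (auto simp: J_def cl_add intro: free_ring_carrier_intros)

lemma J_uminus: "p \<in> J \<Longrightarrow> - p \<in> J"
  using additive_subgroup.a_inv_closed[OF S_subgroup _, of "cl p"] ring.is_abelian_group[OF ring_H]
  by (auto simp: J_def cl_uminus intro: free_ring_carrier_intros)

lemma J_zero: "0 \<in> J"
  using additive_subgroup.zero_closed[OF S_subgroup] by (simp add: J_def cl_zero free_ring_carrier_intros)

lemma I_J: "p \<in> I \<Longrightarrow> p \<in> J"
proof -
  assume p: "p \<in> I"
  then have "p \<in> carrier F" using ideal.Icarr[OF ideal_I] by blast
  moreover have "cl p = cl 0"
    using p \<open>p \<in> carrier F\<close> by (subst cl_eq_cl_iff) (auto intro: free_ring_carrier_intros)
  ultimately show ?thesis
    using additive_subgroup.zero_closed[OF S_subgroup] by (simp add: J_def cl_zero)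
qed

lemma verma_gens_J: "p \<in> verma_gens \<Longrightarrow> p \<in> J"
  using verma_gens_carrier by (auto simp: J_def S_eq intro: generate.incl)

text \<open>The induction principle for \<open>J\<close>: each element of \<open>S\<close> is the
  class of some element of \<open>K\<close>, and lifts with the same class differ by an element of
  \<open>I\<close>, hence of \<open>K\<close>.\<close>

lemma J_minimal:
  fixes K :: "'n::finite cher_gen free_alg set"
  assumes "I \<subseteq> K" "verma_gens \<subseteq> K" "K \<subseteq> carrier F" "0 \<in> K"
    and add: "\<And>p q. p \<in> K \<Longrightarrow> q \<in> K \<Longrightarrow> p + q \<in> K" and uminus: "\<And>p. p \<in> K \<Longrightarrow> - p \<in> K"
  shows "J \<subseteq> K"
proof
  interpret ring H by (rule ring_H)
  have "\<exists>k\<in>K. x = cl k" if "x \<in> S" for x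
    using that unfolding S_eq
  proof (induction rule: generate.induct)
    case one
    show ?case using assms(4) by (auto simp: cl_zero[symmetric])
  next
    case (incl x)
    then show ?case using assms(2) by blast
  next
    case (inv x)
    then obtain k where k: "k \<in> verma_gens" "x = cl k" by blast
    then have "inv\<^bsub>add_monoid H\<^esub> x = cl (- k)"
      using verma_gens_carrier cl_uminus[of k] by (auto simp: a_inv_def)
    with k assms(2) uminus show ?case by blast
  next
    case (eng x y)
    then obtain k l where "k \<in> K" "l \<in> K" "x = cl k" "y = cl l" by blast
    with assms(3) add have "x \<otimes>\<^bsub>add_monoid H\<^esub> y = cl (k + l)" "k + l \<in> K"
      by (auto simp: cl_add subset_iff)
    then show ?case by blast
  qed
  moreover fix p :: "'n cher_gen free_alg" assume "p \<in> J"
  ultimately obtain k where k: "k \<in> K" "cl p = cl k" and "p \<in> carrier F"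
    by (auto simp: J_def)
  then have "p - k \<in> I" using assms(3) by (subst cl_eq_cl_iff[symmetric]) auto
  with assms(1) add[of "p - k" k] k show "p \<in> K" by auto
qed

lemma J_lmult:
  assumes "q \<in> carrier F" "p \<in> J" shows "q * p \<in> J"
proof -
  have "J \<subseteq> {p \<in> carrier F. q * p \<in> J}"
  proof (rule J_minimal)
    show "I \<subseteq> {p \<in> carrier F. q * p \<in> J}"
      using ideal.Icarr[OF ideal_I] ideal.I_l_closed[OF ideal_I _ assms(1)]
      by (auto simp: free_ring_simps intro!: I_J)
    show "verma_gens \<subseteq> {p \<in> carrier F. q * p \<in> J}"
      using verma_gens_carrier verma_gens_lmult[OF assms(1)] verma_gens_J by auto
  qed (auto simp: distrib_left J_zero intro: free_ring_carrier_intros J_add J_uminus)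
  with assms(2) show ?thesis by blast
qed

lemma coset_eq_iff:
  assumes "x \<in> carrier H" "y \<in> carrier H"
  shows "S +>\<^bsub>H\<^esub> x = S +>\<^bsub>H\<^esub> y \<longleftrightarrow> x \<ominus>\<^bsub>H\<^esub> y \<in> S"
proof -
  interpret ring H by (rule ring_H)
  interpret abelian_subgroup S H
    by (rule abelian_subgroupI3[OF S_subgroup is_abelian_group])
  have "S +>\<^bsub>H\<^esub> x = S +>\<^bsub>H\<^esub> y \<longleftrightarrow> x \<in> S +>\<^bsub>H\<^esub> y"
    using a_repr_independence'[of x y] a_rcos_self[of x] assms by auto
  also have "\<dots> \<longleftrightarrow> x \<ominus>\<^bsub>H\<^esub> y \<in> S"
    using a_rcos_module_minus[OF ring_H, of y x] assms by simp
  finally show ?thesis .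
qed

lemma V_eq_iff:
  assumes "p \<in> carrier F" "q \<in> carrier F" shows "V p = V q \<longleftrightarrow> p - q \<in> J"
  unfolding V_def using assms
  by (simp add: coset_eq_iff cl_carrier cl_minus J_def free_ring_carrier_intros)

lemma verma_eq: "verma s C C' c = V ` carrier F"
  unfolding verma_def A_RCOSETS_def' V_def using cl_surj cl_carrier by blast

text \<open>The union in \<open>verma_act\<close> collapses: members of one coset have lifts
  differing by elements of the left ideal \<open>J\<close>, so all of them yield the same
  coset.\<close>

lemma verma_act_V:
  assumes "p \<in> carrier F" "q \<in> carrier F"
  shows "verma_act s C C' c (cl p) (V q) = V (p * q)"
proof -
  interpret ring H by (rule ring_H)
  interpret abelian_subgroup S H
    by (rule abelian_subgroupI3[OF S_subgroup is_abelian_group])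
  have "S +>\<^bsub>H\<^esub> (cl p \<otimes>\<^bsub>H\<^esub> k) = V (p * q)" if "k \<in> V q" for k
  proof -
    have "k \<in> carrier H"
      using that cl_carrier[OF assms(2)] a_elemrcos_carrier unfolding V_def by blast
    then obtain r where r: "r \<in> carrier F" "k = cl r" using cl_surj by blast
    from that have "V r = V q"
      unfolding V_def r(2) using cl_carrier assms(2) a_repr_independence' by metis
    then have "r - q \<in> J" using V_eq_iff r assms by blast
    then have "p * r - p * q \<in> J"
      using J_lmult[OF assms(1)] by (metis right_diff_distrib)
    then have "V (p * r) = V (p * q)"
      using assms r by (subst V_eq_iff) (auto intro: free_ring_carrier_intros)
    then show ?thesis using assms r by (simp add: V_def cl_times)
  qed
  moreover have "cl q \<in> V q"
    unfolding V_def using cl_carrier[OF assms(2)] by (rule a_rcos_self)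
  ultimately show ?thesis unfolding verma_act_def by blast
qed

end

section \<open>Multiplication in the Verma module\<close>

text \<open>A lift through a chosen representative, hence compatible with the algebra operations
  only modulo the relations.\<close>

definition emb :: "'n spoly \<Rightarrow> ('n, 'w) gen free_alg" where
  "emb f = free_eval cst vX (rep_spoly f)"

interpretation vX: free_alg_eval cst "vX :: 'n \<Rightarrow> ('n, 'w) gen free_alg"
  by standard (simp_all add: cst_add cst_mult cst_one var_cst)

context cherednik_algebra
begin

lemma eval_vX_carrier: "(free_eval cst vX p :: 'n::finite cher_gen free_alg) \<in> carrier F"
proof -
  have "(prod_list (map vX us) :: 'n cher_gen free_alg) \<in> carrier F" for us
    by (induction us) (auto intro: free_ring_carrier_intros gens_carrier)
  then show ?thesis
    unfolding free_eval_def by (intro free_ring_carrier_intros)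
qed

lemma emb_carrier: "(emb f :: 'n::finite cher_gen free_alg) \<in> carrier F"
  unfolding emb_def by (rule eval_vX_carrier)

lemma I_closed:
  shows "p \<in> I \<Longrightarrow> q \<in> I \<Longrightarrow> p + q \<in> I" and "p \<in> I \<Longrightarrow> q \<in> I \<Longrightarrow> p - q \<in> I"
    and "p \<in> I \<Longrightarrow> q \<in> carrier F \<Longrightarrow> q * p \<in> I" and "p \<in> I \<Longrightarrow> q \<in> carrier F \<Longrightarrow> p * q \<in> I"
    and "0 \<in> I"
proof -
  note i = ideal.axioms(1)[OF ideal_I]
  show "p \<in> I \<Longrightarrow> q \<in> I \<Longrightarrow> p + q \<in> I"
    using additive_subgroup.a_closed[OF i] by (simp add: free_ring_simps)
  show "p \<in> I \<Longrightarrow> q \<in> carrier F \<Longrightarrow> p * q \<in> I"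
    using ideal.I_r_closed[OF ideal_I] by (simp add: free_ring_simps)
  show l: "p \<in> I \<Longrightarrow> q \<in> carrier F \<Longrightarrow> q * p \<in> I" for p q
    using ideal.I_l_closed[OF ideal_I] by (simp add: free_ring_simps)
  show "p \<in> I \<Longrightarrow> q \<in> I \<Longrightarrow> p - q \<in> I"
    using additive_subgroup.a_closed[OF i, of p "- q"] l[of q "- 1"]
    by (simp add: free_ring_simps free_ring_carrier_intros)
  show "0 \<in> I"
    using additive_subgroup.zero_closed[OF i] by (simp add: free_ring_simps)
qed

text \<open>The relators of S_{-1}(V) are among those of the Cherednik algebra. Hence another
  representative of a skew polynomial changes its lift by an element of \<open>I\<close>
  only.\<close>

lemma eval_vX_skew_ideal:
  assumes "p \<in> skew_ideal" shows "(free_eval cst vX p :: 'n::finite cher_gen free_alg) \<in> I"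
proof -
  have carrier_UNIV: "carrier (free_ring UNIV) = UNIV"
    by (simp add: free_ring_def)
  have "skew_ideal \<subseteq> {p. (free_eval cst vX p :: 'n cher_gen free_alg) \<in> I}"
    unfolding skew_ideal_def
  proof (rule genideal_free_ring_subset)
    have "vX i * vX j + vX j * vX i \<in> I" if "i \<noteq> j" for i j :: 'n
      using that by (intro rels_I) (auto simp: cher_relators_def)
    then show "skew_relators \<subseteq> {p. (free_eval cst vX p :: 'n cher_gen free_alg) \<in> I}"
      by (auto simp: skew_relators_def vX.eval_add vX.eval_times vX.eval_var)
  qed (auto simp: carrier_UNIV vX.eval_add vX.eval_times vX.eval_zero intro: I_closed eval_vX_carrier)
  with assms show ?thesis by blast
qed

text \<open>Equality in the Verma module. \<open>J\<close> is a left ideal, so this is compatible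
  with sums and left multiplication; right multiplication is used only for differences in
  \<open>I\<close>, through \<open>cong_I_rmult\<close>.\<close>

definition cong :: "'n::finite cher_gen free_alg \<Rightarrow> 'n cher_gen free_alg \<Rightarrow> bool" (infix "\<approx>" 50) where
  "p \<approx> q \<longleftrightarrow> p - q \<in> J"

lemma cong_refl: "p \<approx> p"
  by (simp add: cong_def J_zero)

lemma cong_sym: "p \<approx> q \<Longrightarrow> q \<approx> p"
  unfolding cong_def using J_uminus by force

lemma cong_trans [trans]: "p \<approx> q \<Longrightarrow> q \<approx> r \<Longrightarrow> p \<approx> r"
  unfolding cong_def using J_add by force

lemma cong_add: "p \<approx> q \<Longrightarrow> p' \<approx> q' \<Longrightarrow> p + p' \<approx> q + q'"
  unfolding cong_def using J_add[of "p - q" "p' - q'"] by (simp add: algebra_simps)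

lemma cong_uminus: "p \<approx> q \<Longrightarrow> - p \<approx> - q"
  unfolding cong_def using J_uminus[of "p - q"] by (simp add: algebra_simps)

lemma cong_lmult: "p \<approx> q \<Longrightarrow> r \<in> carrier F \<Longrightarrow> r * p \<approx> r * q"
  unfolding cong_def using J_lmult[of r "p - q"] by (simp add: right_diff_distrib)

lemma cong_cst: "p \<approx> q \<Longrightarrow> cst z * p \<approx> cst z * q"
  by (rule cong_lmult) (auto intro: free_ring_carrier_intros)

lemma cong_sum: "(\<And>a. a \<in> A \<Longrightarrow> f a \<approx> g a) \<Longrightarrow> sum f A \<approx> sum g A"
  by (induction A rule: infinite_finite_induct) (auto intro: cong_refl cong_add)

lemma cong_I: "p - q \<in> I \<Longrightarrow> p \<approx> q"
  unfolding cong_def by (rule I_J)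

lemma cong_I_rmult: "p - q \<in> I \<Longrightarrow> r \<in> carrier F \<Longrightarrow> p * r \<approx> q * r"
  by (rule cong_I) (simp add: left_diff_distrib[symmetric] I_closed)

lemma emb_abs: "(emb (abs_spoly p) :: 'n::finite cher_gen free_alg) \<approx> free_eval cst vX p"
proof -
  have "rep_spoly (abs_spoly p) - p \<in> skew_ideal"
    by (simp add: abs_spoly_eq_iff[symmetric])
  from eval_vX_skew_ideal[OF this] show ?thesis
    by (intro cong_I) (simp add: emb_def vX.eval_diff)
qed

lemma emb_one: "(emb 1 :: 'n::finite cher_gen free_alg) \<approx> 1"
  using emb_abs[of 1] by (simp add: one_spoly.abs_eq[symmetric] vX.eval_one)

lemma emb_add: "(emb (f + g) :: 'n::finite cher_gen free_alg) \<approx> emb f + emb g"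
  using emb_abs[of "rep_spoly f + rep_spoly g"]
  by (simp add: plus_spoly.abs_eq[symmetric] vX.eval_add emb_def[symmetric])

lemma emb_const: "(emb (const z * f) :: 'n::finite cher_gen free_alg) \<approx> cst z * emb f"
  using emb_abs[of "cst z * rep_spoly f"]
  by (simp add: times_spoly.abs_eq[symmetric] const.abs_eq[symmetric] vX.eval_times vX.eval_cst emb_def[symmetric])

lemma emb_sx: "(emb (sx k * f) :: 'n::finite cher_gen free_alg) \<approx> vX k * emb f"
  using emb_abs[of "var k * rep_spoly f"]
  by (simp add: times_spoly.abs_eq[symmetric] sx.abs_eq[symmetric] vX.eval_times vX.eval_var emb_def[symmetric])

lemma emb_zero: "(emb 0 :: 'n::finite cher_gen free_alg) \<approx> 0"
  using emb_abs[of 0] by (simp add: zero_spoly.abs_eq[symmetric] vX.eval_zero)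

lemma emb_sum: "(emb (sum f A) :: 'n::finite cher_gen free_alg) \<approx> (\<Sum>a\<in>A. emb (f a))"
proof (induction A rule: infinite_finite_induct)
  case (insert x A)
  have "emb (sum f (insert x A)) \<approx> emb (f x) + emb (sum f A)"
    using insert.hyps by (simp add: emb_add)
  also have "\<dots> \<approx> (\<Sum>a\<in>insert x A. emb (f a))"
    using insert by (simp add: cong_add cong_refl)
  finally show ?case .
qed (simp_all add: emb_zero)

lemma emb_uminus: "(emb (- f) :: 'n::finite cher_gen free_alg) \<approx> - emb f"
  using emb_const[of "- 1" f] cst_mult[of "- 1" 1]
  by (simp add: const_uminus cst_def single_uminus)

lemma verma_of_eq: "verma_of s C C' c f = V (emb f)"
  by (simp add: verma_of_def V_def emb_def)

lemma V_cong: "p \<in> carrier F \<Longrightarrow> q \<in> carrier F \<Longrightarrow> V p = V q \<longleftrightarrow> p \<approx> q"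
  by (simp add: V_eq_iff cong_def)

section \<open>Moving \<open>w\<close> and y_i through skew polynomials to the cyclic vector\<close>

lemma borel_cong:
  assumes "b \<in> carrier (free_ring borel_gens)" shows "b \<approx> cst (triv_char b)"
proof -
  have "1 * b - 1 * cst (triv_char b) \<in> verma_gens"
    unfolding verma_gens_def using assms by (blast intro: free_ring_carrier_intros)
  then show ?thesis unfolding cong_def by (auto dest: verma_gens_J)
qed

lemma vW_cong_1:
  assumes "w \<in> W" shows "(vW w :: 'n::finite cher_gen free_alg) \<approx> 1"
proof -
  have "triv_char (vW w :: 'n cher_gen free_alg) = 1"
    by (simp add: triv_char_def free_eval_def var_def)
  with assms borel_cong[of "vW w :: 'n cher_gen free_alg"] show ?thesis
    by (simp add: free_ring_carrier_intros cst_one)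
qed

lemma vY_cong_0: "(vY i :: 'n::finite cher_gen free_alg) \<approx> 0"
proof -
  have "triv_char (vY i :: 'n cher_gen free_alg) = 0"
    by (simp add: triv_char_def free_eval_def var_def)
  with borel_cong[of "vY i :: 'n cher_gen free_alg"] show ?thesis
    by (simp add: free_ring_carrier_intros cst_def)
qed

lemma vW_vX:
  fixes i :: "'n::finite"
  assumes "w \<in> W"
  shows "vW w * vX i - (\<Sum>k\<in>UNIV. cst (w $ k $ i) * vX k) * vW w \<in> I"
proof -
  let ?u = "matrix_inv w" and ?R = "\<Sum>k\<in>UNIV. cst (w $ k $ i) * vX k :: 'n cher_gen free_alg"
  have u: "?u \<in> W" "?u ** w = mat 1"
    using assms W_inv W_mono_mats mono_mats_inv by blast+
  have "vW w * vX i * vW ?u - ?R \<in> I"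
    using assms by (intro rels_I) (auto simp: cher_relators_def)
  then have "(vW w * vX i * vW ?u - ?R) * vW w \<in> I"
    by (rule I_closed(4)) (rule gens_carrier(3)[OF assms])
  moreover have "vW ?u * vW w - vW (mat 1) \<in> I"
    using assms u by (intro rels_I) (auto simp: cher_relators_def simp flip: u(2))
  moreover have "vW (mat 1) - 1 \<in> (I :: 'n cher_gen free_alg set)"
    by (intro rels_I) (auto simp: cher_relators_def)
  \<comment> \<open>The conjugation relator is multiplied by \<open>w\<close> on the right; the two
    subtracted group relators reduce the product of the letters for \<open>w\<close>'s inverse and
    \<open>w\<close> to 1.\<close>
  ultimately have "(vW w * vX i * vW ?u - ?R) * vW w
      - vW w * vX i * ((vW ?u * vW w - vW (mat 1)) + (vW (mat 1) - 1)) \<in> I"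
    using assms gens_carrier
    by (intro I_closed(2)[OF _ I_closed(3)[OF I_closed(1)]] free_ring_carrier_closed(2)) auto
  then show ?thesis by (simp add: algebra_simps)
qed

text \<open>\<open>w\<close> moves to the right through the generators, transforming each of them,
  until the cyclic vector absorbs it by \<open>vW_cong_1\<close>.\<close>

lemma vW_emb:
  fixes f :: "'n::finite spoly"
  assumes "w \<in> W" shows "vW w * emb f \<approx> emb (skew_act w f)"
proof -
  have wm: "w \<in> mono_mats C" using assms W_mono_mats by blast
  note w = skew_act_mono_mats[OF wm]
  have cw: "vW w \<in> carrier F" using assms gens_carrier by blast
  show ?thesis
  proof (induction f rule: spoly_induct)
    case one
    have "vW w * emb 1 \<approx> vW w * 1" by (intro cong_lmult emb_one cw)
    also have "vW w * 1 \<approx> 1" using vW_cong_1[OF assms] by simp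
    also have "1 \<approx> emb 1" by (rule cong_sym[OF emb_one])
    finally show ?case by (simp add: w)
  next
    case (add f g)
    have "vW w * emb (f + g) \<approx> vW w * (emb f + emb g)" by (intro cong_lmult emb_add cw)
    also have "\<dots> = vW w * emb f + vW w * emb g" by (rule distrib_left)
    also have "\<dots> \<approx> emb (skew_act w f) + emb (skew_act w g)" by (intro cong_add add)
    also have "\<dots> \<approx> emb (skew_act w (f + g))" unfolding w by (rule cong_sym[OF emb_add])
    finally show ?case .
  next
    case (scale z f)
    have "vW w * emb (const z * f) \<approx> vW w * (cst z * emb f)" by (intro cong_lmult emb_const cw)
    also have "\<dots> = cst z * (vW w * emb f)" by (metis mult.assoc var_cst)
    also have "\<dots> \<approx> cst z * emb (skew_act w f)" by (intro cong_cst scale)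
    also have "\<dots> \<approx> emb (skew_act w (const z * f))" unfolding w by (rule cong_sym[OF emb_const])
    finally show ?case .
  next
    case (var k f)
    obtain \<pi> a where \<pi>: "w = mono_mat \<pi> a" "bij \<pi>" using wm by (auto simp: mono_mats_def)
    have "vW w * emb (sx k * f) \<approx> vW w * (vX k * emb f)" by (intro cong_lmult emb_sx cw)
    also have "\<dots> = vW w * vX k * emb f" by (rule mult.assoc[symmetric])
    also have "\<dots> \<approx> (\<Sum>r\<in>UNIV. cst (w $ r $ k) * vX r) * vW w * emb f"
      by (intro cong_I_rmult vW_vX assms emb_carrier)
    also have "(\<Sum>r\<in>UNIV. cst (w $ r $ k) * vX r) = cst (a k) * vX (\<pi> k)"
    proof -
      have "cst 0 = (0 :: 'n cher_gen free_alg)" by (simp add: cst_def)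
      then show ?thesis
        by (simp add: \<pi> mono_mat_nth if_distrib[where f = cst] if_distrib[where f = "\<lambda>x. x * _"] cong: if_cong)
    qed
    also have "cst (a k) * vX (\<pi> k) * vW w * emb f = cst (a k) * (vX (\<pi> k) * (vW w * emb f))"
      by (simp only: mult.assoc)
    also have "\<dots> \<approx> cst (a k) * (vX (\<pi> k) * emb (skew_act w f))"
      by (intro cong_cst cong_lmult var gens_carrier)
    also have "\<dots> \<approx> cst (a k) * emb (sx (\<pi> k) * skew_act w f)"
      by (intro cong_cst cong_sym[OF emb_sx])
    also have "\<dots> \<approx> emb (const (a k) * (sx (\<pi> k) * skew_act w f))"
      by (rule cong_sym[OF emb_const])
    finally show ?case using \<pi> by (simp add: skew_act_mono_mat bij_is_inj)
  qed
qed

text \<open>After y_i has passed x_k, the group elements of the relation meet \<open>emb f\<close>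
  and act by \<open>vW_emb\<close>. The sign \<open>s\<close> is still free; for
  \<open>s = - 1\<close> this is the rule of \<open>dunkl_op_neq\<close>.\<close>

lemma vY_emb_neq:
  fixes f :: "'n::finite spoly"
  assumes "k \<noteq> i"
  shows "vY i * emb (sx k * f) \<approx> - (vX k * (vY i * emb f)) + cst (s * c 1) * emb (sigma_sum k i f)"
proof -
  let ?r = "\<Sum>\<epsilon>\<in>C. cst \<epsilon> * vW (refl_sigma k i \<epsilon>) :: 'n cher_gen free_alg"
  have r: "vY i * vX k + vX k * vY i - cst (s * c 1) * ?r \<in> rels"
    unfolding cher_relators_def using assms by blast
  have "vY i * vX k - (- (vX k * vY i) + cst (s * c 1) * ?r) \<in> I"
    using rels_I[OF r] by (simp add: algebra_simps)
  then have "vY i * vX k * emb f \<approx> (- (vX k * vY i) + cst (s * c 1) * ?r) * emb f"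
    by (intro cong_I_rmult emb_carrier)
  then have 1: "vY i * vX k * emb f \<approx> - (vX k * (vY i * emb f)) + cst (s * c 1) * (?r * emb f)"
    by (simp only: distrib_right mult.assoc mult_minus_left)
  have "?r * emb f \<approx> emb (sigma_sum k i f)"
  proof -
    have "?r * emb f = (\<Sum>\<epsilon>\<in>C. cst \<epsilon> * (vW (refl_sigma k i \<epsilon>) * emb f))"
      by (simp add: sum_distrib_right mult.assoc)
    also have "\<dots> \<approx> (\<Sum>\<epsilon>\<in>C. cst \<epsilon> * emb (skew_act (refl_sigma k i \<epsilon>) f))"
      using assms by (intro cong_sum cong_cst vW_emb W_refl_sigma)
    also have "\<dots> \<approx> (\<Sum>\<epsilon>\<in>C. emb (const \<epsilon> * skew_act (refl_sigma k i \<epsilon>) f))"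
      by (intro cong_sum cong_sym[OF emb_const])
    also have "\<dots> \<approx> emb (sigma_sum k i f)"
      unfolding sigma_sum_def by (rule cong_sym[OF emb_sum])
    finally show ?thesis .
  qed
  then have 2: "- (vX k * (vY i * emb f)) + cst (s * c 1) * (?r * emb f) \<approx>
      - (vX k * (vY i * emb f)) + cst (s * c 1) * emb (sigma_sum k i f)"
    by (intro cong_add cong_refl cong_cst)
  have "vY i * emb (sx k * f) \<approx> vY i * vX k * emb f"
    unfolding mult.assoc by (intro cong_lmult emb_sx gens_carrier)
  from cong_trans[OF cong_trans[OF this 1] 2] show ?thesis .
qed

lemma vY_emb_self:
  fixes f :: "'n::finite spoly"
  shows "vY i * emb (sx i * f) \<approx> vX i * (vY i * emb f) + emb (refl_sum i f)"
proof -
  let ?p = "\<Sum>j\<in>UNIV - {i}. \<Sum>\<epsilon>\<in>C. vW (refl_sigma i j \<epsilon>) :: 'n cher_gen free_alg"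
  let ?q = "\<Sum>\<epsilon>\<in>C' - {1}. cst (c \<epsilon>) * vW (refl_t i \<epsilon>) :: 'n cher_gen free_alg"
  have r: "vY i * vX i - vX i * vY i - (1 + cst (c 1) * ?p + ?q) \<in> rels"
    unfolding cher_relators_def by blast
  have "vY i * vX i - (vX i * vY i + (1 + cst (c 1) * ?p + ?q)) \<in> I"
    using rels_I[OF r] by (simp add: algebra_simps)
  then have "vY i * vX i * emb f \<approx> (vX i * vY i + (1 + cst (c 1) * ?p + ?q)) * emb f"
    by (intro cong_I_rmult emb_carrier)
  then have 1: "vY i * vX i * emb f \<approx>
      vX i * (vY i * emb f) + (emb f + cst (c 1) * (?p * emb f) + ?q * emb f)"
    by (simp only: distrib_right mult.assoc mult_1_left)
  have p: "?p * emb f \<approx> emb (\<Sum>j\<in>UNIV - {i}. \<Sum>\<epsilon>\<in>C. skew_act (refl_sigma i j \<epsilon>) f)"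
  proof -
    have "?p * emb f = (\<Sum>j\<in>UNIV - {i}. \<Sum>\<epsilon>\<in>C. vW (refl_sigma i j \<epsilon>) * emb f)"
      by (simp add: sum_distrib_right)
    also have "\<dots> \<approx> (\<Sum>j\<in>UNIV - {i}. \<Sum>\<epsilon>\<in>C. emb (skew_act (refl_sigma i j \<epsilon>) f))"
      by (intro cong_sum vW_emb W_refl_sigma) auto
    also have "\<dots> \<approx> (\<Sum>j\<in>UNIV - {i}. emb (\<Sum>\<epsilon>\<in>C. skew_act (refl_sigma i j \<epsilon>) f))"
      by (intro cong_sum cong_sym[OF emb_sum])
    also have "\<dots> \<approx> emb (\<Sum>j\<in>UNIV - {i}. \<Sum>\<epsilon>\<in>C. skew_act (refl_sigma i j \<epsilon>) f)"
      by (rule cong_sym[OF emb_sum])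
    finally show ?thesis .
  qed
  have q: "?q * emb f \<approx> emb (\<Sum>\<epsilon>\<in>C' - {1}. const (c \<epsilon>) * skew_act (refl_t i \<epsilon>) f)"
  proof -
    have "?q * emb f = (\<Sum>\<epsilon>\<in>C' - {1}. cst (c \<epsilon>) * (vW (refl_t i \<epsilon>) * emb f))"
      by (simp add: sum_distrib_right mult.assoc)
    also have "\<dots> \<approx> (\<Sum>\<epsilon>\<in>C' - {1}. cst (c \<epsilon>) * emb (skew_act (refl_t i \<epsilon>) f))"
      by (intro cong_sum cong_cst vW_emb W_refl_t) auto
    also have "\<dots> \<approx> (\<Sum>\<epsilon>\<in>C' - {1}. emb (const (c \<epsilon>) * skew_act (refl_t i \<epsilon>) f))"
      by (intro cong_sum cong_sym[OF emb_const])
    also have "\<dots> \<approx> emb (\<Sum>\<epsilon>\<in>C' - {1}. const (c \<epsilon>) * skew_act (refl_t i \<epsilon>) f)"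
      by (rule cong_sym[OF emb_sum])
    finally show ?thesis .
  qed
  have "emb f + cst (c 1) * (?p * emb f) + ?q * emb f \<approx>
      emb f + emb (const (c 1) * (\<Sum>j\<in>UNIV - {i}. \<Sum>\<epsilon>\<in>C. skew_act (refl_sigma i j \<epsilon>) f))
       + emb (\<Sum>\<epsilon>\<in>C' - {1}. const (c \<epsilon>) * skew_act (refl_t i \<epsilon>) f)"
    by (intro cong_add cong_refl q cong_trans[OF cong_cst[OF p] cong_sym[OF emb_const]])
  also have "\<dots> \<approx> emb (f + const (c 1) * (\<Sum>j\<in>UNIV - {i}. \<Sum>\<epsilon>\<in>C. skew_act (refl_sigma i j \<epsilon>) f))
       + emb (\<Sum>\<epsilon>\<in>C' - {1}. const (c \<epsilon>) * skew_act (refl_t i \<epsilon>) f)"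
    by (intro cong_add cong_refl cong_sym[OF emb_add])
  also have "\<dots> \<approx> emb (refl_sum i f)"
    unfolding refl_sum_def by (rule cong_sym[OF emb_add])
  finally have 2: "vX i * (vY i * emb f) + (emb f + cst (c 1) * (?p * emb f) + ?q * emb f) \<approx>
      vX i * (vY i * emb f) + emb (refl_sum i f)"
    by (intro cong_add cong_refl)
  have "vY i * emb (sx i * f) \<approx> vY i * vX i * emb f"
    unfolding mult.assoc by (intro cong_lmult emb_sx gens_carrier)
  from cong_trans[OF cong_trans[OF this 1] 2] show ?thesis .
qed

end

section \<open>The action on the Verma module\<close>

context cherednik_algebra
begin

lemma skew_act_matrix_inv:
  assumes "w \<in> W" shows "skew_act w (skew_act (matrix_inv w) f) = f"
proof -
  have w: "w \<in> mono_mats C" using assms by (rule W_mono_mats)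
  show ?thesis
    unfolding skew_act_mono_mats_mult[OF w mono_mats_inv(1)[OF w], symmetric] mono_mats_inv(2)[OF w]
    by (rule skew_act_mat_1)
qed

lemma rels_cases:
  assumes "r \<in> (rels :: 'n::finite cher_gen free_alg set)"
  obtains
    (ww) v w where "v \<in> W" "w \<in> W" "r = vW v * vW w - vW (v ** w)"
  | (w1) "r = vW (mat 1) - 1"
  | (xx) i j where "i \<noteq> j" "r = vX i * vX j + vX j * vX i"
  | (yy) i j where "i \<noteq> j" "r = vY i * vY j + vY j * vY i"
  | (wx) w i where "w \<in> W" "r = vW w * vX i * vW (matrix_inv w) - (\<Sum>k\<in>UNIV. cst (w $ k $ i) * vX k)"
  | (wy) w i where "w \<in> W"
      "r = vW w * vY i * vW (matrix_inv w) - (\<Sum>k\<in>UNIV. cst (matrix_inv w $ i $ k) * vY k)"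
  | (yx) i j where "i \<noteq> j"
      "r = vY j * vX i + vX i * vY j - cst (s * c 1) * (\<Sum>\<epsilon>\<in>C. cst \<epsilon> * vW (refl_sigma i j \<epsilon>))"
  | (yx_same) i where "r = vY i * vX i - vX i * vY i
        - (1 + cst (c 1) * (\<Sum>j\<in>UNIV - {i}. \<Sum>\<epsilon>\<in>C. vW (refl_sigma i j \<epsilon>))
             + (\<Sum>\<epsilon>\<in>C' - {1}. cst (c \<epsilon>) * vW (refl_t i \<epsilon>)))"
  using assms unfolding cher_relators_def Un_iff mem_Collect_eq singleton_iff
  by (elim disjE exE conjE) (rule that; assumption)+

end

locale cherednik_dunkl = cherednik_algebra C C' c s + dunkl C C' c \<phi>
  for C C' :: "complex set" and c :: "complex \<Rightarrow> complex" and s :: complex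
    and \<phi> :: "'n::{finite,linorder} spoly \<Rightarrow> 'k::division_ring" +
  assumes s_cases: "s = 1 \<or> s = - 1"
begin

lemma sigma_sum_linear:
  assumes "i \<noteq> j"
  shows "sigma_sum i j (f + g) = sigma_sum i j f + sigma_sum i j g"
    and "sigma_sum i j (const z * f) = const z * sigma_sum i j f"
    and "sigma_sum i j 1 = (0 :: 'n spoly)"
proof -
  show "sigma_sum i j (f + g) = sigma_sum i j f + sigma_sum i j g"
    unfolding sigma_sum_def sum.distrib[symmetric]
    by (intro sum.cong refl) (simp add: skew_act_mono_mats refl_sigma_mono_mats distrib_left)
  show "sigma_sum i j (const z * f) = const z * sigma_sum i j f"
    unfolding sigma_sum_def sum_distrib_left
    by (intro sum.cong refl) (simp add: skew_act_mono_mats refl_sigma_mono_mats const_commute_left)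
  have "sigma_sum i j (1 :: 'n spoly) = (\<Sum>\<epsilon>\<in>C. const \<epsilon>)"
    unfolding sigma_sum_def
    by (intro sum.cong refl) (simp add: skew_act_mono_mats refl_sigma_mono_mats)
  also have "\<dots> = const (\<Sum>\<epsilon>\<in>C. \<epsilon>)" by (rule const_sum[symmetric])
  finally show "sigma_sum i j 1 = (0 :: 'n spoly)" by (simp add: sum_C)
qed

lemma emb_cong_add:
  fixes f g :: "'n spoly"
  assumes "p \<approx> emb f" "q \<approx> emb g" shows "p + q \<approx> emb (f + g)"
  using cong_trans[OF cong_add[OF assms] cong_sym[OF emb_add]] .

lemma emb_cong_const:
  fixes f :: "'n spoly"
  assumes "p \<approx> emb f" shows "cst z * p \<approx> emb (const z * f)"
  using cong_trans[OF cong_cst[OF assms] cong_sym[OF emb_const]] .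

lemma emb_cong_sx:
  fixes f :: "'n spoly"
  assumes "p \<approx> emb f" shows "vX k * p \<approx> emb (sx k * f)"
  using cong_trans[OF cong_lmult[OF assms gens_carrier(1)] cong_sym[OF emb_sx]] .

lemma emb_cong_uminus:
  fixes f :: "'n spoly"
  assumes "p \<approx> emb f" shows "- p \<approx> emb (- f)"
  using cong_trans[OF cong_uminus[OF assms] cong_sym[OF emb_uminus]] .

lemma vY_emb_add:
  fixes f g :: "'n spoly"
  assumes "vY i * emb f \<approx> emb f'" "vY i * emb g \<approx> emb g'"
  shows "vY i * emb (f + g) \<approx> emb (f' + g')"
proof -
  have "vY i * emb (f + g) \<approx> vY i * (emb f + emb g)" by (intro cong_lmult emb_add gens_carrier)
  also have "\<dots> = vY i * emb f + vY i * emb g" by (rule distrib_left)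
  also have "\<dots> \<approx> emb (f' + g')" by (intro emb_cong_add assms)
  finally show ?thesis .
qed

lemma vY_emb_one: "vY i * emb (1 :: 'n spoly) \<approx> emb 0"
proof -
  have "vY i * emb (1 :: 'n spoly) \<approx> vY i * 1" by (intro cong_lmult emb_one gens_carrier)
  also have "vY i * 1 \<approx> (0 :: 'n cher_gen free_alg)" using vY_cong_0 by simp
  also have "0 \<approx> emb (0 :: 'n spoly)" by (rule cong_sym[OF emb_zero])
  finally show ?thesis .
qed

lemma vY_emb_const:
  fixes f :: "'n spoly"
  assumes "vY i * emb f \<approx> emb g"
  shows "vY i * emb (const z * f) \<approx> emb (const z * g)"
proof -
  have "vY i * emb (const z * f) \<approx> vY i * (cst z * emb f)" by (intro cong_lmult emb_const gens_carrier)
  also have "\<dots> = cst z * (vY i * emb f)" by (metis mult.assoc var_cst)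
  also have "\<dots> \<approx> emb (const z * g)" by (intro emb_cong_const assms)
  finally show ?thesis .
qed

lemma vY_emb_sx_neq:
  fixes f :: "'n spoly"
  assumes "vY i * emb f \<approx> emb g" "k \<noteq> i"
  shows "vY i * emb (sx k * f) \<approx> emb (- (sx k * g) + const (s * c 1) * sigma_sum k i f)"
  using vY_emb_neq[OF assms(2)]
  by (rule cong_trans) (intro emb_cong_add emb_cong_uminus emb_cong_sx emb_cong_const assms cong_refl)

lemma vY_emb_sx_self:
  fixes f :: "'n spoly"
  assumes "vY i * emb f \<approx> emb g"
  shows "vY i * emb (sx i * f) \<approx> emb (sx i * g + refl_sum i f)"
  using vY_emb_self by (rule cong_trans) (intro emb_cong_add emb_cong_sx assms cong_refl)

text \<open>The factor \<open>c 1\<close> is part of the condition, so that no case distinction on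
  \<open>c 1 = 0\<close> arises.\<close>

definition annihilated :: "'n spoly set" where
  "annihilated = {f. emb (const (c 1) * f) \<approx> 0}"

lemma annihilated_closed:
  shows "f \<in> annihilated \<Longrightarrow> g \<in> annihilated \<Longrightarrow> f + g \<in> annihilated"
    and "f \<in> annihilated \<Longrightarrow> const z * f \<in> annihilated"
    and "f \<in> annihilated \<Longrightarrow> sx k * f \<in> annihilated"
    and "0 \<in> annihilated"
    and "f \<in> annihilated \<Longrightarrow> - f \<in> annihilated"
proof -
  show "f + g \<in> annihilated" if "f \<in> annihilated" "g \<in> annihilated"
    using that cong_trans[OF emb_add[of "const (c 1) * f" "const (c 1) * g"], of 0]
      cong_add[of "emb (const (c 1) * f)" 0 "emb (const (c 1) * g)" 0]
    by (simp add: annihilated_def distrib_left)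
  show *: "const z * f \<in> annihilated" if "f \<in> annihilated" for z f
    using that cong_trans[OF emb_const[of z "const (c 1) * f"], of 0]
      cong_cst[of "emb (const (c 1) * f)" 0 z]
    by (simp add: annihilated_def const_commute_left)
  show "sx k * f \<in> annihilated" if "f \<in> annihilated"
    using that cong_trans[OF emb_sx[of k "const (c 1) * f"], of 0]
      cong_lmult[of "emb (const (c 1) * f)" 0 "vX k"]
    by (simp add: annihilated_def sx_const_left gens_carrier)
  show "0 \<in> annihilated" by (simp add: annihilated_def emb_zero)
  show "- f \<in> annihilated" if "f \<in> annihilated"
    using *[of f "- 1"] that by (simp add: const_uminus)
qed

text \<open>For \<open>s = 1\<close>, compare \<open>y\<^sub>j (x\<^sub>k x\<^sub>j + x\<^sub>j x\<^sub>k) = 0\<close> with the same identity for the Dunkl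
  operator, which has the opposite sign in front of \<open>c\<^sub>1\<close>.\<close>

lemma sx_annihilated:
  assumes "s = 1" "j \<noteq> k" shows "sx k \<in> annihilated"
proof -
  let ?P = "refl_sum j (1 :: 'n spoly)" and ?S = "sigma_sum k j (sx j * 1 :: 'n spoly)"
  have kj: "k \<noteq> j" using assms(2) by simp
  have 0: "sx k * (sx j * 1) + sx j * (sx k * 1) = (0 :: 'n spoly)"
    using anticommute_sx[OF assms(2)] by simp
  have "vY j * emb (sx k * (sx j * 1)) \<approx> emb (- (sx k * (sx j * 0 + ?P)) + const (s * c 1) * ?S)"
    using assms(2) by (intro vY_emb_sx_neq vY_emb_sx_self vY_emb_one) auto
  moreover have "vY j * emb (sx j * (sx k * 1)) \<approx>
      emb (sx j * (- (sx k * 0) + const (s * c 1) * sigma_sum k j 1) + refl_sum j (sx k * 1))"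
    using assms(2) by (intro vY_emb_sx_neq vY_emb_sx_self vY_emb_one) auto
  ultimately have "vY j * emb (0 :: 'n spoly) \<approx>
      emb ((- (sx k * (sx j * 0 + ?P)) + const (s * c 1) * ?S) +
      (sx j * (- (sx k * 0) + const (s * c 1) * sigma_sum k j 1) + refl_sum j (sx k * 1)))"
    unfolding 0[symmetric] by (rule vY_emb_add)
  also have "(- (sx k * (sx j * 0 + ?P)) + const (s * c 1) * ?S) +
      (sx j * (- (sx k * 0) + const (s * c 1) * sigma_sum k j 1) + refl_sum j (sx k * 1)) =
      const (c 1) * ?S + (refl_sum j (sx k * 1) - sx k * ?P)"
    using assms by (simp add: sigma_sum_linear(3))
  also have "refl_sum j (sx k * 1) - sx k * ?P = const (c 1) * ?S"
  proof -
    have 1: "dunkl_op j (sx k * 1) = 0"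
      by (simp only: dunkl_op_neq[OF kj] dunkl_op_one sigma_sum_linear(3)[OF kj]) simp
    have 2: "dunkl_op j (sx k * (sx j * 1)) = - (sx k * ?P) - const (c 1) * ?S"
      by (simp only: dunkl_op_neq[OF kj] dunkl_op_self dunkl_op_one) simp
    have "dunkl_op j (sx k * (sx j * 1) + sx j * (sx k * 1)) = 0"
      unfolding 0 by (rule dunkl_op_zero)
    then show ?thesis
      unfolding dunkl_op_add dunkl_op_self 1 2 by (simp add: algebra_simps)
  qed
  \<comment> \<open>Each \<open>\<epsilon>\<close> contributes \<epsilon> (-1/\<epsilon>) x_k = -
    x_k, so nothing cancels and a nonzero multiple of x_k results.\<close>
  also have "?S = - (const (of_nat (card C)) * sx k)"
  proof -
    have "const \<epsilon> * skew_act (refl_sigma k j \<epsilon>) (sx j * 1) = - sx k" if "\<epsilon> \<in> C" for \<epsilon>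
      using that assms(2) C_nonzero[OF that]
      by (subst skew_act_refl_sigma)
         (auto simp: skew_act_mono_mats refl_sigma_mono_mats mult.assoc[symmetric] const_inverse)
    then show ?thesis by (simp add: sigma_sum_def const_of_nat)
  qed
  also have "const (c 1) * - (const (of_nat (card C)) * sx k) + const (c 1) * - (const (of_nat (card C)) * sx k)
      = const (- 2 * of_nat (card C)) * (const (c 1) * (sx k :: 'n spoly))"
    by (simp only: const_commute_left[of "c 1"] mult_minus_right minus_add_distrib[symmetric]
        mult_2 distrib_right const_add mult_minus_left const_uminus)
  finally have "emb (const (- 2 * of_nat (card C)) * (const (c 1) * (sx k :: 'n spoly))) \<approx> vY j * emb (0 :: 'n spoly)"
    by (rule cong_sym)
  also have "vY j * emb (0 :: 'n spoly) \<approx> vY j * 0" by (intro cong_lmult emb_zero gens_carrier)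
  finally have "const (- 2 * of_nat (card C)) * sx k \<in> annihilated"
    by (simp add: annihilated_def const_commute_left)
  then have "const (inverse (- 2 * of_nat (card C))) * (const (- 2 * of_nat (card C)) * sx k) \<in> annihilated"
    by (rule annihilated_closed(2))
  moreover have "- 2 * of_nat (card C) \<noteq> (0 :: complex)"
    using C_one finite_C by auto
  ultimately show ?thesis
    by (simp only: mult.assoc[symmetric] const_inverse mult_1_left not_False_eq_True)
qed

text \<open>\<open>i\<close> and \<open>j\<close> witness two distinct indices, so each
  \<open>k\<close> has a partner for \<open>sx_annihilated\<close>. Higher degrees follow by left
  multiplication.\<close>

lemma sx_times_annihilated:
  fixes i j k :: 'n
  assumes "s = 1" "j \<noteq> i" shows "sx k * f \<in> annihilated"
proof (induction f arbitrary: k rule: spoly_induct)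
  case one
  have "\<exists>j. j \<noteq> k" using assms(2) by metis
  then show ?case using sx_annihilated[OF assms(1)] by auto
qed (auto simp: distrib_left sx_const_left intro: annihilated_closed)

text \<open>Constants are sent to 0 because \<open>C\<close> sums to 0; on x_k f every summand is a
  scalar multiple of a product starting with a generator.\<close>

lemma sigma_sum_annihilated:
  assumes "s = 1" "i \<noteq> j" shows "sigma_sum i j f \<in> annihilated"
proof (induction f rule: spoly_induct)
  case one
  show ?case using annihilated_closed(4) by (simp add: sigma_sum_linear(3)[OF assms(2)])
next
  case (var k f)
  have sum: "sum g A \<in> annihilated" if "\<And>a. a \<in> A \<Longrightarrow> g a \<in> annihilated" for g :: "complex \<Rightarrow> 'n spoly" and A
    using that by (induction A rule: infinite_finite_induct) (auto intro: annihilated_closed)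
  have "skew_act (refl_sigma i j \<epsilon>) (sx k * f) \<in> annihilated" for \<epsilon>
    unfolding skew_act_refl_sigma[OF assms(2)]
    using annihilated_closed sx_times_annihilated[OF assms] by simp
  then show ?case
    unfolding sigma_sum_def by (intro sum annihilated_closed)
qed (auto simp: sigma_sum_linear[OF assms(2)] intro: annihilated_closed)

text \<open>Both sides obey the same recursion for \<open>s = - 1\<close>. For \<open>s = 1\<close>
  the recursions differ by 2 c_1 \<open>sigma_sum k i f\<close>, which vanishes in the Verma
  module.\<close>

lemma vY_emb: "vY i * emb f \<approx> emb (dunkl_op i f)"
proof (induction f rule: spoly_induct)
  case one
  show ?case unfolding dunkl_op_one by (rule vY_emb_one)
next
  case (add f g)
  show ?case unfolding dunkl_op_add by (rule vY_emb_add[OF add])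
next
  case (scale z f)
  show ?case unfolding dunkl_op_const by (rule vY_emb_const[OF scale])
next
  case (var k f)
  show ?case
  proof (cases "k = i")
    case True
    with vY_emb_sx_self[OF var] show ?thesis by (simp add: dunkl_op_self)
  next
    case False
    have *: "dunkl_op i (sx k * f) = - (sx k * dunkl_op i f) + const (- 1 * c 1) * sigma_sum k i f"
      using False by (simp add: dunkl_op_neq const_uminus)
    show ?thesis
    proof (cases "s = - 1")
      case True
      with vY_emb_sx_neq[OF var False] show ?thesis unfolding * by simp
    next
      case s: False
      with s_cases have s: "s = 1" by blast
      \<comment> \<open>The factor -2 is what turns the coefficient \<open>c 1\<close> into
        \<open>- c 1\<close>.\<close>
      have "const (- 2) * sigma_sum k i f \<in> annihilated"
        using sigma_sum_annihilated[OF s False] by (rule annihilated_closed)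
      then have 0: "emb (const (c 1) * (const (- 2) * sigma_sum k i f)) \<approx> 0"
        by (simp add: annihilated_def)
      let ?g = "- (sx k * dunkl_op i f) + const (s * c 1) * sigma_sum k i f"
      have "vY i * emb (sx k * f) \<approx> emb ?g + 0"
        using vY_emb_sx_neq[OF var False] by simp
      also have "\<dots> \<approx> emb (?g + const (c 1) * (const (- 2) * sigma_sum k i f))"
        by (intro emb_cong_add cong_refl cong_sym[OF 0])
      also have "?g + const (c 1) * (const (- 2) * sigma_sum k i f) = dunkl_op i (sx k * f)"
      proof -
        have "s * c 1 + c 1 * - 2 = - 1 * c 1" using s by simp
        then show ?thesis
          unfolding * by (simp only: add.assoc mult.assoc[symmetric] const_mult[symmetric]
              distrib_right[symmetric] const_add[symmetric])
      qed
      finally show ?thesis .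
    qed
  qed
qed

lemma verma_act_vY: "verma_act s C C' c (cl (vY i)) (verma_of s C C' c f) = verma_of s C C' c (dunkl_op i f)"
proof -
  have "verma_act s C C' c (cl (vY i)) (verma_of s C C' c f) = V (vY i * emb f)"
    unfolding verma_of_eq by (intro verma_act_V gens_carrier emb_carrier)
  also have "\<dots> = V (emb (dunkl_op i f))"
    by (subst V_cong) (auto intro: free_ring_carrier_intros gens_carrier emb_carrier vY_emb)
  finally show ?thesis by (simp add: verma_of_eq)
qed

section \<open>Surjectivity: every word applied to the cyclic vector is a skew polynomial\<close>

lemma word_cong_emb:
  assumes "set us \<subseteq> (gens :: 'n cher_gen set)"
  shows "\<exists>f :: 'n spoly. prod_list (map var us) \<approx> emb f"
  using assms
proof (induction us)
  case Nil
  show ?case using cong_sym[OF emb_one] by auto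
next
  case (Cons g us)
  then obtain f :: "'n spoly" where f: "prod_list (map var us) \<approx> emb f" by auto
  have g: "g \<in> gens" using Cons by simp
  have "var g * prod_list (map var us) \<approx> var g * emb f"
    using f g by (intro cong_lmult free_ring_carrier_intros)
  moreover have "\<exists>h :: 'n spoly. var g * emb f \<approx> emb h"
  proof (cases g)
    case (Xgen k)
    then show ?thesis using cong_sym[OF emb_sx] by blast
  next
    case (Wgen w)
    with g have "w \<in> W" by (auto simp: cher_gens_def)
    with Wgen show ?thesis using vW_emb by blast
  next
    case (Ygen k)
    then show ?thesis using vY_emb by blast
  qed
  ultimately show ?case using cong_trans by force
qed

lemma ex_emb:
  assumes "p \<in> carrier F" shows "\<exists>f :: 'n spoly. p \<approx> emb f"
proof -
  interpret free_alg_eval cst "var :: 'n cher_gen \<Rightarrow> _"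
    by standard (simp_all add: cst_add cst_mult cst_one var_cst)
  have words: "prod_list (map var us) = (Poly_Mapping.single (Word us) 1 :: 'n cher_gen free_alg)" for us
    by (induction us) (simp_all add: var_def mult_single plus_word_def zero_word_def[symmetric])
  \<comment> \<open>Evaluation at the letters themselves is the identity; it serves to write
    \<open>p\<close> as a finite combination of words.\<close>
  have "free_eval cst var q = q" for q :: "'n cher_gen free_alg"
  proof (induction q rule: poly_mapping_single_induct)
    case (single u z)
    show ?case by (simp add: free_eval_def words cst_def mult_single)
  qed (simp_all add: eval_zero eval_add)
  then have p: "p = (\<Sum>u\<in>Poly_Mapping.keys p. cst (Poly_Mapping.lookup p u) * prod_list (map var (letters u)))"
    unfolding free_eval_def by (rule sym)
  have summand: "\<exists>f :: 'n spoly. cst (Poly_Mapping.lookup p u) * prod_list (map var (letters u)) \<approx> emb f"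
    if "u \<in> Poly_Mapping.keys p" for u
  proof -
    from that assms have "set (letters u) \<subseteq> gens" by (simp add: free_ring_def)
    from word_cong_emb[OF this] show ?thesis using emb_cong_const by blast
  qed
  have "\<exists>f :: 'n spoly. (\<Sum>u\<in>U. cst (Poly_Mapping.lookup p u) * prod_list (map var (letters u))) \<approx> emb f"
    if "U \<subseteq> Poly_Mapping.keys p" for U
    using finite_subset[OF that finite_keys] that
  proof (induction U rule: finite_induct)
    case empty
    show ?case using cong_sym[OF emb_zero] by auto
  next
    case (insert u U)
    then obtain f :: "'n spoly"
      where f: "(\<Sum>u\<in>U. cst (Poly_Mapping.lookup p u) * prod_list (map var (letters u))) \<approx> emb f"
      by auto
    obtain g :: "'n spoly"
      where g: "cst (Poly_Mapping.lookup p u) * prod_list (map var (letters u)) \<approx> emb g"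
      using summand insert.prems by blast
    show ?case
      using emb_cong_add[OF g f] unfolding sum.insert[OF insert.hyps] by blast
  qed
  from this[OF subset_refl] show ?thesis unfolding p[symmetric] .
qed

lemma range_verma_of: "range (verma_of s C C' c :: 'n spoly \<Rightarrow> _) = verma s C C' c"
proof -
  have "V p \<in> range (\<lambda>f :: 'n spoly. V (emb f))" if p: "p \<in> carrier F" for p
  proof -
    obtain f :: "'n spoly" where "p \<approx> emb f" using ex_emb[OF p] by blast
    then have "V p = V (emb f)" using V_cong p emb_carrier by blast
    then show ?thesis by blast
  qed
  then have "range (\<lambda>f :: 'n spoly. V (emb f)) = V ` carrier F"
    using emb_carrier by blast
  then show ?thesis by (simp add: verma_eq verma_of_eq[abs_def])
qed

text \<open>Letters \<open>Wgen w\<close> with \<open>w\<close> outside \<open>W\<close> are not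
  generators of the algebra. They act as the identity so that every letter is linear, which
  \<open>skew_act\<close> of an arbitrary matrix need not be.\<close>

definition dunkl_rep :: "'n cher_gen \<Rightarrow> 'n spoly \<Rightarrow> 'n spoly" where
  "dunkl_rep g f = (case g of Xgen k \<Rightarrow> sx k * f | Wgen w \<Rightarrow> if w \<in> W then skew_act w f else f
     | Ygen k \<Rightarrow> dunkl_op k f)"

lemma dunkl_rep_simps:
  "dunkl_rep (Xgen k) f = sx k * f" "dunkl_rep (Ygen k) f = dunkl_op k f"
  "w \<in> W \<Longrightarrow> dunkl_rep (Wgen w) f = skew_act w f"
  by (simp_all add: dunkl_rep_def)

sublocale rep: free_alg_module "\<lambda>z. (*) (const z)" dunkl_rep
proof
  fix g :: "'n cher_gen" and v w :: "'n spoly" and z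
  show "dunkl_rep g (v + w) = dunkl_rep g v + dunkl_rep g w"
    by (simp add: dunkl_rep_def distrib_left skew_act_mono_mats W_mono_mats dunkl_op_add split: gen.split)
  show "dunkl_rep g (const z * v) = const z * dunkl_rep g v"
    by (simp add: dunkl_rep_def sx_const_left skew_act_mono_mats W_mono_mats dunkl_op_const split: gen.split)
qed (simp_all add: const_add const_mult distrib_left distrib_right mult.assoc)

text \<open>The hypothesis on \<open>s\<close> enters in the relation between y_j and x_i for
  distinct indices: the Dunkl operators satisfy it with the sign -1.\<close>

lemma rep_rels:
  assumes s: "s = - 1 \<or> c 1 = 0 \<or> CARD('n) = 1" and r: "r \<in> rels"
  shows "rep.act r v = 0"
proof -
  note simps = rep.act_diff rep.act_add rep.act_times rep.act_var rep.act_one rep.act_sum rep.act_cst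
    dunkl_rep_simps
  from r show ?thesis
  proof (cases rule: rels_cases)
    case (ww u w)
    then show ?thesis
      by (simp add: simps W_mult skew_act_mono_mats_mult W_mono_mats)
  next
    case w1
    then show ?thesis by (simp add: simps W_one skew_act_mat_1)
  next
    case (xx i j)
    then show ?thesis by (simp add: simps anticommute_sx_left[of i j])
  next
    case (yy i j)
    then show ?thesis by (simp add: simps dunkl_op_anticommute)
  next
    case (wx w i)
    obtain \<pi> a where \<pi>: "w = mono_mat \<pi> a" "bij \<pi>" "\<And>k. a k \<in> C"
      using W_mono_mats[OF wx(1)] by (auto simp: mono_mats_def)
    have "skew_act w (skew_act (matrix_inv w) v) = v"
      by (rule skew_act_matrix_inv[OF wx(1)])
    then have "skew_act w (sx i * skew_act (matrix_inv w) v) = const (a i) * (sx (\<pi> i) * v)"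
      using \<pi> by (simp add: skew_act_mono_mat bij_is_inj)
    moreover have "(\<Sum>k\<in>UNIV. const (w $ k $ i) * (sx k * v)) = const (a i) * (sx (\<pi> i) * v)"
      by (simp add: \<pi>(1) mono_mat_nth if_distrib[where f = const] if_distrib[where f = "\<lambda>x. x * _"] cong: if_cong)
    ultimately show ?thesis
      using wx W_inv[OF wx(1)] by (simp add: simps)
  next
    case (wy w i)
    obtain \<pi> a where \<pi>: "w = mono_mat \<pi> a" "bij \<pi>" "\<And>k. a k \<in> C"
      using W_mono_mats[OF wy(1)] by (auto simp: mono_mats_def)
    have "skew_act w (skew_act (matrix_inv w) v) = v"
      by (rule skew_act_matrix_inv[OF wy(1)])
    then have 1: "skew_act w (dunkl_op i (skew_act (matrix_inv w) v)) = const (inverse (a i)) * dunkl_op (\<pi> i) v"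
      using \<pi> by (simp add: skew_act_dunkl_op)
    \<comment> \<open>The inverse of a monomial matrix is monomial, so its row i has a single
      nonzero entry; this leaves one y in the contragredient image of y_i.\<close>
    have "matrix_inv w $ i $ k = (if k = \<pi> i then inverse (a i) else 0)" for k
      using \<pi> C_nonzero by (auto simp: matrix_inv_mono_mat mono_mat_nth bij_inv_eq_iff[OF \<pi>(2)] bij_is_inj)
    then have "(\<Sum>k\<in>UNIV. const (matrix_inv w $ i $ k) * dunkl_op k v) = const (inverse (a i)) * dunkl_op (\<pi> i) v"
      by (simp add: if_distrib[where f = const] if_distrib[where f = "\<lambda>x. x * _"] cong: if_cong)
    with 1 show ?thesis
      using wy W_inv[OF wy(1)] by (simp add: simps)
  next
    case (yx i j)
    \<comment> \<open>This relation has two distinct indices, so \<open>s = - 1\<close> or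
      \<open>c 1 = 0\<close> remains; either way \<open>s * c 1 = - c 1\<close>.\<close>
    have "CARD('n) \<noteq> 1"
      using yx(1) by (metis UNIV_I card_1_singletonE singletonD)
    with s have "const (s * c 1) = - (const (c 1) :: 'n spoly)"
      by (auto simp: const_uminus)
    with yx show ?thesis
      by (simp add: simps W_refl_sigma dunkl_op_neq sigma_sum_def)
  next
    case (yx_same i)
    have "(\<Sum>j\<in>UNIV - {i}. \<Sum>\<epsilon>\<in>C. dunkl_rep (Wgen (refl_sigma i j \<epsilon>)) v) =
        (\<Sum>j\<in>UNIV - {i}. \<Sum>\<epsilon>\<in>C. skew_act (refl_sigma i j \<epsilon>) v)"
      by (intro sum.cong refl dunkl_rep_simps(3) W_refl_sigma) auto
    moreover have "(\<Sum>\<epsilon>\<in>C' - {1}. const (c \<epsilon>) * dunkl_rep (Wgen (refl_t i \<epsilon>)) v) =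
        (\<Sum>\<epsilon>\<in>C' - {1}. const (c \<epsilon>) * skew_act (refl_t i \<epsilon>) v)"
      by (intro sum.cong refl arg_cong2[where f = "(*)"] dunkl_rep_simps(3) W_refl_t) auto
    ultimately show ?thesis
      using yx_same by (simp add: simps dunkl_op_self refl_sum_def)
  qed
qed

text \<open>The vector 1 spans a copy of the trivial character: \<open>W\<close> fixes it and the
  Dunkl operators kill it.\<close>

lemma rep_borel:
  assumes "b \<in> carrier (free_ring borel_gens)" shows "rep.act b 1 = const (triv_char b)"
proof -
  let ?\<chi> = "\<lambda>g :: 'n cher_gen. (case g of Wgen w \<Rightarrow> 1 | _ \<Rightarrow> 0) :: complex"
  have "foldr dunkl_rep us 1 = const (prod_list (map ?\<chi> us))" if "set us \<subseteq> borel_gens" for us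
    using that
  proof (induction us)
    case (Cons g us)
    have "dunkl_rep g (const z * 1) = const (?\<chi> g * z)" if "g \<in> borel_gens" for z
      using that
      by (auto simp: dunkl_rep_simps dunkl_op_const dunkl_op_one skew_act_mono_mats W_mono_mats
          simp del: mult_1_right) simp
    with Cons show ?case by simp
  qed simp
  with assms show ?thesis
    unfolding word_act_def triv_char_def free_eval_def const_sum
    by (intro sum.cong refl) (simp add: free_ring_def const_mult)
qed

text \<open>\<open>I\<close> acts by 0 on every vector, and \<open>verma_gens\<close> kills 1
  because \<open>b\<close> acts on 1 by its character; \<open>J_minimal\<close> does the
  rest.\<close>

lemma rep_J:
  assumes "s = - 1 \<or> c 1 = 0 \<or> CARD('n) = 1" "p \<in> J"
  shows "rep.act p 1 = 0"
proof -
  have "J \<subseteq> {p \<in> carrier F. rep.act p 1 = 0}"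
  proof (rule J_minimal)
    show "I \<subseteq> {p \<in> carrier F. rep.act p 1 = 0}"
      using rep.act_genideal[OF rels_carrier rep_rels[OF assms(1)]] ideal.Icarr[OF ideal_I] by auto
    show "verma_gens \<subseteq> {p \<in> carrier F. rep.act p 1 = 0}"
      using verma_gens_carrier
      by (auto simp: verma_gens_def rep.act_diff rep.act_times rep.act_cst rep_borel)
  qed (auto simp: rep.act_add rep.act_uminus intro: free_ring_carrier_intros)
  with assms(2) show ?thesis by blast
qed

text \<open>Acting on 1 is constant on congruence classes by \<open>rep_J\<close> and sends
  \<open>emb f\<close> back to \<open>f\<close>, which gives a left inverse.\<close>

lemma inj_verma_of:
  assumes "s = - 1 \<or> c 1 = 0 \<or> CARD('n) = 1"
  shows "inj (verma_of s C C' c :: 'n spoly \<Rightarrow> _)"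
proof -
  have cong: "rep.act p 1 = rep.act q 1" if "p \<approx> q" for p q
    using rep_J[OF assms, of "p - q"] that by (simp add: cong_def rep.act_diff)
  have emb: "rep.act (emb f) 1 = f" for f
  proof (induction f rule: spoly_induct)
    case one
    show ?case using cong[OF emb_one] by (simp add: rep.act_one)
  next
    case (add f g)
    then show ?case using cong[OF emb_add[of f g]] by (simp add: rep.act_add)
  next
    case (scale z f)
    then show ?case using cong[OF emb_const[of z f]] by (simp add: rep.act_times rep.act_cst)
  next
    case (var k f)
    then show ?case using cong[OF emb_sx[of k f]] by (simp add: rep.act_times rep.act_var dunkl_rep_simps)
  qed
  show ?thesis
  proof (rule injI)
    fix f g :: "'n spoly" assume "verma_of s C C' c f = verma_of s C C' c g"
    then have "emb f \<approx> (emb g :: 'n cher_gen free_alg)"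
      unfolding verma_of_eq using V_cong emb_carrier by blast
    from cong[OF this] show "f = g" by (simp add: emb)
  qed
qed

end

theorem theorem0p3:
  fixes C C' :: "complex set" and c :: "complex \<Rightarrow> complex" and s :: complex
    and \<phi> :: "'n::{finite,linorder} spoly \<Rightarrow> 'k::division_ring"
  assumes "subgroup C cstar" and "finite C"
    and "subgroup C' cstar" and "finite C'"
    and "C' \<subseteq> C" and "- 1 \<in> C"
    and "s = 1 \<or> s = - 1"
    and "skew_field_of_fractions \<phi>"
  shows "range (verma_of s C C' c :: 'n spoly \<Rightarrow> _) = verma s C C' c
    \<and> (s = - 1 \<or> c 1 = 0 \<or> CARD('n) = 1 \<longrightarrow> inj (verma_of s C C' c :: 'n spoly \<Rightarrow> _))
    \<and> (\<forall>(i::'n) f. \<exists>g. \<phi> g = braided_dunkl \<phi> C C' c i f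
         \<and> verma_act s C C' c (cher_cls s C C' c (vY i)) (verma_of s C C' c f) = verma_of s C C' c g)"
proof -
  have "parameters C C'" by (rule parameters.intro) fact+
  moreover have "fraction_field \<phi>" by (rule fraction_field.intro) fact
  ultimately interpret cherednik_dunkl C C' c s \<phi>
    using \<open>s = 1 \<or> s = - 1\<close>
    by (intro cherednik_dunkl.intro cherednik_algebra.intro dunkl.intro cherednik_dunkl_axioms.intro)
  have "\<exists>g. \<phi> g = braided_dunkl \<phi> C C' c i f
      \<and> verma_act s C C' c (cher_cls s C C' c (vY i)) (verma_of s C C' c f) = verma_of s C C' c g" for i f
    by (intro exI[of _ "dunkl_op i f"] conjI phi_dunkl_op verma_act_vY)
  then show ?thesis
    by (intro conjI allI impI range_verma_of inj_verma_of)
qed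

end
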